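(* Let $(R,\mathfrak m)$ be a one-dimensional Noetherian Cohen-Macaulay local ring possessing a canonical module $\omega_R$, with total ring of fractions $Q(R)$ and integral closure $\overline R$ of $R$ in $Q(R)$. Suppose that: (a) there is an $R$-submodule $C$ of $Q(R)$ with $R\subseteq C\subseteq\overline R$ and $C\cong\omega_R$; (b) $\overline R$ is finitely generated as an $R$-module; (c) $\overline R$ is a local ring; (d) there is a non-zerodivisor $a\in\mathfrak m$ such that $(a)$ is a reduction of $\mathfrak m$. If $R$ is a far-flung Gorenstein ring, then the inequalities \[ \mathrm r(R)+1\le \mathrm e(R)\le \binom{\mathrm r(R)+1}{2} \] hold.
   Context: For a finitely generated $R$-module $M$, the trace ideal is $\mathrm{tr}_R(M)=\sum_{f\in\mathrm{Hom}_R(M,R)}\mathrm{Im}\,f\subseteq R$. For fractional ideals $I,J$ (finitely generated $R$-submodules of $Q(R)$ containing a non-zerodivisor of $R$), $I:J=\{\alpha\in Q(R): \alpha J\subseteq I\}$. A ring $R$ satisfying (a) and (b) is called far-flung Gorenstein if $\mathrm{tr}_R(\omega_R)=R:\overline R$. $\mathrm e(R)$ denotes the (Hilbert-Samuel) multiplicity of $R$ with respect to $\mathfrak m$, and $\mathrm r(R)$ denotes the Cohen-Macaulay type of $R$ (equal to the minimal number of generators of $\omega_R$).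
   Formalization: The formal theorem additionally assumes that R is not integrally closed (R is different from its integral closure); this excludes exactly the discrete valuation rings, where r(R)=e(R)=1 and the lower bound fails. *)

theory Defs
  imports Complex_Main "HOL-Library.Extended_Nat" "HOL-Algebra.Ring_Divisibility"
    "HOL-Algebra.Ideal_Product" "HOL-Algebra.Subrings" "HOL-Algebra.Module"
begin

section \<open>Modules over a commutative ring\<close>

text \<open>The fields \<open>mult\<close> and \<open>one\<close> of a module record are irrelevant for its module structure;
  below they are filled with arbitrary values.\<close>

definition ring_module :: "('a, 'b) ring_scheme \<Rightarrow> 'a set \<Rightarrow> ('a, 'a) module" where
  \<comment> \<open>an additive subgroup \<open>C\<close> of the ring \<open>Q\<close>, as a module over a subring of \<open>Q\<close> acting by
    multiplication; in particular, \<open>ring_module R (carrier R)\<close> is \<open>R\<close> as a module over itself\<close>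
  "ring_module Q C =
     \<lparr>carrier = C, monoid.mult = monoid.mult Q, one = one Q, zero = zero Q, add = add Q, smult = monoid.mult Q\<rparr>"

definition generated_submodule ::
    "('a, 'b) ring_scheme \<Rightarrow> ('a, 'm, 'c) module_scheme \<Rightarrow> 'm set \<Rightarrow> 'm set" where
  "generated_submodule R M S = \<Inter>{N. submodule N R M \<and> S \<subseteq> N}"

definition finitely_generated_module ::
    "('a, 'b) ring_scheme \<Rightarrow> ('a, 'm, 'c) module_scheme \<Rightarrow> bool" where
  "finitely_generated_module R M \<longleftrightarrow>
     (\<exists>S. finite S \<and> S \<subseteq> carrier M \<and> generated_submodule R M S = carrier M)"

definition module_hom ::
    "('a, 'b) ring_scheme \<Rightarrow> ('a, 'm, 'c) module_scheme \<Rightarrow> ('a, 'n, 'd) module_scheme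
      \<Rightarrow> ('m \<Rightarrow> 'n) set" where
  \<comment> \<open>homomorphisms are extensional, so that distinct elements of this set are distinct maps\<close>
  "module_hom R M N =
     {f \<in> carrier M \<rightarrow>\<^sub>E carrier N.
        (\<forall>x\<in>carrier M. \<forall>y\<in>carrier M. f (x \<oplus>\<^bsub>M\<^esub> y) = f x \<oplus>\<^bsub>N\<^esub> f y) \<and>
        (\<forall>r\<in>carrier R. \<forall>x\<in>carrier M. f (r \<odot>\<^bsub>M\<^esub> x) = r \<odot>\<^bsub>N\<^esub> f x)}"

definition module_iso ::
    "('a, 'b) ring_scheme \<Rightarrow> ('a, 'm, 'c) module_scheme \<Rightarrow> ('a, 'n, 'd) module_scheme
      \<Rightarrow> bool" where
  "module_iso R M N \<longleftrightarrow> (\<exists>f\<in>module_hom R M N. bij_betw f (carrier M) (carrier N))"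

definition hom_module ::
    "('a, 'b) ring_scheme \<Rightarrow> ('a, 'm, 'c) module_scheme \<Rightarrow> ('a, 'n, 'd) module_scheme
      \<Rightarrow> ('a, 'm \<Rightarrow> 'n) module" where
  "hom_module R M N =
     \<lparr>carrier = module_hom R M N, monoid.mult = undefined, one = undefined,
      zero = (\<lambda>x\<in>carrier M. \<zero>\<^bsub>N\<^esub>),
      add = (\<lambda>f g. \<lambda>x\<in>carrier M. f x \<oplus>\<^bsub>N\<^esub> g x),
      smult = (\<lambda>r f. \<lambda>x\<in>carrier M. r \<odot>\<^bsub>N\<^esub> f x)\<rparr>"

definition quot_module :: "('a, 'm, 'c) module_scheme \<Rightarrow> 'm set \<Rightarrow> ('a, 'm set) module" where
  "quot_module M N =
     \<lparr>carrier = a_rcosets\<^bsub>M\<^esub> N, monoid.mult = undefined, one = undefined,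
      zero = N, add = set_add M,
      smult = (\<lambda>r X. \<Union>x\<in>X. N +>\<^bsub>M\<^esub> (r \<odot>\<^bsub>M\<^esub> x))\<rparr>"

definition module_length ::
    "('a, 'b) ring_scheme \<Rightarrow> ('a, 'm, 'c) module_scheme \<Rightarrow> enat" where
  "module_length R M =
     Sup {enat n |n. \<exists>N. (\<forall>i\<le>n. submodule (N i) R M) \<and> (\<forall>i<n. N i \<subset> N (Suc i))}"

definition free_module :: "('a, 'b) ring_scheme \<Rightarrow> nat \<Rightarrow> ('a, nat \<Rightarrow> 'a) module" where
  "free_module R n =
     \<lparr>carrier = {..<n} \<rightarrow>\<^sub>E carrier R, monoid.mult = undefined, one = undefined,
      zero = (\<lambda>i\<in>{..<n}. \<zero>\<^bsub>R\<^esub>),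
      add = (\<lambda>v w. \<lambda>i\<in>{..<n}. v i \<oplus>\<^bsub>R\<^esub> w i),
      smult = (\<lambda>r v. \<lambda>i\<in>{..<n}. r \<otimes>\<^bsub>R\<^esub> v i)\<rparr>"


section \<open>Ext\<close>

definition free_resolution ::
    "('a, 'b) ring_scheme \<Rightarrow> ('a, 'm, 'c) module_scheme \<Rightarrow> (nat \<Rightarrow> nat)
      \<Rightarrow> ((nat \<Rightarrow> 'a) \<Rightarrow> 'm) \<Rightarrow> (nat \<Rightarrow> (nat \<Rightarrow> 'a) \<Rightarrow> (nat \<Rightarrow> 'a)) \<Rightarrow> bool" where
  \<comment> \<open>\<open>\<dots> \<rightarrow> R^(n 2) \<rightarrow> R^(n 1) \<rightarrow> R^(n 0) \<rightarrow> M \<rightarrow> 0\<close> is exact, where \<open>d i\<close> is the map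
    \<open>R^(n (i + 1)) \<rightarrow> R^(n i)\<close> and \<open>e\<close> is the augmentation \<open>R^(n 0) \<rightarrow> M\<close>\<close>
  "free_resolution R M n e d \<longleftrightarrow>
     e \<in> module_hom R (free_module R (n 0)) M \<and>
     e ` carrier (free_module R (n 0)) = carrier M \<and>
     (\<forall>i. d i \<in> module_hom R (free_module R (n (Suc i))) (free_module R (n i))) \<and>
     d 0 ` carrier (free_module R (n 1)) = {v \<in> carrier (free_module R (n 0)). e v = \<zero>\<^bsub>M\<^esub>} \<and>
     (\<forall>i. d (Suc i) ` carrier (free_module R (n (Suc (Suc i)))) =
        {v \<in> carrier (free_module R (n (Suc i))). d i v = \<zero>\<^bsub>free_module R (n i)\<^esub>})"

definition cocycles ::
    "('a, 'b) ring_scheme \<Rightarrow> (nat \<Rightarrow> nat) \<Rightarrow> (nat \<Rightarrow> (nat \<Rightarrow> 'a) \<Rightarrow> (nat \<Rightarrow> 'a))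
      \<Rightarrow> ('a, 'm, 'c) module_scheme \<Rightarrow> nat \<Rightarrow> ((nat \<Rightarrow> 'a) \<Rightarrow> 'm) set" where
  "cocycles R n d M i =
     {f \<in> module_hom R (free_module R (n i)) M.
        \<forall>v\<in>carrier (free_module R (n (Suc i))). f (d i v) = \<zero>\<^bsub>M\<^esub>}"

fun coboundaries ::
    "('a, 'b) ring_scheme \<Rightarrow> (nat \<Rightarrow> nat) \<Rightarrow> (nat \<Rightarrow> (nat \<Rightarrow> 'a) \<Rightarrow> (nat \<Rightarrow> 'a))
      \<Rightarrow> ('a, 'm, 'c) module_scheme \<Rightarrow> nat \<Rightarrow> ((nat \<Rightarrow> 'a) \<Rightarrow> 'm) set" where
  "coboundaries R n d M 0 = {\<lambda>v\<in>carrier (free_module R (n 0)). \<zero>\<^bsub>M\<^esub>}"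
| "coboundaries R n d M (Suc i) =
     (\<lambda>g. \<lambda>v\<in>carrier (free_module R (n (Suc i))). g (d i v)) `
       module_hom R (free_module R (n i)) M"

definition ext_module ::
    "('a, 'b) ring_scheme \<Rightarrow> ('a, 'n, 'd) module_scheme \<Rightarrow> ('a, 'm, 'c) module_scheme \<Rightarrow> nat
      \<Rightarrow> ('a, ((nat \<Rightarrow> 'a) \<Rightarrow> 'm) set) module" where
  \<comment> \<open>\<open>Ext^i_R(N, M)\<close>, as the cohomology of \<open>Hom_R(F, M)\<close> for some resolution \<open>F\<close> of \<open>N\<close> by
    finitely generated free modules. Such a resolution exists if \<open>R\<close> is Noetherian and \<open>N\<close> is
    finitely generated, and up to isomorphism the result does not depend on it.\<close>
  "ext_module R N M i =
     (let (n, d) = (SOME (n, d). \<exists>e. free_resolution R N n e d)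
      in quot_module
           ((hom_module R (free_module R (n i)) M)\<lparr>carrier := cocycles R n d M i\<rparr>)
           (coboundaries R n d M i))"


section \<open>Local rings and their invariants\<close>

definition local_ring :: "('a, 'b) ring_scheme \<Rightarrow> 'a set \<Rightarrow> bool" where
  "local_ring R \<mm> \<longleftrightarrow>
     cring R \<and> maximalideal \<mm> R \<and> (\<forall>\<nn>. maximalideal \<nn> R \<longrightarrow> \<nn> = \<mm>)"

definition nonzerodivisors :: "('a, 'b) ring_scheme \<Rightarrow> 'a set" where
  "nonzerodivisors R =
     {s \<in> carrier R. \<forall>x\<in>carrier R. s \<otimes>\<^bsub>R\<^esub> x = \<zero>\<^bsub>R\<^esub> \<longrightarrow> x = \<zero>\<^bsub>R\<^esub>}"

definition krull_dim :: "('a, 'b) ring_scheme \<Rightarrow> enat" where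
  "krull_dim R =
     Sup {enat n |n. \<exists>P. (\<forall>i\<le>n. primeideal (P i) R) \<and> (\<forall>i<n. P i \<subset> P (Suc i))}"

definition regular_sequence :: "('a, 'b) ring_scheme \<Rightarrow> 'a list \<Rightarrow> bool" where
  "regular_sequence R xs \<longleftrightarrow>
     set xs \<subseteq> carrier R \<and> Idl\<^bsub>R\<^esub> (set xs) \<noteq> carrier R \<and>
     (\<forall>i<length xs. let I = Idl\<^bsub>R\<^esub> (set (take i xs))
                    in I +>\<^bsub>R\<^esub> (xs ! i) \<in> nonzerodivisors (R Quot I))"

definition depth :: "('a, 'b) ring_scheme \<Rightarrow> 'a set \<Rightarrow> enat" where
  "depth R \<mm> = Sup {enat (length xs) |xs. regular_sequence R xs \<and> set xs \<subseteq> \<mm>}"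

definition cohen_macaulay :: "('a, 'b) ring_scheme \<Rightarrow> 'a set \<Rightarrow> bool" where
  "cohen_macaulay R \<mm> \<longleftrightarrow> depth R \<mm> = krull_dim R"

definition residue_module :: "('a, 'b) ring_scheme \<Rightarrow> 'a set \<Rightarrow> ('a, 'a set) module" where
  "residue_module R \<mm> = quot_module (ring_module R (carrier R)) \<mm>"

definition bass_number ::
    "('a, 'b) ring_scheme \<Rightarrow> 'a set \<Rightarrow> ('a, 'm, 'c) module_scheme \<Rightarrow> nat \<Rightarrow> enat" where
  \<comment> \<open>\<open>dim_k Ext^i_R(k, M)\<close> for \<open>k = R/\<mm>\<close>; as \<open>\<mm>\<close> annihilates \<open>Ext^i_R(k, M)\<close>, its
    \<open>R\<close>-submodules are its \<open>k\<close>-subspaces, and the dimension over \<open>k\<close> is the length over \<open>R\<close>\<close>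
  "bass_number R \<mm> M i = module_length R (ext_module R (residue_module R \<mm>) M i)"

definition cm_type :: "('a, 'b) ring_scheme \<Rightarrow> 'a set \<Rightarrow> nat" where
  "cm_type R \<mm> = the_enat (bass_number R \<mm> (ring_module R (carrier R)) (the_enat (depth R \<mm>)))"

definition canonical_module ::
    "('a, 'b) ring_scheme \<Rightarrow> 'a set \<Rightarrow> ('a, 'm, 'c) module_scheme \<Rightarrow> bool" where
  \<comment> \<open>for a Cohen-Macaulay local ring \<open>(R, \<mm>)\<close> of dimension \<open>d\<close>: a finitely generated module \<open>W\<close>
    with \<open>dim_k Ext^i_R(k, W) = \<delta>_{id}\<close> for all \<open>i\<close>, i.e. a maximal Cohen-Macaulay module of
    type 1 and finite injective dimension\<close>
  "canonical_module R \<mm> W \<longleftrightarrow>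
     module R W \<and> finitely_generated_module R W \<and>
     (\<forall>i. bass_number R \<mm> W i = (if enat i = krull_dim R then 1 else 0))"

definition hs_multiplicity :: "('a, 'b) ring_scheme \<Rightarrow> 'a set \<Rightarrow> real" where
  \<comment> \<open>\<open>lim d! \<ell>(R/\<mm>^n) / n^d\<close> with \<open>d = dim R\<close>\<close>
  "hs_multiplicity R \<mm> =
     (let d = the_enat (krull_dim R)
      in lim (\<lambda>n. fact d * real (the_enat (module_length R
                (quot_module (ring_module R (carrier R)) (\<mm> [^]\<^bsub>ideals_set R\<^esub> n)))) / real n ^ d))"

definition reduction_of :: "('a, 'b) ring_scheme \<Rightarrow> 'a set \<Rightarrow> 'a set \<Rightarrow> bool" where
  \<comment> \<open>\<open>J\<close> is a reduction of \<open>I\<close>\<close>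
  "reduction_of R J I \<longleftrightarrow>
     ideal J R \<and> ideal I R \<and> J \<subseteq> I \<and>
     (\<exists>n::nat. I [^]\<^bsub>ideals_set R\<^esub> Suc n = J \<cdot>\<^bsub>R\<^esub> (I [^]\<^bsub>ideals_set R\<^esub> n))"


section \<open>Total rings of fractions and far-flung Gorenstein rings\<close>

definition total_ring_of_fractions ::
    "('a, 'b) ring_scheme \<Rightarrow> ('a, 'b) ring_scheme \<Rightarrow> bool" where
  \<comment> \<open>\<open>Q\<close> is the localization of \<open>R\<close> at its non-zerodivisors, and \<open>R\<close> is identified with its
    image in \<open>Q\<close>, i.e. it is a subring of \<open>Q\<close>\<close>
  "total_ring_of_fractions R Q \<longleftrightarrow>
     cring Q \<and> subcring (carrier R) Q \<and> R = Q\<lparr>carrier := carrier R\<rparr> \<and>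
     nonzerodivisors R \<subseteq> Units Q \<and>
     (\<forall>q\<in>carrier Q. \<exists>r\<in>carrier R. \<exists>s\<in>nonzerodivisors R. q = r \<otimes>\<^bsub>Q\<^esub> inv\<^bsub>Q\<^esub> s)"

definition integral_closure ::
    "('a, 'b) ring_scheme \<Rightarrow> ('a, 'b) ring_scheme \<Rightarrow> 'a set" where
  "integral_closure R Q =
     {q \<in> carrier Q. \<exists>n::nat. \<exists>c. (\<forall>i<n. c i \<in> carrier R) \<and>
        q [^]\<^bsub>Q\<^esub> n \<oplus>\<^bsub>Q\<^esub> (\<Oplus>\<^bsub>Q\<^esub>i\<in>{..<n}. c i \<otimes>\<^bsub>Q\<^esub> q [^]\<^bsub>Q\<^esub> i) = \<zero>\<^bsub>Q\<^esub>}"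

definition frac_colon :: "('a, 'b) ring_scheme \<Rightarrow> 'a set \<Rightarrow> 'a set \<Rightarrow> 'a set" where
  "frac_colon Q I J = {q \<in> carrier Q. \<forall>x\<in>J. q \<otimes>\<^bsub>Q\<^esub> x \<in> I}"

definition trace_ideal ::
    "('a, 'b) ring_scheme \<Rightarrow> ('a, 'm, 'c) module_scheme \<Rightarrow> 'a set" where
  \<comment> \<open>the sum of a family of ideals is the ideal generated by their union\<close>
  "trace_ideal R M =
     Idl\<^bsub>R\<^esub> (\<Union>f\<in>module_hom R M (ring_module R (carrier R)). f ` carrier M)"

definition far_flung_gorenstein ::
    "('a, 'b) ring_scheme \<Rightarrow> ('a, 'b) ring_scheme \<Rightarrow> ('a, 'm, 'c) module_scheme \<Rightarrow> bool" where
  \<comment> \<open>\<open>Q\<close> is the total ring of fractions and \<open>W\<close> the canonical module of \<open>R\<close>; only used if \<open>W\<close> is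
    isomorphic to some \<open>C\<close> between \<open>R\<close> and its integral closure, and the latter is finite over \<open>R\<close>\<close>
  "far_flung_gorenstein R Q W \<longleftrightarrow>
     trace_ideal R W = frac_colon Q (carrier R) (integral_closure R Q)"

end

theory Submission
  imports Defs
begin

text \<open>
  Write \<open>S\<close> for the integral closure, \<open>\<ell>\<close> for length, \<open>X\<^sup>* = C : X\<close>, and \<open>e = \<ell>(R/aR)\<close>, which is \<open>e(R)\<close> because
  \<open>\<mm>\<^sup>n\<^sup>+\<^sup>1 = a \<mm>\<^sup>n\<close> for large \<open>n\<close>; also \<open>\<ell>(X/aX) = e\<close> for every fractional ideal \<open>X\<close>. As multiplication
  by \<open>a\<close> is bijective on \<open>Q\<close> and zero on \<open>R/\<mm>\<close>, the module \<open>Ext\<^sup>1(R/\<mm>, X)\<close> is \<open>(X : \<mm>)/X\<close>.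

  Hence \<open>(C : \<mm>)/C\<close> has length 1, which gives \<open>\<ell>(X\<^sup>*/Y\<^sup>*) \<le> \<ell>(Y/X)\<close> for \<open>X \<subseteq> Y\<close>. For \<open>X = a\<^sup>n Y\<close> both sides
  equal \<open>n e\<close>, so equality holds throughout, and \<open>X\<^sup>*\<^sup>* = X\<close>.

  Duality turns the far-flung condition \<open>tr(\<omega>) = R : S\<close> into \<open>C\<^sup>2 = S\<close>, and it shows that \<open>C\<close> is generated by
  \<open>r = \<ell>((R : \<mm>)/R)\<close> elements modulo \<open>\<mm>C\<close>. Since \<open>x/a\<close> is integral for \<open>x \<in> \<mm>\<close>, we have \<open>\<mm>S = aS\<close>, so
  the products of pairs of these elements generate \<open>S/aS\<close>, a vector space over \<open>R/\<mm>\<close> of dimension \<open>e\<close>.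
  The lower bound holds because \<open>R : \<mm>\<close> is a proper submodule of \<open>a\<^sup>-\<^sup>1R\<close> unless \<open>\<mm> = aR\<close>, in which case \<open>R\<close>
  is integrally closed.
\<close>

section \<open>Lengths of families of sets\<close>

text \<open>All comparisons take place between submodules of the single module Q, so the length of
  Y/X is taken as the supremum of strict chains between X and Y; quotients occur only where Ext and
  the multiplicity are defined by them. Powers of a serve as the only denominators: every
  non-zero-divisor of R divides one, so any two fractional ideals X, Y satisfy a^n Y \<subseteq> X
  for some n. This makes all lengths involved finite and lets them be cancelled.

  The equality C^2 = S comes from C : C^2 = (C : C) : C = R : C \<subseteq> R : S \<subseteq> C : S
  by dualizing once more. The inclusion R : C \<subseteq> R : S is all that the far-flung condition
  contributes: as 1 lies in C, each q in R : C is the value at 1 of a homomorphism from C to R,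
  hence lies in the trace ideal. The binomial coefficient counts unordered pairs, with repetition,
  of r generators of C modulo \<mm>C.

  The lower bound fails for a discrete valuation ring, where r = e = 1. The assumption that S
  differs from R excludes this case.\<close>

definition has_chain :: "'a set set \<Rightarrow> nat \<Rightarrow> bool" where
  "has_chain I n \<longleftrightarrow> (\<exists>N. (\<forall>i\<le>n. N i \<in> I) \<and> (\<forall>i<n. N i \<subset> N (Suc i)))"

text \<open>Abstracting from submodules to arbitrary families of sets lets chains be transported
  between different modules, and types, by any strictly monotone map.\<close>

definition chain_length :: "'a set set \<Rightarrow> enat" where
  "chain_length I = Sup {enat n |n. has_chain I n}"

lemma has_chain_antimono:
  assumes "has_chain I n" "m \<le> n"
  shows "has_chain I m"
proof -
  obtain N where N: "\<forall>i\<le>n. N i \<in> I" "\<forall>i<n. N i \<subset> N (Suc i)"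
    using assms(1) unfolding has_chain_def by blast
  have "\<forall>i\<le>m. N i \<in> I" "\<forall>i<m. N i \<subset> N (Suc i)"
    using N assms(2) by simp_all
  then show ?thesis
    unfolding has_chain_def by (intro exI[of _ N] conjI)
qed

lemma has_chain_mono: "has_chain I n \<Longrightarrow> I \<subseteq> J \<Longrightarrow> has_chain J n"
  unfolding has_chain_def by blast

lemma has_chain_0: "has_chain I 0 \<longleftrightarrow> I \<noteq> {}"
  unfolding has_chain_def by auto

lemma has_chain_image:
  assumes "has_chain I n"
    and "\<And>N. N \<in> I \<Longrightarrow> F N \<in> J"
    and "\<And>N N'. N \<in> I \<Longrightarrow> N' \<in> I \<Longrightarrow> N \<subset> N' \<Longrightarrow> F N \<subset> F N'"
  shows "has_chain J n"
proof -
  obtain N where N: "\<forall>i\<le>n. N i \<in> I" "\<forall>i<n. N i \<subset> N (Suc i)"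
    using assms(1) unfolding has_chain_def by blast
  have "\<forall>i\<le>n. F (N i) \<in> J" "\<forall>i<n. F (N i) \<subset> F (N (Suc i))"
    using N assms(2,3) by auto
  then show ?thesis
    unfolding has_chain_def by (intro exI[of _ "\<lambda>i. F (N i)"]) auto
qed

lemma has_chain_snoc:
  assumes "has_chain I n" "I \<subseteq> J" "Y \<in> J" "\<And>N. N \<in> I \<Longrightarrow> N \<subset> Y"
  shows "has_chain J (Suc n)"
proof -
  obtain N where N: "\<forall>i\<le>n. N i \<in> I" "\<forall>i<n. N i \<subset> N (Suc i)"
    using assms(1) unfolding has_chain_def by blast
  let ?N = "\<lambda>i. if i \<le> n then N i else Y"
  have "\<forall>i\<le>Suc n. ?N i \<in> J" "\<forall>i<Suc n. ?N i \<subset> ?N (Suc i)"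
    using N assms(2-4) by (auto simp: less_Suc_eq_le less_eq_Suc_le)
  then show ?thesis
    unfolding has_chain_def by (intro exI[of _ ?N] conjI)
qed

lemma has_chain_append:
  assumes "has_chain I m" "has_chain J n" "I \<subseteq> K" "J \<subseteq> K"
    and "\<And>N N'. N \<in> I \<Longrightarrow> N' \<in> J \<Longrightarrow> N \<subseteq> N'"
  shows "has_chain K (m + n)"
proof -
  obtain N where N: "\<forall>i\<le>m. N i \<in> I" "\<forall>i<m. N i \<subset> N (Suc i)"
    using assms(1) unfolding has_chain_def by blast
  obtain P where P: "\<forall>i\<le>n. P i \<in> J" "\<forall>i<n. P i \<subset> P (Suc i)"
    using assms(2) unfolding has_chain_def by blast
  let ?N = "\<lambda>i. if i < m then N i else P (i - m)"
  have "?N i \<in> K" if "i \<le> m + n" for i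
    using that N P assms(3,4) by auto
  moreover have "?N i \<subset> ?N (Suc i)" if "i < m + n" for i
  proof (cases "Suc i < m")
    case True
    then show ?thesis using N by auto
  next
    case F: False
    show ?thesis
    proof (cases "i < m")
      case True
      then have "Suc i = m" using F by simp
      then have "N i \<subset> N m" "N m \<subseteq> P 0"
        using N P assms(5) by auto
      then show ?thesis using True F \<open>Suc i = m\<close> by auto
    next
      case False
      then have "P (i - m) \<subset> P (Suc (i - m))" using P that by auto
      then show ?thesis using False by (simp add: Suc_diff_le)
    qed
  qed
  ultimately show ?thesis
    unfolding has_chain_def by (intro exI[of _ ?N]) auto
qed

text \<open>The supremum may be infinite, but chains can be cut short, so every finite bound below
  it is realized. The family must be nonempty for n = 0: the supremum over no chains is 0, yet a
  chain with no steps still needs one member.\<close>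

lemma enat_le_chain_length:
  assumes "I \<noteq> {}"
  shows "enat n \<le> chain_length I \<longleftrightarrow> has_chain I n"
proof
  assume "has_chain I n"
  then show "enat n \<le> chain_length I"
    unfolding chain_length_def by (intro Sup_upper) auto
next
  assume *: "enat n \<le> chain_length I"
  show "has_chain I n"
  proof (cases n)
    case 0
    then show ?thesis using assms by (simp add: has_chain_0)
  next
    case (Suc k)
    then have "enat k < chain_length I" using *
      by (meson enat_ord_simps(2) lessI order_less_le_trans)
    then obtain m where "has_chain I m" "k < m"
      unfolding chain_length_def less_Sup_iff by auto
    then show ?thesis using Suc has_chain_antimono[of I m n] by simp
  qed
qed

lemma enat_leI: "a \<le> b" if "\<And>n. enat n \<le> a \<Longrightarrow> enat n \<le> b" for a b :: enat
proof (cases b)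
  case (enat m)
  then have "\<not> enat (Suc m) \<le> a" using that[of "Suc m"] by auto
  then show ?thesis using enat by (cases a) auto
qed simp

lemma chain_length_le:
  assumes "\<And>n. has_chain I n \<Longrightarrow> has_chain J n"
  shows "chain_length I \<le> chain_length J"
  unfolding chain_length_def using assms by (intro Sup_subset_mono) auto

lemma chain_length_le_image:
  assumes "\<And>N. N \<in> I \<Longrightarrow> F N \<in> J"
    and "\<And>N N'. N \<in> I \<Longrightarrow> N' \<in> I \<Longrightarrow> N \<subset> N' \<Longrightarrow> F N \<subset> F N'"
  shows "chain_length I \<le> chain_length J"
  by (rule chain_length_le) (erule has_chain_image; fact assms)

section \<open>Submodules\<close>

definition sub_interval ::
    "('a, 'b) ring_scheme \<Rightarrow> ('a, 'm, 'c) module_scheme \<Rightarrow> 'm set \<Rightarrow> 'm set \<Rightarrow> 'm set set" where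
  "sub_interval R M X Y = {N. submodule N R M \<and> X \<subseteq> N \<and> N \<subseteq> Y}"

text \<open>The length of Y/X, read off from the interval between X and Y by the correspondence of
  submodules. No quotient module is formed, so lengths for varying X and Y concern sets of one
  type.\<close>

definition mlen ::
    "('a, 'b) ring_scheme \<Rightarrow> ('a, 'm, 'c) module_scheme \<Rightarrow> 'm set \<Rightarrow> 'm set \<Rightarrow> enat" where
  "mlen R M X Y = chain_length (sub_interval R M X Y)"

text \<open>G generates Y modulo X, expressed by the universal property so that no linear
  combinations have to be handled.\<close>

definition spans_over ::
    "('a, 'b) ring_scheme \<Rightarrow> ('a, 'm, 'c) module_scheme \<Rightarrow> 'm set \<Rightarrow> 'm set \<Rightarrow> 'm set \<Rightarrow> bool" where
  "spans_over R M X G Y \<longleftrightarrow> G \<subseteq> Y \<and> (\<forall>N. submodule N R M \<longrightarrow> X \<subseteq> N \<longrightarrow> G \<subseteq> N \<longrightarrow> Y \<subseteq> N)"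

context module
begin

lemma submoduleI':
  assumes "H \<subseteq> carrier M" "\<zero>\<^bsub>M\<^esub> \<in> H"
    and "\<And>x y. x \<in> H \<Longrightarrow> y \<in> H \<Longrightarrow> x \<oplus>\<^bsub>M\<^esub> y \<in> H"
    and "\<And>r x. r \<in> carrier R \<Longrightarrow> x \<in> H \<Longrightarrow> r \<odot>\<^bsub>M\<^esub> x \<in> H"
  shows "submodule H R M"
proof (rule submoduleI)
  fix x assume x: "x \<in> H"
  have "(\<ominus> \<one>) \<odot>\<^bsub>M\<^esub> x = \<ominus>\<^bsub>M\<^esub> x"
    using smult_l_minus[of \<one> x] x assms(1) by auto
  then show "\<ominus>\<^bsub>M\<^esub> x \<in> H" using assms(4)[of "\<ominus> \<one>" x] x by simp
qed (use assms in auto)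

lemma sub_carrier: "submodule H R M \<Longrightarrow> x \<in> H \<Longrightarrow> x \<in> carrier M"
  using submoduleE(1) by blast

lemma sub_zero: "submodule H R M \<Longrightarrow> \<zero>\<^bsub>M\<^esub> \<in> H"
  using subgroup.one_closed[OF submodule.axioms(1)] by simp

lemmas sub_add = submoduleE(5)
lemmas sub_smult = submoduleE(4)
lemmas sub_neg = submoduleE(3)

lemma sub_minus: "submodule H R M \<Longrightarrow> x \<in> H \<Longrightarrow> y \<in> H \<Longrightarrow> x \<ominus>\<^bsub>M\<^esub> y \<in> H"
  unfolding a_minus_def by (simp add: sub_add sub_neg)

lemma sub_cancel:
  assumes "submodule H R M" "x \<oplus>\<^bsub>M\<^esub> y \<in> H" "x \<in> H" "y \<in> carrier M"
  shows "y \<in> H"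
proof -
  have "(x \<oplus>\<^bsub>M\<^esub> y) \<ominus>\<^bsub>M\<^esub> x = y"
    using assms(4) sub_carrier[OF assms(1,3)]
    by (simp add: a_minus_def M.a_comm[of x y] M.a_assoc M.r_neg)
  then show ?thesis using sub_minus[OF assms(1-3)] by simp
qed

lemma sub_Int: "submodule X R M \<Longrightarrow> submodule Y R M \<Longrightarrow> submodule (X \<inter> Y) R M"
  by (rule submoduleI') (auto simp: sub_zero sub_add sub_smult sub_carrier)

lemma mem_set_add: "z \<in> X <+>\<^bsub>M\<^esub> Y \<longleftrightarrow> (\<exists>x\<in>X. \<exists>y\<in>Y. z = x \<oplus>\<^bsub>M\<^esub> y)"
  by (auto simp: set_add_def' )

lemma sub_sum:
  assumes X: "submodule X R M" and Y: "submodule Y R M"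
  shows "submodule (X <+>\<^bsub>M\<^esub> Y) R M"
proof (rule submoduleI')
  note c = sub_carrier[OF X] sub_carrier[OF Y]
  show "X <+>\<^bsub>M\<^esub> Y \<subseteq> carrier M" using c by (auto simp: mem_set_add)
  show "\<zero>\<^bsub>M\<^esub> \<in> X <+>\<^bsub>M\<^esub> Y"
    using sub_zero[OF X] sub_zero[OF Y] by (force simp: mem_set_add)
  fix x y assume "x \<in> X <+>\<^bsub>M\<^esub> Y" "y \<in> X <+>\<^bsub>M\<^esub> Y"
  then obtain p q p' q' where *: "p \<in> X" "q \<in> Y" "p' \<in> X" "q' \<in> Y" "x = p \<oplus>\<^bsub>M\<^esub> q" "y = p' \<oplus>\<^bsub>M\<^esub> q'"
    by (auto simp: mem_set_add)
  then have "x \<oplus>\<^bsub>M\<^esub> y = (p \<oplus>\<^bsub>M\<^esub> p') \<oplus>\<^bsub>M\<^esub> (q \<oplus>\<^bsub>M\<^esub> q')"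
    using c by (simp add: M.a_ac)
  then show "x \<oplus>\<^bsub>M\<^esub> y \<in> X <+>\<^bsub>M\<^esub> Y"
    using * sub_add[OF X, of p p'] sub_add[OF Y, of q q'] unfolding mem_set_add by blast
next
  fix r x assume r: "r \<in> carrier R" and "x \<in> X <+>\<^bsub>M\<^esub> Y"
  then obtain p q where *: "p \<in> X" "q \<in> Y" "x = p \<oplus>\<^bsub>M\<^esub> q"
    by (auto simp: mem_set_add)
  then have "r \<odot>\<^bsub>M\<^esub> x = r \<odot>\<^bsub>M\<^esub> p \<oplus>\<^bsub>M\<^esub> r \<odot>\<^bsub>M\<^esub> q"
    using r sub_carrier[OF X] sub_carrier[OF Y] by (simp add: smult_r_distr)
  then show "r \<odot>\<^bsub>M\<^esub> x \<in> X <+>\<^bsub>M\<^esub> Y"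
    using * sub_smult[OF X r] sub_smult[OF Y r] by (auto simp: mem_set_add)
qed

lemma sum_upper:
  assumes "submodule X R M" "submodule Y R M"
  shows "X \<subseteq> X <+>\<^bsub>M\<^esub> Y" "Y \<subseteq> X <+>\<^bsub>M\<^esub> Y"
proof -
  show "X \<subseteq> X <+>\<^bsub>M\<^esub> Y"
    using sub_zero[OF assms(2)] sub_carrier[OF assms(1)] by (force simp: mem_set_add)
  show "Y \<subseteq> X <+>\<^bsub>M\<^esub> Y"
    using sub_zero[OF assms(1)] sub_carrier[OF assms(2)] by (force simp: mem_set_add)
qed

lemma sum_least: "submodule Z R M \<Longrightarrow> X \<subseteq> Z \<Longrightarrow> Y \<subseteq> Z \<Longrightarrow> X <+>\<^bsub>M\<^esub> Y \<subseteq> Z"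
  by (auto simp: mem_set_add intro!: sub_add)

definition cyc :: "'c \<Rightarrow> 'c set" where
  "cyc y = {r \<odot>\<^bsub>M\<^esub> y |r. r \<in> carrier R}"

lemma sub_cyc:
  assumes "y \<in> carrier M"
  shows "submodule (cyc y) R M"
proof (rule submoduleI')
  show "cyc y \<subseteq> carrier M" using assms by (auto simp: cyc_def)
  show "\<zero>\<^bsub>M\<^esub> \<in> cyc y" using assms smult_l_null[of y] unfolding cyc_def by force
  show "x \<oplus>\<^bsub>M\<^esub> z \<in> cyc y" if "x \<in> cyc y" "z \<in> cyc y" for x z
    using that assms unfolding cyc_def
    by (auto simp: smult_l_distr[symmetric])
  show "r \<odot>\<^bsub>M\<^esub> x \<in> cyc y" if "r \<in> carrier R" "x \<in> cyc y" for r x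
    using that assms unfolding cyc_def
    by (auto simp: smult_assoc1[symmetric])
qed

lemma cyc_self: "y \<in> carrier M \<Longrightarrow> y \<in> cyc y"
  unfolding cyc_def using smult_one[of y] by force

lemma cyc_least: "submodule N R M \<Longrightarrow> y \<in> N \<Longrightarrow> cyc y \<subseteq> N"
  unfolding cyc_def using sub_smult by blast

lemma sub_extend:
  assumes "submodule X R M" "y \<in> carrier M"
  shows "submodule (X <+>\<^bsub>M\<^esub> cyc y) R M" "X \<subseteq> X <+>\<^bsub>M\<^esub> cyc y" "y \<in> X <+>\<^bsub>M\<^esub> cyc y"
    and "\<And>N. submodule N R M \<Longrightarrow> X \<subseteq> N \<Longrightarrow> y \<in> N \<Longrightarrow> X <+>\<^bsub>M\<^esub> cyc y \<subseteq> N"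
  using sub_sum[OF assms(1) sub_cyc[OF assms(2)]] sum_upper[OF assms(1) sub_cyc[OF assms(2)]]
    cyc_self[OF assms(2)] sum_least cyc_least by auto

lemma generated_submodule_sub:
  assumes "S \<subseteq> carrier M"
  shows "submodule (generated_submodule R M S) R M"
proof (rule submoduleI')
  show "generated_submodule R M S \<subseteq> carrier M"
    unfolding generated_submodule_def using carrier_is_submodule assms by blast
qed (auto simp: generated_submodule_def sub_zero sub_add sub_smult)

lemma generated_submodule_upper: "S \<subseteq> generated_submodule R M S"
  unfolding generated_submodule_def by blast

lemma generated_submodule_least:
  "submodule N R M \<Longrightarrow> S \<subseteq> N \<Longrightarrow> generated_submodule R M S \<subseteq> N"
  unfolding generated_submodule_def by blast

lemma interval_nonempty: "submodule X R M \<Longrightarrow> X \<subseteq> Y \<Longrightarrow> sub_interval R M X Y \<noteq> {}"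
  unfolding sub_interval_def by auto

lemma enat_le_mlen:
  "submodule X R M \<Longrightarrow> X \<subseteq> Y \<Longrightarrow> enat n \<le> mlen R M X Y \<longleftrightarrow> has_chain (sub_interval R M X Y) n"
  unfolding mlen_def by (rule enat_le_chain_length) (rule interval_nonempty)

text \<open>Intersecting a chain with \<open>Y\<close> and adding \<open>Y\<close> to it loses no step, by the modular law.\<close>

lemma mlen_add:
  assumes X: "submodule X R M" and Y: "submodule Y R M" and Z: "submodule Z R M"
    and XY: "X \<subseteq> Y" and YZ: "Y \<subseteq> Z"
  shows "mlen R M X Z = mlen R M X Y + mlen R M Y Z"
proof (rule antisym)
  show "mlen R M X Z \<le> mlen R M X Y + mlen R M Y Z"
  proof (rule enat_leI)
    fix n assume "enat n \<le> mlen R M X Z"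
    then have "has_chain (sub_interval R M X Z) n"
      using enat_le_mlen[OF X] XY YZ by blast
    then obtain N where N: "\<forall>i\<le>n. N i \<in> sub_interval R M X Z" "\<forall>i<n. N i \<subset> N (Suc i)"
      unfolding has_chain_def by blast
    let ?A = "\<lambda>k. sub_interval R M X (N k \<inter> Y)" and ?B = "\<lambda>k. sub_interval R M Y (N k <+>\<^bsub>M\<^esub> Y)"
    \<comment> \<open>Induction along the chain: at each step either the trace on Y or the sum with
      Y grows strictly, and the corresponding counter is raised.\<close>
    have "\<exists>i j. k \<le> i + j \<and> has_chain (?A k) i \<and> has_chain (?B k) j" if "k \<le> n" for k
      using that
    proof (induction k)
      case 0
      have "X \<in> ?A 0" "Y \<in> ?B 0"
        using N(1) X Y XY sum_upper(2)[of "N 0" Y] by (auto simp: sub_interval_def)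
      then show ?case by (metis empty_iff has_chain_0 le0)
    next
      case (Suc k)
      then obtain i j where ij: "k \<le> i + j" "has_chain (?A k) i" "has_chain (?B k) j"
        by auto
      let ?P = "N k" and ?P' = "N (Suc k)"
      have P: "submodule ?P R M" "submodule ?P' R M" "?P \<subset> ?P'" "X \<subseteq> ?P"
        using N Suc.prems unfolding sub_interval_def by auto
      have A: "?A k \<subseteq> ?A (Suc k)" using P unfolding sub_interval_def by auto
      have PY: "?P <+>\<^bsub>M\<^esub> Y \<subseteq> ?P' <+>\<^bsub>M\<^esub> Y" using P unfolding mem_set_add subset_iff by blast
      then have B: "?B k \<subseteq> ?B (Suc k)" unfolding sub_interval_def by auto
      show ?case
      proof (cases "?P \<inter> Y = ?P' \<inter> Y")
        case False
        have "?P' \<inter> Y \<in> ?A (Suc k)" using P XY sub_Int[OF P(2) Y] unfolding sub_interval_def by auto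
        then have "has_chain (?A (Suc k)) (Suc i)"
          by (rule has_chain_snoc[OF ij(2) A])
            (use P False in \<open>auto simp: sub_interval_def\<close>)
        then show ?thesis using ij(1) has_chain_mono[OF ij(3) B] by (intro exI[of _ "Suc i"] exI[of _ j]) auto
      next
        case T: True
        have "?P <+>\<^bsub>M\<^esub> Y \<noteq> ?P' <+>\<^bsub>M\<^esub> Y"
        proof
          assume eq: "?P <+>\<^bsub>M\<^esub> Y = ?P' <+>\<^bsub>M\<^esub> Y"
          have "?P' \<subseteq> ?P"
          proof
            fix x assume x: "x \<in> ?P'"
            then have "x \<in> ?P <+>\<^bsub>M\<^esub> Y" using sum_upper(1)[OF P(2) Y] eq by auto
            then obtain p y where py: "p \<in> ?P" "y \<in> Y" "x = p \<oplus>\<^bsub>M\<^esub> y" by (auto simp: mem_set_add)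
            then have "y \<in> ?P'" using sub_cancel[OF P(2), of p y] x P sub_carrier[OF Y] by auto
            then have "y \<in> ?P" using T py by auto
            then show "x \<in> ?P" using py sub_add[OF P(1)] by auto
          qed
          then show False using P by auto
        qed
        then have ne: "?P <+>\<^bsub>M\<^esub> Y \<subset> ?P' <+>\<^bsub>M\<^esub> Y" using PY by auto
        have "?P' <+>\<^bsub>M\<^esub> Y \<in> ?B (Suc k)" using sub_sum[OF P(2) Y] sum_upper(2)[OF P(2) Y] unfolding sub_interval_def by auto
        then have "has_chain (?B (Suc k)) (Suc j)"
          by (rule has_chain_snoc[OF ij(3) B]) (use ne in \<open>auto simp: sub_interval_def\<close>)
        then show ?thesis using ij(1) has_chain_mono[OF ij(2) A] by (intro exI[of _ i] exI[of _ "Suc j"]) auto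
      qed
    qed
    from this[of n] obtain i j where ij: "n \<le> i + j" "has_chain (?A n) i" "has_chain (?B n) j"
      by auto
    have Nn: "submodule (N n) R M" "N n \<subseteq> Z" using N(1) unfolding sub_interval_def by auto
    have "?A n \<subseteq> sub_interval R M X Y" unfolding sub_interval_def by auto
    moreover have "?B n \<subseteq> sub_interval R M Y Z"
      using sum_least[OF Z Nn(2) YZ] unfolding sub_interval_def by auto
    ultimately have "enat i \<le> mlen R M X Y" "enat j \<le> mlen R M Y Z"
      using ij has_chain_mono enat_le_mlen[OF X XY] enat_le_mlen[OF Y YZ] by blast+
    then have "enat i + enat j \<le> mlen R M X Y + mlen R M Y Z" by (rule add_mono)
    moreover have "enat n \<le> enat i + enat j" using ij(1) by simp
    ultimately show "enat n \<le> mlen R M X Y + mlen R M Y Z" by (rule order_trans[rotated])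
  qed
  show "mlen R M X Y + mlen R M Y Z \<le> mlen R M X Z"
  proof (rule enat_leI)
    fix n assume n: "enat n \<le> mlen R M X Y + mlen R M Y Z"
    \<comment> \<open>If the first length is infinite, it alone supplies all n steps.\<close>
    have "\<exists>i j. n = i + j \<and> enat i \<le> mlen R M X Y \<and> enat j \<le> mlen R M Y Z"
    proof (cases "mlen R M X Y")
      case (enat p)
      show ?thesis
      proof (cases "n \<le> p")
        case True
        then show ?thesis using enat by (intro exI[of _ n] exI[of _ 0]) (auto simp: zero_enat_def[symmetric])
      next
        case False
        then have "enat (n - p) \<le> mlen R M Y Z" using n enat by (cases "mlen R M Y Z") auto
        then show ?thesis using False enat by (intro exI[of _ p] exI[of _ "n - p"]) auto
      qed
    next
      case infinity
      then show ?thesis by (intro exI[of _ n] exI[of _ 0]) (auto simp: zero_enat_def[symmetric])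
    qed
    then obtain i j where ij: "n = i + j" "has_chain (sub_interval R M X Y) i" "has_chain (sub_interval R M Y Z) j"
      using enat_le_mlen[OF X XY] enat_le_mlen[OF Y YZ] by blast
    have "has_chain (sub_interval R M X Z) (i + j)"
      by (rule has_chain_append[OF ij(2,3)]) (use XY YZ in \<open>auto simp: sub_interval_def\<close>)
    then show "enat n \<le> mlen R M X Z" using ij(1) enat_le_mlen[OF X] XY YZ by blast
  qed
qed

lemma mlen_self: "submodule X R M \<Longrightarrow> mlen R M X X = 0"
proof -
  assume X: "submodule X R M"
  have "\<not> has_chain (sub_interval R M X X) (Suc 0)"
    unfolding has_chain_def sub_interval_def by auto
  then have "\<not> enat 1 \<le> mlen R M X X" using enat_le_mlen[OF X] by auto
  then show ?thesis by (metis One_nat_def ileI1 not_gr_zero one_eSuc one_enat_def)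
qed

lemma mlen_pos:
  assumes "submodule X R M" "submodule Y R M" "X \<subset> Y"
  shows "1 \<le> mlen R M X Y"
proof -
  have "has_chain (sub_interval R M X Y) 1"
    unfolding has_chain_def sub_interval_def
    using assms by (intro exI[of _ "\<lambda>i. if i = 0 then X else Y"]) auto
  then show ?thesis using enat_le_mlen[of X Y 1] assms by (auto simp: one_enat_def)
qed

lemma mlen_eq_0D:
  assumes "submodule X R M" "submodule Y R M" "X \<subseteq> Y" "mlen R M X Y = 0"
  shows "X = Y"
  using mlen_pos[of X Y] assms by (cases "X = Y") auto

text \<open>The quotient (X + Ry)/X is cyclic and killed by \<mm>, hence zero or a copy of the
  residue field. Concretely, a strictly larger N contains some x + ry with r a unit, and therefore y
  itself.\<close>

lemma mlen_extend_le_1: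
  assumes units: "\<And>r. r \<in> carrier R \<Longrightarrow> r \<notin> \<mm> \<Longrightarrow> r \<in> Units R"
    and X: "submodule X R M" and y: "y \<in> carrier M"
    and ann: "\<And>\<mu>. \<mu> \<in> \<mm> \<Longrightarrow> \<mu> \<odot>\<^bsub>M\<^esub> y \<in> X"
  shows "mlen R M X (X <+>\<^bsub>M\<^esub> cyc y) \<le> 1"
proof -
  have *: "N = X <+>\<^bsub>M\<^esub> cyc y" if N: "submodule N R M" "X \<subset> N" "N \<subseteq> X <+>\<^bsub>M\<^esub> cyc y" for N
  proof -
    obtain z where z: "z \<in> N" "z \<notin> X" using N by auto
    then obtain x r where xr: "x \<in> X" "r \<in> carrier R" "z = x \<oplus>\<^bsub>M\<^esub> r \<odot>\<^bsub>M\<^esub> y"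
      using N by (force simp: mem_set_add cyc_def)
    have "r \<notin> \<mm>" using ann z xr sub_add[OF X] by auto
    then have u: "r \<in> Units R" using units xr by auto
    have ry: "r \<odot>\<^bsub>M\<^esub> y \<in> N" using sub_cancel[OF N(1), of x "r \<odot>\<^bsub>M\<^esub> y"] z xr N y by auto
    have "inv r \<odot>\<^bsub>M\<^esub> (r \<odot>\<^bsub>M\<^esub> y) = y"
      using u y xr by (simp add: smult_assoc1[symmetric] R.Units_l_inv)
    then have "y \<in> N" using sub_smult[OF N(1) R.Units_inv_closed[OF u] ry] by simp
    then show ?thesis using sub_extend(4)[OF X y N(1)] N by auto
  qed
  have "\<not> has_chain (sub_interval R M X (X <+>\<^bsub>M\<^esub> cyc y)) 2"
  proof
    assume "has_chain (sub_interval R M X (X <+>\<^bsub>M\<^esub> cyc y)) 2"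
    then obtain N where N: "\<forall>i\<le>2. N i \<in> sub_interval R M X (X <+>\<^bsub>M\<^esub> cyc y)"
      "\<forall>i<2. N i \<subset> N (Suc i)"
      unfolding has_chain_def by blast
    have "N 0 \<subset> N 1" "N 1 \<subset> N 2" using N(2) by (auto simp: numeral_2_eq_2)
    moreover have "X \<subseteq> N 0" "submodule (N 1) R M" "N 2 \<subseteq> X <+>\<^bsub>M\<^esub> cyc y"
      using N(1) by (auto simp: sub_interval_def)
    ultimately show False using *[of "N 1"] by auto
  qed
  then have "\<not> enat 2 \<le> mlen R M X (X <+>\<^bsub>M\<^esub> cyc y)"
    using enat_le_mlen[OF X sub_extend(2)[OF X y]] by blast
  then show ?thesis by (cases "mlen R M X (X <+>\<^bsub>M\<^esub> cyc y)") (auto simp: one_enat_def)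
qed

text \<open>The generators are adjoined to X one at a time; as \<mm> maps each of them into X, each
  raises the length by at most one. This is the step that turns a count of generators into an upper
  bound for e.\<close>

lemma mlen_le_card:
  assumes units: "\<And>r. r \<in> carrier R \<Longrightarrow> r \<notin> \<mm> \<Longrightarrow> r \<in> Units R"
    and "finite G" "submodule X R M" "submodule Y R M" "X \<subseteq> Y" "spans_over R M X G Y"
    and "\<And>\<mu> y. \<mu> \<in> \<mm> \<Longrightarrow> y \<in> G \<Longrightarrow> \<mu> \<odot>\<^bsub>M\<^esub> y \<in> X"
  shows "mlen R M X Y \<le> enat (card G)"
  using assms(2-)
proof (induction G arbitrary: X rule: finite_induct)
  case empty
  then have "X = Y" unfolding spans_over_def by blast
  then show ?case using mlen_self[of X] empty by auto
next
  case (insert g G)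
  have g: "g \<in> carrier M" "g \<in> Y"
    using insert.prems(4) sub_carrier[OF insert.prems(2)] by (auto simp: spans_over_def)
  let ?X = "X <+>\<^bsub>M\<^esub> cyc g"
  note e = sub_extend[OF insert.prems(1) g(1)]
  have XY: "?X \<subseteq> Y" using e(4)[OF insert.prems(2)] insert.prems g by auto
  have "spans_over R M ?X G Y"
    using insert.prems(4) subset_trans[OF e(2)] subsetD[OF _ e(3)] unfolding spans_over_def by simp
  then have "mlen R M ?X Y \<le> enat (card G)"
    using insert.IH[OF e(1) insert.prems(2) XY] insert.prems(5) e(2) by blast
  moreover have "mlen R M X ?X \<le> 1"
    using mlen_extend_le_1[OF units insert.prems(1) g(1)] insert.prems(5) by blast
  ultimately have "mlen R M X Y \<le> 1 + enat (card G)"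
    using mlen_add[OF insert.prems(1) e(1) insert.prems(2) e(2) XY] by (simp add: add_mono)
  then show ?case using insert.hyps by (simp add: one_enat_def)
qed

text \<open>Any element of Y outside X may be adjoined, since the remaining length drops by at least
  one each time. This provides the r generators of C modulo \<mm>C.\<close>

lemma spanning_set_of_length:
  assumes "submodule X R M" "submodule Y R M" "X \<subseteq> Y" "mlen R M X Y \<le> enat n"
  shows "\<exists>G. finite G \<and> card G \<le> n \<and> spans_over R M X G Y"
  using assms
proof (induction n arbitrary: X)
  case 0
  then have "X = Y" using mlen_eq_0D[of X Y] by (simp add: zero_enat_def[symmetric])
  then show ?case by (intro exI[of _ "{}"]) (auto simp: spans_over_def)
next
  case (Suc n)
  show ?case
  proof (cases "X = Y")
    case True
    then show ?thesis by (intro exI[of _ "{}"]) (auto simp: spans_over_def)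
  next
    case False
    then obtain g where g: "g \<in> Y" "g \<notin> X" using Suc.prems by auto
    then have gc: "g \<in> carrier M" using sub_carrier Suc.prems by blast
    let ?X = "X <+>\<^bsub>M\<^esub> cyc g"
    note e = sub_extend[OF Suc.prems(1) gc]
    have XY: "?X \<subseteq> Y" using e(4)[OF Suc.prems(2)] Suc.prems g by auto
    have "1 \<le> mlen R M X ?X" using mlen_pos[OF Suc.prems(1) e(1)] e g by auto
    moreover have "mlen R M X Y = mlen R M X ?X + mlen R M ?X Y"
      by (rule mlen_add) (use Suc.prems e XY in auto)
    ultimately have "mlen R M ?X Y \<le> enat n" using Suc.prems(4)
      by (cases "mlen R M X ?X"; cases "mlen R M ?X Y") (auto simp: one_enat_def)
    then obtain G where G: "finite G" "card G \<le> n" "spans_over R M ?X G Y"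
      using Suc.IH[OF e(1) Suc.prems(2) XY] by blast
    have "spans_over R M X (insert g G) Y"
      using G(3) e(4) g unfolding spans_over_def by blast
    moreover have "card (insert g G) \<le> Suc n" using G by (simp add: card_insert_if)
    ultimately show ?thesis using G(1) by blast
  qed
qed

end

section \<open>Linear maps and quotients\<close>

text \<open>The map is required to be linear only on a submodule Z and its values elsewhere are
  irrelevant. Multiplication by an element of Q can thus be restricted to any fractional ideal
  without changing the function.\<close>

locale linear_map = M: module R M + M': module R M' for R (structure) and M and M' +
  fixes Z and \<psi>
  assumes Z: "submodule Z R M"
    and \<psi>_closed: "x \<in> Z \<Longrightarrow> \<psi> x \<in> carrier M'"
    and \<psi>_add: "x \<in> Z \<Longrightarrow> y \<in> Z \<Longrightarrow> \<psi> (x \<oplus>\<^bsub>M\<^esub> y) = \<psi> x \<oplus>\<^bsub>M'\<^esub> \<psi> y"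
    and \<psi>_smult: "r \<in> carrier R \<Longrightarrow> x \<in> Z \<Longrightarrow> \<psi> (r \<odot>\<^bsub>M\<^esub> x) = r \<odot>\<^bsub>M'\<^esub> \<psi> x"
begin

lemma \<psi>_zero: "\<psi> \<zero>\<^bsub>M\<^esub> = \<zero>\<^bsub>M'\<^esub>"
proof -
  have z: "\<zero>\<^bsub>M\<^esub> \<in> Z" by (rule M.sub_zero[OF Z])
  have "\<psi> (\<zero> \<odot>\<^bsub>M\<^esub> \<zero>\<^bsub>M\<^esub>) = \<zero> \<odot>\<^bsub>M'\<^esub> \<psi> \<zero>\<^bsub>M\<^esub>" using z \<psi>_smult[of \<zero>] M.R.zero_closed by blast
  then show ?thesis using z \<psi>_closed by simp
qed

lemma sub_vimage:
  assumes "submodule P R M'"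
  shows "submodule {z \<in> Z. \<psi> z \<in> P} R M"
  by (rule M.submoduleI')
    (use assms M.sub_carrier[OF Z] M.sub_add[OF Z] M.sub_zero[OF Z] M.sub_smult[OF Z] in
      \<open>auto simp: \<psi>_zero \<psi>_add \<psi>_smult M'.sub_add M'.sub_smult M'.sub_zero\<close>)

lemma sub_image:
  assumes N: "submodule N R M" "N \<subseteq> Z"
  shows "submodule (\<psi> ` N) R M'"
proof (rule M'.submoduleI')
  show "\<psi> ` N \<subseteq> carrier M'" using N \<psi>_closed by auto
  show "\<zero>\<^bsub>M'\<^esub> \<in> \<psi> ` N" using M.sub_zero[OF N(1)] \<psi>_zero by force
  show "x \<oplus>\<^bsub>M'\<^esub> y \<in> \<psi> ` N" if "x \<in> \<psi> ` N" "y \<in> \<psi> ` N" for x y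
    using that N M.sub_add[OF N(1)] by (auto simp: \<psi>_add[symmetric] subset_iff)
  show "r \<odot>\<^bsub>M'\<^esub> x \<in> \<psi> ` N" if "r \<in> carrier R" "x \<in> \<psi> ` N" for r x
    using that N M.sub_smult[OF N(1)] by (auto simp: \<psi>_smult[symmetric] subset_iff)
qed

text \<open>\<psi> induces an injection of Z modulo the preimage of C into D/C. On chains it acts by
  N \<mapsto> \<psi>(N) + C, which is strict because N contains the preimage of C: from \<psi>(x) =
  \<psi>(n) + c it follows that x - n lies in N.\<close>

lemma mlen_vimage_le:
  assumes C: "submodule C R M'" and D: "submodule D R M'" and "C \<subseteq> D" and im: "\<psi> ` Z \<subseteq> D"
  shows "mlen R M {z \<in> Z. \<psi> z \<in> C} Z \<le> mlen R M' C D"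
  unfolding mlen_def
proof (rule chain_length_le_image[where F = "\<lambda>N. \<psi> ` N <+>\<^bsub>M'\<^esub> C"])
  let ?B = "{z \<in> Z. \<psi> z \<in> C}"
  fix N assume "N \<in> sub_interval R M ?B Z"
  then have N: "submodule N R M" "N \<subseteq> Z" "?B \<subseteq> N" by (auto simp: sub_interval_def)
  note NI = sub_image[OF N(1,2)]
  have "\<psi> ` N \<subseteq> D" using image_mono[OF N(2), of \<psi>] im by (rule subset_trans)
  then show "\<psi> ` N <+>\<^bsub>M'\<^esub> C \<in> sub_interval R M' C D"
    using M'.sub_sum[OF NI C] M'.sum_upper(2)[OF NI C] M'.sum_least[OF D _ \<open>C \<subseteq> D\<close>]
    by (simp add: sub_interval_def)
  fix N' assume "N' \<in> sub_interval R M ?B Z" and sub: "N \<subset> N'"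
  then have N': "submodule N' R M" "N' \<subseteq> Z" by (auto simp: sub_interval_def)
  note NI' = sub_image[OF N']
  obtain x where x: "x \<in> N'" "x \<notin> N" using sub by auto
  have "\<psi> x \<notin> \<psi> ` N <+>\<^bsub>M'\<^esub> C"
  proof
    assume "\<psi> x \<in> \<psi> ` N <+>\<^bsub>M'\<^esub> C"
    then obtain n c where nc: "n \<in> N" "c \<in> C" "\<psi> x = \<psi> n \<oplus>\<^bsub>M'\<^esub> c" by (auto simp: M'.mem_set_add)
    let ?d = "x \<oplus>\<^bsub>M\<^esub> (\<ominus> \<one>) \<odot>\<^bsub>M\<^esub> n"
    have Zs: "x \<in> Z" "n \<in> Z" "(\<ominus> \<one>) \<odot>\<^bsub>M\<^esub> n \<in> Z" using x nc N N' M.sub_smult[OF Z] by auto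
    have cs: "x \<in> carrier M" "n \<in> carrier M" "\<psi> n \<in> carrier M'" "c \<in> carrier M'"
      using Zs M.sub_carrier[OF Z] \<psi>_closed nc M'.sub_carrier[OF C] by auto
    have "\<psi> ?d = (\<psi> n \<oplus>\<^bsub>M'\<^esub> c) \<oplus>\<^bsub>M'\<^esub> (\<ominus> \<one>) \<odot>\<^bsub>M'\<^esub> \<psi> n"
      using Zs nc by (simp add: \<psi>_add \<psi>_smult)
    also have "\<dots> = (\<psi> n \<oplus>\<^bsub>M'\<^esub> c) \<oplus>\<^bsub>M'\<^esub> \<ominus>\<^bsub>M'\<^esub> \<psi> n"
      using cs by (simp add: M'.smult_l_minus)
    also have "\<dots> = c" using cs by (simp add: M'.M.a_comm[of "\<psi> n" c] M'.M.a_assoc M'.M.r_neg)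
    finally have "?d \<in> ?B" using nc Zs M.sub_add[OF Z] by auto
    then have "?d \<in> N" using N by auto
    moreover have "x = ?d \<oplus>\<^bsub>M\<^esub> n"
      using cs by (simp add: M.smult_l_minus M.M.add.m_assoc M.M.l_neg)
    ultimately have "x \<in> N" using M.sub_add[OF N(1), of ?d n] nc by simp
    then show False using x by simp
  qed
  moreover have "\<psi> x \<in> \<psi> ` N' <+>\<^bsub>M'\<^esub> C" using M'.sum_upper(1)[OF NI' C] x by auto
  moreover have "\<psi> ` N <+>\<^bsub>M'\<^esub> C \<subseteq> \<psi> ` N' <+>\<^bsub>M'\<^esub> C" using sub unfolding M'.mem_set_add subset_iff by blast
  ultimately show "\<psi> ` N <+>\<^bsub>M'\<^esub> C \<subset> \<psi> ` N' <+>\<^bsub>M'\<^esub> C" by blast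
qed

text \<open>If \<psi> is also onto D modulo C, taking preimages is strictly monotone in the other
  direction. This is the isomorphism theorem at the level of lengths, and the source of all
  equalities of lengths below except additivity and duality.\<close>

lemma mlen_vimage:
  assumes C: "submodule C R M'" and D: "submodule D R M'" and "C \<subseteq> D" and im: "\<psi> ` Z \<subseteq> D"
    and surj: "D \<subseteq> \<psi> ` Z <+>\<^bsub>M'\<^esub> C"
  shows "mlen R M {z \<in> Z. \<psi> z \<in> C} Z = mlen R M' C D"
proof (rule antisym)
  show "mlen R M' C D \<le> mlen R M {z \<in> Z. \<psi> z \<in> C} Z"
    unfolding mlen_def
  proof (rule chain_length_le_image[where F = "\<lambda>P. {z \<in> Z. \<psi> z \<in> P}"])
    fix P assume "P \<in> sub_interval R M' C D"
    then have P: "submodule P R M'" "C \<subseteq> P" by (auto simp: sub_interval_def)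
    show "{z \<in> Z. \<psi> z \<in> P} \<in> sub_interval R M {z \<in> Z. \<psi> z \<in> C} Z"
      using sub_vimage[OF P(1)] P by (auto simp: sub_interval_def)
    fix P' assume "P' \<in> sub_interval R M' C D" and PP': "P \<subset> P'"
    then have P': "submodule P' R M'" "P' \<subseteq> D" "C \<subseteq> P'" by (auto simp: sub_interval_def)
    obtain p where p: "p \<in> P'" "p \<notin> P" using PP' by auto
    then obtain z c where zc: "z \<in> Z" "c \<in> C" "p = \<psi> z \<oplus>\<^bsub>M'\<^esub> c"
      using P' surj by (force simp: M'.mem_set_add)
    have cs: "\<psi> z \<in> carrier M'" "c \<in> carrier M'"
      using zc \<psi>_closed M'.sub_carrier[OF C] by auto
    have "\<psi> z \<in> P'" using M'.sub_cancel[OF P'(1), of c "\<psi> z"] p zc P' cs by (auto simp: M'.M.a_comm)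
    moreover have "\<psi> z \<notin> P" using p zc P M'.sub_add[OF P(1)] by auto
    ultimately show "{z \<in> Z. \<psi> z \<in> P} \<subset> {z \<in> Z. \<psi> z \<in> P'}" using PP' zc by auto
  qed
qed (rule mlen_vimage_le; fact)

lemma \<psi>_minus:
  assumes "x \<in> Z" "y \<in> Z"
  shows "x \<ominus>\<^bsub>M\<^esub> y \<in> Z" "\<psi> (x \<ominus>\<^bsub>M\<^esub> y) = \<psi> x \<ominus>\<^bsub>M'\<^esub> \<psi> y"
proof -
  have y: "(\<ominus> \<one>) \<odot>\<^bsub>M\<^esub> y \<in> Z" using M.sub_smult[OF Z] assms by simp
  have m: "x \<ominus>\<^bsub>M\<^esub> y = x \<oplus>\<^bsub>M\<^esub> (\<ominus> \<one>) \<odot>\<^bsub>M\<^esub> y"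
    using assms M.sub_carrier[OF Z] by (simp add: a_minus_def M.smult_l_minus)
  then show "x \<ominus>\<^bsub>M\<^esub> y \<in> Z" using M.sub_add[OF Z assms(1) y] by simp
  show "\<psi> (x \<ominus>\<^bsub>M\<^esub> y) = \<psi> x \<ominus>\<^bsub>M'\<^esub> \<psi> y"
    unfolding m using assms y by (simp add: \<psi>_add \<psi>_smult M'.smult_l_minus a_minus_def \<psi>_closed)
qed

end

section \<open>Modules of functions\<close>

text \<open>A common form of \<open>free_module\<close> and \<open>hom_module\<close>, so that the
  module axioms are verified once, pointwise.\<close>

definition fun_module :: "'i set \<Rightarrow> ('a, 'm, 'c) module_scheme \<Rightarrow> ('a, 'i \<Rightarrow> 'm) module" where
  "fun_module D M =
     \<lparr>carrier = D \<rightarrow>\<^sub>E carrier M, monoid.mult = undefined, one = undefined,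
      zero = (\<lambda>x\<in>D. \<zero>\<^bsub>M\<^esub>),
      add = (\<lambda>f g. \<lambda>x\<in>D. f x \<oplus>\<^bsub>M\<^esub> g x),
      smult = (\<lambda>r f. \<lambda>x\<in>D. r \<odot>\<^bsub>M\<^esub> f x)\<rparr>"

lemma ring_module_simps [simp]:
  "carrier (ring_module Q C) = C" "add (ring_module Q C) = add Q"
  "zero (ring_module Q C) = zero Q" "smult (ring_module Q C) = monoid.mult Q"
  by (simp_all add: ring_module_def)

lemma free_module_eq: "free_module R n = fun_module {..<n} (ring_module R (carrier R))"
  by (simp add: free_module_def fun_module_def)

text \<open>The two records differ only in their carriers, so cocycles can be treated as a submodule
  of all functions into N.\<close>

lemma hom_module_eq:
  "(hom_module R M N)\<lparr>carrier := Z\<rparr> = (fun_module (carrier M) N)\<lparr>carrier := Z\<rparr>"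
  by (simp add: hom_module_def fun_module_def)

lemma (in cring) module_self: "module R (ring_module R (carrier R))"
proof (rule moduleI)
  show "abelian_group (ring_module R (carrier R))"
    by (rule abelian_groupI) (auto simp: a_ac intro: bexI[of _ "\<ominus> x" for x] l_neg)
qed (auto simp: cring_axioms l_distr r_distr m_assoc)

lemma (in module) fun_module_module: "module R (fun_module D M)"
proof -
  let ?F = "fun_module D M"
  have mem: "f x \<in> carrier M" if "f \<in> carrier ?F" "x \<in> D" for f x
    using that by (auto simp: fun_module_def)
  have eqI: "f = g" if "f \<in> carrier ?F" "g \<in> carrier ?F" "\<And>x. x \<in> D \<Longrightarrow> f x = g x" for f g
    using that PiE_ext[of f D "\<lambda>_. carrier M" g] by (simp add: fun_module_def)
  have cl: "f \<oplus>\<^bsub>?F\<^esub> g \<in> carrier ?F" "r \<odot>\<^bsub>?F\<^esub> f \<in> carrier ?F" "\<zero>\<^bsub>?F\<^esub> \<in> carrier ?F"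
    if "f \<in> carrier ?F" "g \<in> carrier ?F" "r \<in> carrier R" for f g r
    using mem[OF that(1)] mem[OF that(2)] that(3) by (simp_all add: fun_module_def)
  have zero: "\<zero>\<^bsub>?F\<^esub> \<in> carrier ?F" by (simp add: fun_module_def)
  have ap: "x \<in> D \<Longrightarrow> (f \<oplus>\<^bsub>?F\<^esub> g) x = f x \<oplus>\<^bsub>M\<^esub> g x" "x \<in> D \<Longrightarrow> (r \<odot>\<^bsub>?F\<^esub> f) x = r \<odot>\<^bsub>M\<^esub> f x"
    "x \<in> D \<Longrightarrow> \<zero>\<^bsub>?F\<^esub> x = \<zero>\<^bsub>M\<^esub>" for f g r x
    by (simp_all add: fun_module_def)
  have one: "\<one> \<in> carrier R" by simp
  show ?thesis
  proof (rule moduleI)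
    show "abelian_group ?F"
    proof (rule abelian_groupI)
      fix f assume f: "f \<in> carrier ?F"
      have neg: "(\<ominus> \<one>) \<odot>\<^bsub>?F\<^esub> f \<in> carrier ?F" using cl(2)[OF f f] by simp
      have "(\<ominus> \<one>) \<odot>\<^bsub>?F\<^esub> f \<oplus>\<^bsub>?F\<^esub> f = \<zero>\<^bsub>?F\<^esub>"
        by (rule eqI[OF cl(1)[OF neg f one] zero]) (simp add: ap smult_l_minus mem[OF f] M.l_neg)
      then show "\<exists>g\<in>carrier ?F. g \<oplus>\<^bsub>?F\<^esub> f = \<zero>\<^bsub>?F\<^esub>" using neg by blast
      show "\<zero>\<^bsub>?F\<^esub> \<oplus>\<^bsub>?F\<^esub> f = f"
        by (rule eqI[OF cl(1)[OF zero f one] f]) (simp add: ap mem[OF f])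
      fix g assume g: "g \<in> carrier ?F"
      show "f \<oplus>\<^bsub>?F\<^esub> g \<in> carrier ?F" by (rule cl(1)[OF f g one])
      show "f \<oplus>\<^bsub>?F\<^esub> g = g \<oplus>\<^bsub>?F\<^esub> f"
        by (rule eqI[OF cl(1)[OF f g one] cl(1)[OF g f one]]) (simp add: ap mem[OF f] mem[OF g] M.a_comm)
      fix h assume h: "h \<in> carrier ?F"
      show "(f \<oplus>\<^bsub>?F\<^esub> g) \<oplus>\<^bsub>?F\<^esub> h = f \<oplus>\<^bsub>?F\<^esub> (g \<oplus>\<^bsub>?F\<^esub> h)"
        by (rule eqI[OF cl(1)[OF cl(1)[OF f g one] h one] cl(1)[OF f cl(1)[OF g h one] one]])
          (simp add: ap mem[OF f] mem[OF g] mem[OF h] M.a_assoc)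
    qed (rule zero)
    fix r f assume r: "r \<in> carrier R" and f: "f \<in> carrier ?F"
    show "r \<odot>\<^bsub>?F\<^esub> f \<in> carrier ?F" by (rule cl(2)[OF f f r])
    fix q assume q: "q \<in> carrier R"
    have rq: "r \<oplus> q \<in> carrier R" "r \<otimes> q \<in> carrier R" using r q by auto
    show "(r \<oplus> q) \<odot>\<^bsub>?F\<^esub> f = r \<odot>\<^bsub>?F\<^esub> f \<oplus>\<^bsub>?F\<^esub> q \<odot>\<^bsub>?F\<^esub> f"
      by (rule eqI[OF cl(2)[OF f f rq(1)] cl(1)[OF cl(2)[OF f f r] cl(2)[OF f f q] one]])
        (simp add: ap mem[OF f] smult_l_distr r q)
    show "(r \<otimes> q) \<odot>\<^bsub>?F\<^esub> f = r \<odot>\<^bsub>?F\<^esub> (q \<odot>\<^bsub>?F\<^esub> f)"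
      by (rule eqI[OF cl(2)[OF f f rq(2)] cl(2)[OF cl(2)[OF f f q] f r]])
        (simp add: ap mem[OF f] smult_assoc1 r q)
  next
    fix r f g assume r: "r \<in> carrier R" and f: "f \<in> carrier ?F" and g: "g \<in> carrier ?F"
    show "r \<odot>\<^bsub>?F\<^esub> (f \<oplus>\<^bsub>?F\<^esub> g) = r \<odot>\<^bsub>?F\<^esub> f \<oplus>\<^bsub>?F\<^esub> r \<odot>\<^bsub>?F\<^esub> g"
      by (rule eqI[OF cl(2)[OF cl(1)[OF f g one] f r] cl(1)[OF cl(2)[OF f f r] cl(2)[OF g g r] one]])
        (simp add: ap mem[OF f] mem[OF g] smult_r_distr r)
  next
    fix f assume f: "f \<in> carrier ?F"
    show "\<one> \<odot>\<^bsub>?F\<^esub> f = f"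
      by (rule eqI[OF cl(2)[OF f f one] f]) (simp add: ap mem[OF f])
  qed (rule R.cring_axioms)
qed

lemma linear_map_of_hom:
  assumes "module R M" "module R N" "f \<in> module_hom R M N"
  shows "linear_map R M N (carrier M) f"
proof -
  interpret M: module R M by fact
  interpret N: module R N by fact
  show ?thesis
  proof (intro linear_map.intro linear_map_axioms.intro assms M.carrier_is_submodule)
  qed (use assms(3) in \<open>auto simp: module_hom_def\<close>)
qed

section \<open>Quotient modules\<close>

context module
begin

lemma abelian_subgroup_sub: "submodule N R M \<Longrightarrow> abelian_subgroup N M"
  by (rule abelian_subgroupI3)
    (auto simp: additive_subgroup_def submodule_def M.abelian_group_axioms)

lemma coset_eq_iff:
  assumes "submodule N R M" "x \<in> carrier M" "y \<in> carrier M"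
  shows "N +>\<^bsub>M\<^esub> x = N +>\<^bsub>M\<^esub> y \<longleftrightarrow> x \<ominus>\<^bsub>M\<^esub> y \<in> N"
proof -
  interpret N: abelian_subgroup N M by (rule abelian_subgroup_sub[OF assms(1)])
  show ?thesis
    using assms(2,3) N.a_rcos_module[of y x] N.a_rcos_self[of x] M.a_repr_independence[of x N y]
      N.a_subgroup by (auto simp: a_minus_def)
qed

lemma quot_module_carrier: "carrier (quot_module M N) = (\<lambda>x. N +>\<^bsub>M\<^esub> x) ` carrier M"
  by (auto simp: quot_module_def A_RCOSETS_def' )

lemma quot_module_add:
  assumes "submodule N R M" "x \<in> carrier M" "y \<in> carrier M"
  shows "(N +>\<^bsub>M\<^esub> x) \<oplus>\<^bsub>quot_module M N\<^esub> (N +>\<^bsub>M\<^esub> y) = N +>\<^bsub>M\<^esub> (x \<oplus>\<^bsub>M\<^esub> y)"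
  using abelian_subgroup.a_rcos_sum[OF abelian_subgroup_sub] assms by (simp add: quot_module_def)

lemma quot_module_smult:
  assumes N: "submodule N R M" and r: "r \<in> carrier R" and x: "x \<in> carrier M"
  shows "r \<odot>\<^bsub>quot_module M N\<^esub> (N +>\<^bsub>M\<^esub> x) = N +>\<^bsub>M\<^esub> (r \<odot>\<^bsub>M\<^esub> x)"
proof -
  interpret N: abelian_subgroup N M by (rule abelian_subgroup_sub[OF N])
  have eq: "N +>\<^bsub>M\<^esub> (r \<odot>\<^bsub>M\<^esub> y) = N +>\<^bsub>M\<^esub> (r \<odot>\<^bsub>M\<^esub> x)" if y: "y \<in> N +>\<^bsub>M\<^esub> x" for y
  proof -
    obtain n where n: "n \<in> N" "y = n \<oplus>\<^bsub>M\<^esub> x" using y by (auto simp: a_r_coset_def')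
    have c: "n \<in> carrier M" using n sub_carrier[OF N] by simp
    have "r \<odot>\<^bsub>M\<^esub> y = r \<odot>\<^bsub>M\<^esub> n \<oplus>\<^bsub>M\<^esub> r \<odot>\<^bsub>M\<^esub> x" using n c r x by (simp add: smult_r_distr)
    then have "r \<odot>\<^bsub>M\<^esub> y \<ominus>\<^bsub>M\<^esub> r \<odot>\<^bsub>M\<^esub> x = r \<odot>\<^bsub>M\<^esub> n"
      using c r x by (simp add: a_minus_def M.a_assoc M.r_neg)
    then show ?thesis using coset_eq_iff[OF N, of "r \<odot>\<^bsub>M\<^esub> y" "r \<odot>\<^bsub>M\<^esub> x"] sub_smult[OF N r n(1)] n c r x by simp
  qed
  have "N +>\<^bsub>M\<^esub> x \<noteq> {}" using N.a_rcos_self[OF x] by blast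
  then have "(\<Union>y\<in>N +>\<^bsub>M\<^esub> x. N +>\<^bsub>M\<^esub> (r \<odot>\<^bsub>M\<^esub> y)) = N +>\<^bsub>M\<^esub> (r \<odot>\<^bsub>M\<^esub> x)"
    by (rule SUP_eq_const) (rule eq)
  then show ?thesis by (simp add: quot_module_def)
qed

lemma quot_module_zero: "\<zero>\<^bsub>quot_module M N\<^esub> = N"
  by (simp add: quot_module_def)

lemma coset_zero: "submodule N R M \<Longrightarrow> N +>\<^bsub>M\<^esub> \<zero>\<^bsub>M\<^esub> = N"
  using sub_carrier by (intro M.a_coset_add_zero) auto

lemma coset_eq_zero_iff:
  assumes "submodule N R M" "x \<in> carrier M"
  shows "N +>\<^bsub>M\<^esub> x = N \<longleftrightarrow> x \<in> N"
  using abelian_subgroup.a_rcos_self[OF abelian_subgroup_sub[OF assms(1)] assms(2)]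
    abelian_subgroup.a_rcos_const[OF abelian_subgroup_sub[OF assms(1)]] by auto

lemma quot_module_module:
  assumes N: "submodule N R M"
  shows "module R (quot_module M N)"
proof (rule moduleI)
  have z: "\<zero>\<^bsub>quot_module M N\<^esub> = N +>\<^bsub>M\<^esub> \<zero>\<^bsub>M\<^esub>"
    using coset_zero[OF N] by (simp add: quot_module_zero)
  show "abelian_group (quot_module M N)"
  proof (rule abelian_groupI)
    fix X assume "X \<in> carrier (quot_module M N)"
    then obtain x where x: "x \<in> carrier M" "X = N +>\<^bsub>M\<^esub> x" by (auto simp: quot_module_carrier)
    then have "(N +>\<^bsub>M\<^esub> (\<ominus>\<^bsub>M\<^esub> x)) \<oplus>\<^bsub>quot_module M N\<^esub> X = \<zero>\<^bsub>quot_module M N\<^esub>"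
      by (simp add: quot_module_add[OF N] z M.l_neg)
    then show "\<exists>Y\<in>carrier (quot_module M N). Y \<oplus>\<^bsub>quot_module M N\<^esub> X = \<zero>\<^bsub>quot_module M N\<^esub>"
      using x by (auto simp: quot_module_carrier)
  qed (auto simp: quot_module_carrier quot_module_add[OF N] z M.a_ac)
qed (auto simp: R.cring_axioms quot_module_carrier quot_module_add[OF N] quot_module_smult[OF N]
  smult_l_distr smult_r_distr smult_assoc1)

lemma coset_linear_map:
  assumes N: "submodule N R M"
  shows "linear_map R M (quot_module M N) (carrier M) (\<lambda>x. N +>\<^bsub>M\<^esub> x)"
proof -
  interpret q: module R "quot_module M N" by (rule quot_module_module[OF N])
  show ?thesis
    by (intro linear_map.intro linear_map_axioms.intro module_axioms q.module_axioms carrier_is_submodule)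
      (auto simp: quot_module_carrier quot_module_add[OF N] quot_module_smult[OF N])
qed

text \<open>Links the lengths of the definitions to those of intervals. The coset map is onto with
  kernel N, and since every submodule contains zero, the interval from zero to the whole quotient
  consists of all its submodules.\<close>

lemma module_length_quot:
  assumes N: "submodule N R M"
  shows "module_length R (quot_module M N) = mlen R M N (carrier M)"
proof -
  interpret c: linear_map R M "quot_module M N" "carrier M" "\<lambda>x. N +>\<^bsub>M\<^esub> x"
    by (rule coset_linear_map[OF N])
  let ?q = "quot_module M N"
  have z: "submodule {\<zero>\<^bsub>?q\<^esub>} R ?q"
    by (rule c.M'.submoduleI') auto
  have "mlen R M {x \<in> carrier M. N +>\<^bsub>M\<^esub> x \<in> {\<zero>\<^bsub>?q\<^esub>}} (carrier M) = mlen R ?q {\<zero>\<^bsub>?q\<^esub>} (carrier ?q)"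
    by (rule c.mlen_vimage[OF z c.M'.carrier_is_submodule])
      (use c.M'.sum_upper(1)[OF c.M'.carrier_is_submodule z] c.M'.sub_zero[OF c.M'.carrier_is_submodule] in \<open>auto simp: quot_module_carrier\<close>)
  also have "{x \<in> carrier M. N +>\<^bsub>M\<^esub> x \<in> {\<zero>\<^bsub>?q\<^esub>}} = N"
    using coset_eq_zero_iff[OF N] sub_carrier[OF N] by (auto simp: quot_module_zero)
  also have "mlen R ?q {\<zero>\<^bsub>?q\<^esub>} (carrier ?q) = module_length R ?q"
  proof -
    have "sub_interval R ?q {\<zero>\<^bsub>?q\<^esub>} (carrier ?q) = {N. submodule N R ?q}"
      using c.M'.sub_zero c.M'.sub_carrier by (auto simp: sub_interval_def)
    then show ?thesis
      by (simp add: mlen_def chain_length_def module_length_def has_chain_def)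
  qed
  finally show ?thesis by simp
qed

end

section \<open>Finitely generated free modules\<close>

definition unit_vec :: "('a, 'b) ring_scheme \<Rightarrow> nat \<Rightarrow> nat \<Rightarrow> nat \<Rightarrow> 'a" where
  "unit_vec R n j = (\<lambda>i\<in>{..<n}. if i = j then \<one>\<^bsub>R\<^esub> else \<zero>\<^bsub>R\<^esub>)"

lemma free_module_simps:
  "carrier (free_module R n) = {..<n} \<rightarrow>\<^sub>E carrier R"
  "\<zero>\<^bsub>free_module R n\<^esub> = (\<lambda>i\<in>{..<n}. \<zero>\<^bsub>R\<^esub>)"
  "v \<oplus>\<^bsub>free_module R n\<^esub> w = (\<lambda>i\<in>{..<n}. v i \<oplus>\<^bsub>R\<^esub> w i)"
  "r \<odot>\<^bsub>free_module R n\<^esub> v = (\<lambda>i\<in>{..<n}. r \<otimes>\<^bsub>R\<^esub> v i)"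
  by (simp_all add: free_module_def)

context cring
begin

lemma free_module_module: "module R (free_module R n)"
  unfolding free_module_eq by (rule module.fun_module_module[OF module_self])

lemma unit_vec_carrier: "unit_vec R n j \<in> carrier (free_module R n)"
  by (auto simp: unit_vec_def free_module_simps)

lemma free_module_induct:
  assumes v: "v \<in> carrier (free_module R n)"
    and zero: "\<zero>\<^bsub>free_module R n\<^esub> \<in> P"
    and unit: "\<And>j. j < n \<Longrightarrow> unit_vec R n j \<in> P"
    and add: "\<And>v w. v \<in> P \<Longrightarrow> w \<in> P \<Longrightarrow> v \<oplus>\<^bsub>free_module R n\<^esub> w \<in> P"
    and smult: "\<And>r v. r \<in> carrier R \<Longrightarrow> v \<in> P \<Longrightarrow> r \<odot>\<^bsub>free_module R n\<^esub> v \<in> P"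
  shows "v \<in> P"
proof -
  \<comment> \<open>The vector v cut off after its first k coordinates; it is rebuilt one unit
    vector at a time.\<close>
  let ?t = "\<lambda>k. \<lambda>i\<in>{..<n}. if i < k then v i else \<zero>"
  have vc: "i < n \<Longrightarrow> v i \<in> carrier R" for i using v by (auto simp: free_module_simps)
  have "?t k \<in> P" if "k \<le> n" for k
    using that
  proof (induction k)
    case 0
    then show ?case using zero by (simp add: free_module_simps restrict_def)
  next
    case (Suc k)
    have t: "?t (Suc k) = ?t k \<oplus>\<^bsub>free_module R n\<^esub> v k \<odot>\<^bsub>free_module R n\<^esub> unit_vec R n k"
      using vc Suc.prems by (auto simp: free_module_simps unit_vec_def fun_eq_iff less_Suc_eq)
    have "v k \<odot>\<^bsub>free_module R n\<^esub> unit_vec R n k \<in> P"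
      using smult[OF vc unit] Suc.prems by simp
    moreover have "?t k \<in> P" by (rule Suc.IH) (use Suc.prems in simp)
    ultimately show ?case unfolding t by (intro add)
  qed
  from this[of n] have "?t n \<in> P" by simp
  moreover have "?t n = v"
  proof
    show "?t n i = v i" for i
      using v PiE_arb[of v "{..<n}" "\<lambda>_. carrier R" i] by (auto simp: free_module_simps)
  qed
  ultimately show ?thesis by simp
qed

lemma free_module_hom_exists:
  assumes "module R M" and m: "\<And>j. j < n \<Longrightarrow> m j \<in> carrier M"
  shows "\<exists>h\<in>module_hom R (free_module R n) M. \<forall>j<n. h (unit_vec R n j) = m j"
proof -
  interpret M: module R M by fact
  let ?h = "\<lambda>v\<in>carrier (free_module R n). \<Oplus>\<^bsub>M\<^esub>i\<in>{..<n}. v i \<odot>\<^bsub>M\<^esub> m i"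
  interpret F: module R "free_module R n" by (rule free_module_module)
  have fm: "v i \<in> carrier R" if "v \<in> carrier (free_module R n)" "i < n" for v i
    using that by (auto simp: free_module_simps)
  have ap: "i < n \<Longrightarrow> (v \<oplus>\<^bsub>free_module R n\<^esub> w) i = v i \<oplus> w i" "i < n \<Longrightarrow> (r \<odot>\<^bsub>free_module R n\<^esub> v) i = r \<otimes> v i" for v w i r
    by (simp_all add: free_module_simps)
  have cl: "(\<lambda>i. v i \<odot>\<^bsub>M\<^esub> m i) \<in> {..<n} \<rightarrow> carrier M" if "v \<in> carrier (free_module R n)" for v
    using that m by (auto simp: free_module_simps)
  have "?h \<in> module_hom R (free_module R n) M"
    unfolding module_hom_def
  proof (intro CollectI conjI ballI)
    show "?h \<in> carrier (free_module R n) \<rightarrow>\<^sub>E carrier M" using cl by auto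
  next
    fix v w assume vw: "v \<in> carrier (free_module R n)" "w \<in> carrier (free_module R n)"
    have "(\<Oplus>\<^bsub>M\<^esub>i\<in>{..<n}. (v \<oplus>\<^bsub>free_module R n\<^esub> w) i \<odot>\<^bsub>M\<^esub> m i) = (\<Oplus>\<^bsub>M\<^esub>i\<in>{..<n}. v i \<odot>\<^bsub>M\<^esub> m i \<oplus>\<^bsub>M\<^esub> w i \<odot>\<^bsub>M\<^esub> m i)"
      by (rule M.M.finsum_cong') (use m fm[OF vw(1)] fm[OF vw(2)] in \<open>auto simp: ap M.smult_l_distr\<close>)
    also have "\<dots> = (\<Oplus>\<^bsub>M\<^esub>i\<in>{..<n}. v i \<odot>\<^bsub>M\<^esub> m i) \<oplus>\<^bsub>M\<^esub> (\<Oplus>\<^bsub>M\<^esub>i\<in>{..<n}. w i \<odot>\<^bsub>M\<^esub> m i)"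
      by (rule M.M.finsum_addf) (use vw cl in auto)
    finally show "?h (v \<oplus>\<^bsub>free_module R n\<^esub> w) = ?h v \<oplus>\<^bsub>M\<^esub> ?h w" using vw by simp
  next
    fix r v assume rv: "r \<in> carrier R" "v \<in> carrier (free_module R n)"
    have "(\<Oplus>\<^bsub>M\<^esub>i\<in>{..<n}. (r \<odot>\<^bsub>free_module R n\<^esub> v) i \<odot>\<^bsub>M\<^esub> m i) = (\<Oplus>\<^bsub>M\<^esub>i\<in>{..<n}. r \<odot>\<^bsub>M\<^esub> (v i \<odot>\<^bsub>M\<^esub> m i))"
      by (rule M.M.finsum_cong') (use rv(1) m fm[OF rv(2)] in \<open>auto simp: ap M.smult_assoc1\<close>)
    also have "\<dots> = r \<odot>\<^bsub>M\<^esub> (\<Oplus>\<^bsub>M\<^esub>i\<in>{..<n}. v i \<odot>\<^bsub>M\<^esub> m i)"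
      by (rule M.finsum_smult_ldistr[symmetric]) (use rv cl in auto)
    finally show "?h (r \<odot>\<^bsub>free_module R n\<^esub> v) = r \<odot>\<^bsub>M\<^esub> ?h v" using rv by simp
  qed
  moreover have "?h (unit_vec R n j) = m j" if j: "j < n" for j
  proof -
    have "(\<Oplus>\<^bsub>M\<^esub>i\<in>{..<n}. unit_vec R n j i \<odot>\<^bsub>M\<^esub> m i) = (\<Oplus>\<^bsub>M\<^esub>i\<in>{..<n}. if j = i then m i else \<zero>\<^bsub>M\<^esub>)"
      by (rule M.M.finsum_cong') (use j m in \<open>auto simp: unit_vec_def\<close>)
    also have "\<dots> = m j"
      by (rule M.M.add.finprod_singleton) (use j m in auto)
    finally show ?thesis by (simp add: unit_vec_carrier)
  qed
  ultimately show ?thesis by blast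
qed

lemma free_module_hom_eqI:
  assumes "linear_map R (free_module R n) M (carrier (free_module R n)) f"
    and "linear_map R (free_module R n) M (carrier (free_module R n)) g"
    and eq: "\<And>j. j < n \<Longrightarrow> f (unit_vec R n j) = g (unit_vec R n j)"
    and v: "v \<in> carrier (free_module R n)"
  shows "f v = g v"
proof -
  interpret f: linear_map R "free_module R n" M "carrier (free_module R n)" f by fact
  interpret g: linear_map R "free_module R n" M "carrier (free_module R n)" g by fact
  have "v \<in> {v \<in> carrier (free_module R n). f v = g v}"
    by (rule free_module_induct[OF v])
      (use eq unit_vec_carrier in \<open>auto simp: f.\<psi>_add g.\<psi>_add f.\<psi>_smult g.\<psi>_smult f.\<psi>_zero g.\<psi>_zero\<close>)
  then show ?thesis by simp
qed

lemma free_cover: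
  assumes "module R M" "finite G" "G \<subseteq> carrier M"
  shows "\<exists>n. \<exists>h\<in>module_hom R (free_module R n) M.
    h ` carrier (free_module R n) = generated_submodule R M G"
proof -
  interpret M: module R M by fact
  define n where "n = card G"
  obtain g where g: "bij_betw g {..<n} G"
    using ex_bij_betw_nat_finite[OF assms(2)] unfolding atLeast0LessThan n_def by blast
  then have gc: "j < n \<Longrightarrow> g j \<in> G" for j by (auto simp: bij_betw_def)
  then obtain h where h: "h \<in> module_hom R (free_module R n) M" "\<And>j. j < n \<Longrightarrow> h (unit_vec R n j) = g j"
    using free_module_hom_exists[OF assms(1), of n g] assms(3) by blast
  interpret h: linear_map R "free_module R n" M "carrier (free_module R n)" h
    by (rule linear_map_of_hom[OF free_module_module assms(1) h(1)])
  let ?F = "carrier (free_module R n)" and ?N = "generated_submodule R M G"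
  have "submodule (h ` ?F) R M" by (rule h.sub_image[OF h.M.carrier_is_submodule]) auto
  moreover have "G \<subseteq> h ` ?F"
  proof
    fix x assume "x \<in> G"
    then obtain j where "j < n" "x = g j" using g by (auto simp: bij_betw_def)
    then show "x \<in> h ` ?F" using h(2)[of j] unit_vec_carrier[of n j] by force
  qed
  ultimately have "?N \<subseteq> h ` ?F" by (rule M.generated_submodule_least)
  moreover have N: "submodule ?N R M" by (rule M.generated_submodule_sub[OF assms(3)])
  have "v \<in> {v \<in> ?F. h v \<in> ?N}" if v: "v \<in> ?F" for v
    by (rule free_module_induct[OF v])
      (use h(2) gc M.generated_submodule_upper[of G] unit_vec_carrier M.sub_zero[OF N] in
        \<open>auto simp: h.\<psi>_add h.\<psi>_smult h.\<psi>_zero M.sub_add[OF N] M.sub_smult[OF N]\<close>)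
  ultimately show ?thesis using h(1) by blast
qed

section \<open>Ideals as submodules, Noetherian free modules and free resolutions\<close>

lemma submodule_self_iff: "submodule I R (ring_module R (carrier R)) \<longleftrightarrow> ideal I R"
proof
  interpret S: module R "ring_module R (carrier R)" by (rule module_self)
  assume I: "submodule I R (ring_module R (carrier R))"
  have "subgroup I (add_monoid R)"
  proof (rule add.subgroupI)
    show "I \<subseteq> carrier R" "I \<noteq> {}" using S.submoduleE(1,2)[OF I] by auto
    show "\<ominus> x \<in> I" if x: "x \<in> I" for x
      using S.sub_smult[OF I _ x, of "\<ominus> \<one>"] S.sub_carrier[OF I x] by (simp add: l_minus)
    show "x \<oplus> y \<in> I" if "x \<in> I" "y \<in> I" for x y
      using S.sub_add[OF I that] by simp
  qed
  then show "ideal I R"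
  proof (rule idealI[OF ring_axioms])
    fix x r assume x: "x \<in> I" and r: "r \<in> carrier R"
    show "r \<otimes> x \<in> I" using S.sub_smult[OF I r x] by simp
    then show "x \<otimes> r \<in> I" using S.sub_carrier[OF I x] r by (simp add: m_comm)
  qed
next
  interpret S: module R "ring_module R (carrier R)" by (rule module_self)
  assume "ideal I R"
  then interpret I: ideal I R .
  show "submodule I R (ring_module R (carrier R))"
    by (rule S.submoduleI') (auto simp: I.I_l_closed I.a_Hcarr)
qed

end

text \<open>Induction on the number k of leading coordinates that may be nonzero on N. The last of
  these coordinates takes its values in a finitely generated ideal; preimages of generators,
  together with generators of the vectors where that coordinate vanishes, generate N.\<close>

lemma (in noetherian_ring) free_module_noetherian:
  assumes "cring R" and "submodule N R (free_module R n)"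
  shows "\<exists>G. finite G \<and> G \<subseteq> N \<and> N = generated_submodule R (free_module R n) G"
proof -
  interpret cring R by fact
  let ?F = "free_module R n" and ?S = "ring_module R (carrier R)"
  let ?g = "generated_submodule R ?F"
  interpret F: module R ?F by (rule free_module_module)
  interpret S: module R ?S by (rule module_self)
  have "\<exists>G. finite G \<and> G \<subseteq> N \<and> N \<subseteq> ?g G"
    if "submodule N R ?F" "\<forall>v\<in>N. \<forall>i. k \<le> i \<and> i < n \<longrightarrow> v i = \<zero>" for k N
    using that
  proof (induction k arbitrary: N)
    case 0
    have "v = \<zero>\<^bsub>?F\<^esub>" if "v \<in> N" for v
      using that 0(2) F.sub_carrier[OF 0(1) that] by (intro PiE_ext[of v "{..<n}" "\<lambda>_. carrier R"]) (auto simp: free_module_simps)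
    then have "N \<subseteq> ?g {}" using F.sub_zero[OF F.generated_submodule_sub[of "{}"]] by auto
    then show ?case by blast
  next
    case (Suc k)
    note N = Suc.prems(1)
    show ?case
    proof (cases "k < n")
      case False
      then have "\<forall>v\<in>N. \<forall>i. k \<le> i \<and> i < n \<longrightarrow> v i = \<zero>" by auto
      then show ?thesis by (rule Suc.IH[OF N])
    next
      case k: True
      have coord: "linear_map R ?F ?S (carrier ?F) (\<lambda>v. v k)"
        by (intro linear_map.intro linear_map_axioms.intro F.module_axioms S.module_axioms F.carrier_is_submodule)
          (use k in \<open>auto simp: free_module_simps\<close>)
      interpret k: linear_map R ?F ?S "carrier ?F" "\<lambda>v. v k" by (rule coord)
      have "ideal ((\<lambda>v. v k) ` N) R"
        using k.sub_image[OF N] F.submoduleE(1)[OF N] submodule_self_iff by blast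
      then obtain A where A: "A \<subseteq> carrier R" "finite A" "(\<lambda>v. v k) ` N = Idl A"
        using finetely_gen by blast
      have "A \<subseteq> (\<lambda>v. v k) ` N" using genideal_self[OF A(1)] A(3) by simp
      then obtain G1 where G1: "G1 \<subseteq> N" "finite G1" "A = (\<lambda>v. v k) ` G1"
        using A(2) by (meson finite_subset_image)
      let ?N0 = "{v \<in> N. v k \<in> {\<zero>}}"
      have "submodule {\<zero>} R ?S" by (rule S.submoduleI') auto
      then have "submodule (N \<inter> {v \<in> carrier ?F. v k \<in> {\<zero>}}) R ?F"
        using F.sub_Int[OF N k.sub_vimage] by blast
      moreover have "N \<inter> {v \<in> carrier ?F. v k \<in> {\<zero>}} = ?N0" using F.sub_carrier[OF N] by auto
      ultimately have N0: "submodule ?N0 R ?F" by simp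
      have "\<forall>v\<in>?N0. \<forall>i. k \<le> i \<and> i < n \<longrightarrow> v i = \<zero>"
      proof (intro ballI allI impI)
        show "v i = \<zero>" if "v \<in> ?N0" "k \<le> i \<and> i < n" for v i
          using that Suc.prems(2) by (cases "i = k") auto
      qed
      then obtain G0 where G0: "finite G0" "G0 \<subseteq> ?N0" "?N0 \<subseteq> ?g G0"
        using Suc.IH[OF N0] by blast
      let ?G = "G0 \<union> G1"
      have GN: "?G \<subseteq> N" using G0 G1 by auto
      then have Gc: "?G \<subseteq> carrier ?F" using F.sub_carrier[OF N] by auto
      have gG: "submodule (?g ?G) R ?F" by (rule F.generated_submodule_sub[OF Gc])
      have gN: "?g ?G \<subseteq> N" by (rule F.generated_submodule_least[OF N GN])
      have up: "?G \<subseteq> ?g ?G" by (rule F.generated_submodule_upper)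
      \<comment> \<open>The projection of the generated submodule is an ideal containing A, so it
        covers all values on N. Every v in N can then be corrected to a vector vanishing at
        k.\<close>
      have "ideal ((\<lambda>v. v k) ` ?g ?G) R"
        using k.sub_image[OF gG] F.submoduleE(1)[OF gG] submodule_self_iff by blast
      moreover have "A \<subseteq> (\<lambda>v. v k) ` ?g ?G" using G1 up by auto
      ultimately have cov: "(\<lambda>v. v k) ` N \<subseteq> (\<lambda>v. v k) ` ?g ?G"
        unfolding A(3) by (rule genideal_minimal)
      have "N \<subseteq> ?g ?G"
      proof
        fix v assume v: "v \<in> N"
        then obtain u where u: "u \<in> ?g ?G" "u k = v k" using cov by force
        have uN: "u \<in> N" using u gN by auto
        have c: "u \<in> carrier ?F" "v \<in> carrier ?F" using uN v F.sub_carrier[OF N] by auto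
        have "(v \<ominus>\<^bsub>?F\<^esub> u) k = (v \<oplus>\<^bsub>?F\<^esub> (\<ominus> \<one>) \<odot>\<^bsub>?F\<^esub> u) k"
          using c by (simp add: F.smult_l_minus a_minus_def)
        also have "\<dots> = \<zero>" using PiE_mem[of v "{..<n}" "\<lambda>_. carrier R" k] c u k by (simp add: free_module_simps l_minus r_neg)
        finally have "v \<ominus>\<^bsub>?F\<^esub> u \<in> ?N0" using F.sub_minus[OF N v uN] by simp
        moreover have "?g G0 \<subseteq> ?g ?G" using F.generated_submodule_least[OF gG] up by auto
        ultimately have "v \<ominus>\<^bsub>?F\<^esub> u \<in> ?g ?G" using G0 by auto
        then have "(v \<ominus>\<^bsub>?F\<^esub> u) \<oplus>\<^bsub>?F\<^esub> u \<in> ?g ?G" using F.sub_add[OF gG _ u(1)] by simp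
        moreover have "(v \<ominus>\<^bsub>?F\<^esub> u) \<oplus>\<^bsub>?F\<^esub> u = v"
          using c by (simp add: a_minus_def F.M.a_assoc F.M.l_neg)
        ultimately show "v \<in> ?g ?G" by simp
      qed
      then show ?thesis using GN G0 G1 by (intro exI[of _ ?G]) auto
    qed
  qed
  from this[OF assms(2), of n] obtain G where "finite G" "G \<subseteq> N" "N \<subseteq> ?g G"
    by (meson leD)
  then show ?thesis using F.generated_submodule_least[OF assms(2)] by blast
qed

lemma (in noetherian_ring) kernel_cover:
  assumes "cring R" and "linear_map R (free_module R p) X (carrier (free_module R p)) f"
  shows "\<exists>q. \<exists>d\<in>module_hom R (free_module R q) (free_module R p).
    d ` carrier (free_module R q) = {v \<in> carrier (free_module R p). f v = \<zero>\<^bsub>X\<^esub>}"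
proof -
  interpret cring R by fact
  interpret f: linear_map R "free_module R p" X "carrier (free_module R p)" f by fact
  let ?K = "{v \<in> carrier (free_module R p). f v \<in> {\<zero>\<^bsub>X\<^esub>}}"
  have "submodule {\<zero>\<^bsub>X\<^esub>} R X" by (rule f.M'.submoduleI') auto
  then have "submodule ?K R (free_module R p)" by (rule f.sub_vimage)
  then obtain G where G: "finite G" "G \<subseteq> ?K" "?K = generated_submodule R (free_module R p) G"
    using free_module_noetherian[OF assms(1)] by meson
  have "G \<subseteq> carrier (free_module R p)" using G(2) by auto
  then show ?thesis using free_cover[OF free_module_module G(1), of p] G(3) by simp
qed

text \<open>\<open>ext_module\<close> selects its resolution by \<open>SOME\<close>, so nothing is
  known about that choice until some resolution has been exhibited.\<close>

lemma (in noetherian_ring) free_resolution_exists: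
  assumes "cring R" and "module R M" and "finitely_generated_module R M"
  shows "\<exists>n d e. free_resolution R M n e d"
proof -
  interpret cring R by fact
  interpret M: module R M by fact
  let ?F = "free_module R"
  obtain n0 e where e: "e \<in> module_hom R (?F n0) M" "e ` carrier (?F n0) = carrier M"
    using free_cover[OF assms(2)] assms(3) unfolding finitely_generated_module_def by metis
  obtain q0 d0 where d0: "d0 \<in> module_hom R (?F q0) (?F n0)"
    "d0 ` carrier (?F q0) = {v \<in> carrier (?F n0). e v = \<zero>\<^bsub>M\<^esub>}"
    using kernel_cover[OF assms(1) linear_map_of_hom[OF free_module_module assms(2) e(1)]] by blast
  \<comment> \<open>The state of the dependent choice is a triple (p, q, d) with d a map from rank q
    to rank p. \<open>P\<close> fixes the first triple, and \<open>S\<close> demands that the next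
    map covers the kernel of the present one.\<close>
  define P where "P = (\<lambda>(i::nat) (p, q, d). d \<in> module_hom R (?F q) (?F p) \<and> (i = 0 \<longrightarrow> p = n0 \<and> q = q0 \<and> d = d0))"
  define S where "S = (\<lambda>(i::nat) (p::nat, q, d) (p', q', d'). p' = q \<and>
      d' ` carrier (?F q') = {v \<in> carrier (?F q). d v = \<zero>\<^bsub>?F p\<^esub>})"
  have "\<exists>f. \<forall>i. P i (f i) \<and> S i (f i) (f (Suc i))"
  proof (rule dependent_nat_choice)
    show "\<exists>x. P 0 x" using d0 by (auto simp: P_def)
    fix x i assume "P i x"
    then obtain p q d where x: "x = (p, q, d)" "d \<in> module_hom R (?F q) (?F p)"
      by (auto simp: P_def)
    obtain q' d' where "d' \<in> module_hom R (?F q') (?F q)"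
      "d' ` carrier (?F q') = {v \<in> carrier (?F q). d v = \<zero>\<^bsub>?F p\<^esub>}"
      using kernel_cover[OF assms(1) linear_map_of_hom[OF free_module_module free_module_module x(2)]] by blast
    then show "\<exists>y. P (Suc i) y \<and> S i x y"
      by (intro exI[of _ "(q, q', d')"]) (simp add: P_def S_def x(1))
  qed
  then obtain f where f: "\<And>i. P i (f i)" "\<And>i. S i (f i) (f (Suc i))" by blast
  define n where "n = (\<lambda>i. fst (f i))"
  define d where "d = (\<lambda>i. snd (snd (f i)))"
  have q: "fst (snd (f i)) = n (Suc i)" for i
    using f(2)[of i] by (auto simp: S_def n_def split: prod.splits)
  have fi: "f i = (n i, n (Suc i), d i)" for i
    using q[of i] by (simp add: n_def d_def prod_eq_iff)
  have "free_resolution R M n e d"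
    unfolding free_resolution_def
    using f(1)[of 0] f(1) f(2) e d0 by (auto simp: fi P_def S_def)
  then show ?thesis by blast
qed

section \<open>Submodules of an overring\<close>

locale overring = Q?: cring Q + R: cring R for Q :: "('a, 'b) ring_scheme" (structure) and R :: "('a, 'b) ring_scheme" +
  assumes carrier_sub: "carrier R \<subseteq> carrier Q"
    and R_eq: "R = Q\<lparr>carrier := carrier R\<rparr>"
begin

lemma ops [simp]:
  "add R = add Q" "monoid.mult R = monoid.mult Q" "zero R = zero Q" "one R = one Q"
  by (subst R_eq, simp)+

abbreviation "V \<equiv> ring_module Q (carrier Q)"

lemma R_mem [simp, intro]: "r \<in> carrier R \<Longrightarrow> r \<in> carrier Q"
  using carrier_sub by auto

lemma module_V: "module R V"
proof (rule moduleI)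
  show "abelian_group V"
    by (rule abelian_groupI) (auto simp: a_ac intro: bexI[of _ "\<ominus> x" for x] l_neg)
qed (auto simp: R.cring_axioms l_distr r_distr m_assoc)

sublocale V: module R V
  by (rule module_V)

lemma fsubI:
  assumes "X \<subseteq> carrier Q" "\<zero> \<in> X"
    and "\<And>x y. x \<in> X \<Longrightarrow> y \<in> X \<Longrightarrow> x \<oplus> y \<in> X"
    and "\<And>r x. r \<in> carrier R \<Longrightarrow> x \<in> X \<Longrightarrow> r \<otimes> x \<in> X"
  shows "submodule X R V"
  by (rule V.submoduleI') (use assms in auto)

lemma fsubD:
  assumes "submodule X R V"
  shows "x \<in> X \<Longrightarrow> x \<in> carrier Q" "\<zero> \<in> X"
    and "x \<in> X \<Longrightarrow> y \<in> X \<Longrightarrow> x \<oplus> y \<in> X"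
    and "r \<in> carrier R \<Longrightarrow> x \<in> X \<Longrightarrow> r \<otimes> x \<in> X"
  using V.sub_carrier[OF assms] V.sub_zero[OF assms] V.sub_add[OF assms] V.sub_smult[OF assms] by auto

lemma linear_map_V:
  assumes "module R M"
    and "\<And>x. x \<in> carrier M \<Longrightarrow> f x \<in> carrier Q"
    and "\<And>x y. x \<in> carrier M \<Longrightarrow> y \<in> carrier M \<Longrightarrow> f (x \<oplus>\<^bsub>M\<^esub> y) = f x \<oplus> f y"
    and "\<And>r x. r \<in> carrier R \<Longrightarrow> x \<in> carrier M \<Longrightarrow> f (r \<odot>\<^bsub>M\<^esub> x) = r \<otimes> f x"
  shows "linear_map R M V (carrier M) f"
  by (intro linear_map.intro linear_map_axioms.intro assms(1) module_V module.carrier_is_submodule)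
    (use assms in auto)

text \<open>The inverse isomorphism is regarded as a map into Q, where values of homomorphisms into
  M can be divided by a.\<close>

lemma inverse_linear:
  assumes M: "module R M" and C: "submodule C R V"
    and \<phi>: "\<phi> \<in> module_hom R (ring_module Q C) M" and bij: "bij_betw \<phi> C (carrier M)"
  defines "\<phi>' \<equiv> inv_into C \<phi>"
  shows "linear_map R M V (carrier M) \<phi>'" "y \<in> carrier M \<Longrightarrow> \<phi>' y \<in> C"
    and "y \<in> carrier M \<Longrightarrow> \<phi> (\<phi>' y) = y" "c \<in> C \<Longrightarrow> \<phi>' (\<phi> c) = c"
    and "c \<in> C \<Longrightarrow> \<phi> c \<in> carrier M"
proof -
  interpret M: module R M by fact
  have 1: "\<phi>' y \<in> C" "\<phi> (\<phi>' y) = y" if "y \<in> carrier M" for y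
    using bij that by (auto simp: \<phi>'_def bij_betw_def inv_into_into f_inv_into_f)
  have 2: "\<phi>' (\<phi> c) = c" if "c \<in> C" for c
    using bij that by (auto simp: \<phi>'_def bij_betw_def)
  have hom: "\<phi> (x \<oplus> y) = \<phi> x \<oplus>\<^bsub>M\<^esub> \<phi> y" "\<phi> (r \<otimes> x) = r \<odot>\<^bsub>M\<^esub> \<phi> x"
    if "x \<in> C" "y \<in> C" "r \<in> carrier R" for x y r
    using \<phi> that by (auto simp: module_hom_def)
  show "linear_map R M V (carrier M) \<phi>'"
  proof (rule linear_map_V[OF M])
    show "\<phi>' x \<in> carrier Q" if "x \<in> carrier M" for x using 1(1)[OF that] fsubD(1)[OF C] by simp
    show "\<phi>' (x \<oplus>\<^bsub>M\<^esub> y) = \<phi>' x \<oplus> \<phi>' y" if xy: "x \<in> carrier M" "y \<in> carrier M" for x y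
    proof -
      have "\<phi>' x \<oplus> \<phi>' y \<in> C" using 1 xy fsubD(3)[OF C] by simp
      moreover have "\<phi> (\<phi>' x \<oplus> \<phi>' y) = x \<oplus>\<^bsub>M\<^esub> y" using 1 xy hom(1) R.one_closed by metis
      ultimately show ?thesis using 2 by metis
    qed
    show "\<phi>' (r \<odot>\<^bsub>M\<^esub> x) = r \<otimes> \<phi>' x" if r: "r \<in> carrier R" and x: "x \<in> carrier M" for r x
    proof -
      have "r \<otimes> \<phi>' x \<in> C" using 1 r x fsubD(4)[OF C] by simp
      moreover have "\<phi> (r \<otimes> \<phi>' x) = r \<odot>\<^bsub>M\<^esub> x" using 1 r x hom(2) by metis
      ultimately show ?thesis using 2 by metis
    qed
  qed
  show "y \<in> carrier M \<Longrightarrow> \<phi>' y \<in> C" "y \<in> carrier M \<Longrightarrow> \<phi> (\<phi>' y) = y" "c \<in> C \<Longrightarrow> \<phi>' (\<phi> c) = c"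
    "c \<in> C \<Longrightarrow> \<phi> c \<in> carrier M"
    using 1 2 bij by (auto simp: bij_betw_def)
qed

end

section \<open>The first Bass number of a fractional ideal\<close>

text \<open>Let \<open>F\<^sub>2 \<rightarrow> F\<^sub>1 \<rightarrow> F\<^sub>0 \<rightarrow> R/\<mm>\<close> be the chosen resolution and let \<open>v\<^sub>0 \<in> F\<^sub>0\<close> lift \<open>1\<close>. A cocycle
  \<open>f\<close> on \<open>F\<^sub>1\<close> descends to the image of \<open>d\<^sub>0\<close>, which contains \<open>a v\<^sub>0 = d\<^sub>0 u\<close>, and it extends
  uniquely to a map \<open>F\<^sub>0 \<rightarrow> Q\<close>. The value \<open>a\<^sup>-\<^sup>1 f(u)\<close> of this extension at \<open>v\<^sub>0\<close> lies in \<open>C : \<mm>\<close>, and it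
  lies in \<open>C\<close> iff \<open>f\<close> is a coboundary.\<close>

lemma (in overring) bass_number_1:
  assumes noeth: "noetherian_ring R" and \<mm>: "ideal \<mm> R" and a: "a \<in> \<mm>" "a \<in> Units Q"
    and M: "module R M" and C: "submodule C R V"
    and \<phi>: "\<phi> \<in> module_hom R (ring_module Q C) M" and bij: "bij_betw \<phi> C (carrier M)"
  shows "bass_number R \<mm> M 1 = mlen R V C {q \<in> carrier Q. \<forall>\<mu>\<in>\<mm>. \<mu> \<otimes> q \<in> C}"
proof -
  let ?S = "ring_module R (carrier R)"
  let ?k = "residue_module R \<mm>"
  let ?F = "\<lambda>i. free_module R i"
  let ?D = "{q \<in> carrier Q. \<forall>\<mu>\<in>\<mm>. \<mu> \<otimes> q \<in> C}"
  interpret S: module R ?S by (rule R.module_self)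
  interpret M: module R M by (rule M)
  interpret \<mm>: ideal \<mm> R by (rule \<mm>)
  have mS: "submodule \<mm> R ?S" using \<mm> R.submodule_self_iff by simp
  have mR: "\<mu> \<in> \<mm> \<Longrightarrow> \<mu> \<in> carrier R" for \<mu> by (rule \<mm>.a_Hcarr)
  have aR: "a \<in> carrier R" using mR a by simp
  have ai: "inv a \<in> carrier Q" "inv a \<otimes> a = \<one>" "a \<otimes> inv a = \<one>" using a by auto
  have a_cancel: "inv a \<otimes> (a \<otimes> x) = x" if "x \<in> carrier Q" for x
    using that ai aR by (simp add: m_assoc[symmetric])
  have kmod: "module R ?k" unfolding residue_module_def by (rule S.quot_module_module[OF mS])
  interpret k: module R ?k by (rule kmod)
  have kcar: "carrier ?k = (\<lambda>x. \<mm> +>\<^bsub>?S\<^esub> x) ` carrier R"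
    by (simp add: residue_module_def S.quot_module_carrier)
  have ksm: "r \<odot>\<^bsub>?k\<^esub> (\<mm> +>\<^bsub>?S\<^esub> x) = \<mm> +>\<^bsub>?S\<^esub> (r \<otimes> x)" if "r \<in> carrier R" "x \<in> carrier R" for r x
    using S.quot_module_smult[OF mS that(1), of x] that(2) by (simp add: residue_module_def)
  have kz: "\<mm> +>\<^bsub>?S\<^esub> x = \<zero>\<^bsub>?k\<^esub> \<longleftrightarrow> x \<in> \<mm>" if "x \<in> carrier R" for x
    using S.coset_eq_zero_iff[OF mS, of x] that by (simp add: residue_module_def S.quot_module_zero)
  have kann: "\<mu> \<odot>\<^bsub>?k\<^esub> y = \<zero>\<^bsub>?k\<^esub>" if \<mu>: "\<mu> \<in> \<mm>" and y: "y \<in> carrier ?k" for \<mu> y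
  proof -
    obtain x where x: "x \<in> carrier R" "y = \<mm> +>\<^bsub>?S\<^esub> x" using y kcar by auto
    have "\<mu> \<otimes> x \<in> \<mm>" using \<mm>.I_r_closed[OF \<mu> x(1)] by simp
    then show ?thesis using ksm[OF mR[OF \<mu>] x(1)] kz[of "\<mu> \<otimes> x"] mR x(2) by auto
  qed
  let ?o = "\<mm> +>\<^bsub>?S\<^esub> \<one>"
  have o: "?o \<in> carrier ?k" using kcar R.one_closed by auto
  have kcyc: "\<exists>r\<in>carrier R. y = r \<odot>\<^bsub>?k\<^esub> ?o" if y: "y \<in> carrier ?k" for y
  proof -
    obtain x where x: "x \<in> carrier R" "y = \<mm> +>\<^bsub>?S\<^esub> x" using y kcar by auto
    then have "y = x \<odot>\<^bsub>?k\<^esub> ?o" using ksm[OF x(1) R.one_closed] by simp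
    then show ?thesis using x(1) by blast
  qed
  have kfg: "finitely_generated_module R ?k"
  proof -
    have gs: "submodule (generated_submodule R ?k {?o}) R ?k" by (rule k.generated_submodule_sub) (use o in simp)
    have "?o \<in> generated_submodule R ?k {?o}" using k.generated_submodule_upper[of "{?o}"] by simp
    then have "y \<in> generated_submodule R ?k {?o}" if "y \<in> carrier ?k" for y
      using kcyc[OF that] k.sub_smult[OF gs] by auto
    then have "generated_submodule R ?k {?o} = carrier ?k" using k.submoduleE(1)[OF gs] by auto
    then show ?thesis unfolding finitely_generated_module_def using o by (intro exI[of _ "{?o}"]) simp
  qed
  \<comment> \<open>Of the chosen resolution only exactness is known; its ranks and maps are
    arbitrary.\<close>
  obtain n d where nd: "(SOME (n, d). \<exists>e. free_resolution R ?k n e d) = (n, d)"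
    by (cases "SOME (n, d). \<exists>e. free_resolution R ?k n e d") blast
  have "\<exists>nd. case nd of (n, d) \<Rightarrow> \<exists>e. free_resolution R ?k n e d"
    using noetherian_ring.free_resolution_exists[OF noeth R.cring_axioms kmod kfg] by auto
  from someI_ex[OF this] obtain e where res: "free_resolution R ?k n e d"
    unfolding nd by auto
  let ?F0 = "?F (n 0)" and ?F1 = "?F (n (Suc 0))" and ?F2 = "?F (n (Suc (Suc 0)))"
  let ?d0 = "d 0" and ?d1 = "d (Suc 0)"
  have homs: "e \<in> module_hom R ?F0 ?k" "?d0 \<in> module_hom R ?F1 ?F0" "?d1 \<in> module_hom R ?F2 ?F1"
    and eimg: "e ` carrier ?F0 = carrier ?k"
    and ex0: "?d0 ` carrier ?F1 = {v \<in> carrier ?F0. e v = \<zero>\<^bsub>?k\<^esub>}"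
    and ex1: "?d1 ` carrier ?F2 = {v \<in> carrier ?F1. ?d0 v = \<zero>\<^bsub>?F0\<^esub>}"
    using res unfolding free_resolution_def by auto
  interpret e: linear_map R ?F0 ?k "carrier ?F0" e
    by (rule linear_map_of_hom[OF R.free_module_module kmod homs(1)])
  interpret d0: linear_map R ?F1 ?F0 "carrier ?F1" ?d0
    by (rule linear_map_of_hom[OF R.free_module_module R.free_module_module homs(2)])
  interpret d1: linear_map R ?F2 ?F1 "carrier ?F2" ?d1
    by (rule linear_map_of_hom[OF R.free_module_module R.free_module_module homs(3)])
  have d0_lift: "\<exists>w\<in>carrier ?F1. ?d0 w = v" if "v \<in> carrier ?F0" "e v = \<zero>\<^bsub>?k\<^esub>" for v
    using that ex0 by (metis (mono_tags, lifting) imageE mem_Collect_eq)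
  have d0_m: "\<exists>w\<in>carrier ?F1. ?d0 w = \<mu> \<odot>\<^bsub>?F0\<^esub> v" if "\<mu> \<in> \<mm>" "v \<in> carrier ?F0" for \<mu> v
    using that mR by (intro d0_lift) (auto simp: e.\<psi>_smult e.\<psi>_closed kann)
  have e_d0: "e (?d0 w) = \<zero>\<^bsub>?k\<^esub>" if "w \<in> carrier ?F1" for w using that ex0 by auto
  obtain v0 where v0: "v0 \<in> carrier ?F0" "e v0 = ?o" using eimg o by (metis imageE)
  \<comment> \<open>Such a u exists because a kills the residue field, so a v0 lies in the kernel of
    e, which is the image of the first differential.\<close>
  obtain u where u: "u \<in> carrier ?F1" "?d0 u = a \<odot>\<^bsub>?F0\<^esub> v0" using d0_m[OF a(1) v0(1)] by blast
  define \<phi>' where "\<phi>' = inv_into C \<phi>"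
  note inv = inverse_linear[OF M C \<phi> bij, folded \<phi>'_def]
  interpret p: linear_map R M V "carrier M" \<phi>' by (rule inv(1))
  have padd: "\<phi>' (x \<oplus>\<^bsub>M\<^esub> y) = \<phi>' x \<oplus> \<phi>' y" if "x \<in> carrier M" "y \<in> carrier M" for x y
    using p.\<psi>_add[OF that] by simp
  have psm: "\<phi>' (r \<odot>\<^bsub>M\<^esub> x) = r \<otimes> \<phi>' x" if "r \<in> carrier R" "x \<in> carrier M" for r x
    using p.\<psi>_smult[OF that] by simp
  have pQ: "\<phi>' x \<in> carrier Q" if "x \<in> carrier M" for x using p.\<psi>_closed[OF that] by simp
  have hadd: "\<phi> (x \<oplus> y) = \<phi> x \<oplus>\<^bsub>M\<^esub> \<phi> y" if "x \<in> C" "y \<in> C" for x y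
    using \<phi> that by (auto simp: module_hom_def)
  have hsm: "\<phi> (r \<otimes> x) = r \<odot>\<^bsub>M\<^esub> \<phi> x" if "r \<in> carrier R" "x \<in> C" for x r
    using \<phi> that by (auto simp: module_hom_def)
  have hz: "\<phi> \<zero> = \<zero>\<^bsub>M\<^esub>"
    using inv(3)[of "\<zero>\<^bsub>M\<^esub>"] p.\<psi>_zero by simp
  define Z where "Z = cocycles R n d M (Suc 0)"
  define B where "B = coboundaries R n d M (Suc 0)"
  \<comment> \<open>The value at v0 of the extension of f to a map from the free module of rank
    \<open>n 0\<close> to Q, as a v0 is the image of u.\<close>
  define \<psi> where "\<psi> = (\<lambda>f. inv a \<otimes> \<phi>' (f u))"
  let ?H = "fun_module (carrier ?F1) M"
  let ?HZ = "?H\<lparr>carrier := Z\<rparr>"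
  interpret H: module R ?H by (rule M.fun_module_module)
  have Z_iff: "f \<in> Z \<longleftrightarrow> f \<in> module_hom R ?F1 M \<and> (\<forall>v\<in>carrier ?F2. f (?d1 v) = \<zero>\<^bsub>M\<^esub>)" for f
    by (simp add: Z_def cocycles_def)
  have Zlin: "linear_map R ?F1 M (carrier ?F1) f" if "f \<in> Z" for f
    using that linear_map_of_hom[OF R.free_module_module M] Z_iff by blast
  have Zc: "f w \<in> carrier M" if "f \<in> Z" "w \<in> carrier ?F1" for f w
    using linear_map.\<psi>_closed[OF Zlin[OF that(1)] that(2)] .
  have Zadd: "f (w \<oplus>\<^bsub>?F1\<^esub> w') = f w \<oplus>\<^bsub>M\<^esub> f w'" if "f \<in> Z" "w \<in> carrier ?F1" "w' \<in> carrier ?F1" for f w w'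
    using linear_map.\<psi>_add[OF Zlin[OF that(1)] that(2,3)] .
  have Zsm: "f (r \<odot>\<^bsub>?F1\<^esub> w) = r \<odot>\<^bsub>M\<^esub> f w" if "f \<in> Z" "r \<in> carrier R" "w \<in> carrier ?F1" for f r w
    using linear_map.\<psi>_smult[OF Zlin[OF that(1)] that(2,3)] .
  \<comment> \<open>By exactness, elements with the same image under the first differential differ
    by a boundary, on which the cocycle f vanishes.\<close>
  have Zwd: "f w = f w'" if f: "f \<in> Z" and w: "w \<in> carrier ?F1" "w' \<in> carrier ?F1" and eq: "?d0 w = ?d0 w'" for f w w'
  proof -
    have "?d0 (w \<ominus>\<^bsub>?F1\<^esub> w') = \<zero>\<^bsub>?F0\<^esub>"
      using d0.\<psi>_minus[OF w] eq d0.\<psi>_closed[OF w(2)] by (simp add: a_minus_def e.M.M.r_neg)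
    then have "w \<ominus>\<^bsub>?F1\<^esub> w' \<in> ?d1 ` carrier ?F2" using ex1 d0.\<psi>_minus(1)[OF w] by auto
    then have "f (w \<ominus>\<^bsub>?F1\<^esub> w') = \<zero>\<^bsub>M\<^esub>" using f Z_iff by auto
    then have "f w \<ominus>\<^bsub>M\<^esub> f w' = \<zero>\<^bsub>M\<^esub>" using linear_map.\<psi>_minus(2)[OF Zlin[OF f] w] by simp
    then show ?thesis
      using Zc[OF f w(1)] Zc[OF f w(2)] M.M.minus_equality[of "f w" "\<ominus>\<^bsub>M\<^esub> f w'"]
      by (simp add: a_minus_def)
  qed
  have ZH: "submodule Z R ?H"
  proof (rule H.submoduleI')
    show "Z \<subseteq> carrier ?H" by (auto simp: Z_iff module_hom_def fun_module_def)
    show "\<zero>\<^bsub>?H\<^esub> \<in> Z"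
      using d0.M.M.add.m_closed d0.M.smult_closed d1.\<psi>_closed by (auto simp: Z_iff module_hom_def fun_module_def)
    fix f g assume f: "f \<in> Z" and g: "g \<in> Z"
    show "f \<oplus>\<^bsub>?H\<^esub> g \<in> Z"
      unfolding Z_iff module_hom_def
    proof (intro conjI CollectI ballI)
      show "f \<oplus>\<^bsub>?H\<^esub> g \<in> carrier ?F1 \<rightarrow>\<^sub>E carrier M" using Zc[OF f] Zc[OF g] by (simp add: fun_module_def)
      fix x y assume xy: "x \<in> carrier ?F1" "y \<in> carrier ?F1"
      show "(f \<oplus>\<^bsub>?H\<^esub> g) (x \<oplus>\<^bsub>?F1\<^esub> y) = (f \<oplus>\<^bsub>?H\<^esub> g) x \<oplus>\<^bsub>M\<^esub> (f \<oplus>\<^bsub>?H\<^esub> g) y"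
        using xy Zc[OF f] Zc[OF g] d0.M.M.add.m_closed[OF xy]
        by (simp add: fun_module_def Zadd[OF f] Zadd[OF g] M.M.a_ac)
    next
      fix r x assume r: "r \<in> carrier R" and x: "x \<in> carrier ?F1"
      show "(f \<oplus>\<^bsub>?H\<^esub> g) (r \<odot>\<^bsub>?F1\<^esub> x) = r \<odot>\<^bsub>M\<^esub> (f \<oplus>\<^bsub>?H\<^esub> g) x"
        using r x Zc[OF f] Zc[OF g] d0.M.smult_closed[OF r x]
        by (simp add: fun_module_def Zsm[OF f] Zsm[OF g] M.smult_r_distr)
    next
      fix v assume v: "v \<in> carrier ?F2"
      show "(f \<oplus>\<^bsub>?H\<^esub> g) (?d1 v) = \<zero>\<^bsub>M\<^esub>"
        using f g v d1.\<psi>_closed[OF v] by (simp add: fun_module_def Z_iff)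
    qed
  next
    fix r f assume r: "r \<in> carrier R" and f: "f \<in> Z"
    show "r \<odot>\<^bsub>?H\<^esub> f \<in> Z"
      unfolding Z_iff module_hom_def
    proof (intro conjI CollectI ballI)
      show "r \<odot>\<^bsub>?H\<^esub> f \<in> carrier ?F1 \<rightarrow>\<^sub>E carrier M" using Zc[OF f] r by (simp add: fun_module_def)
      fix x y assume xy: "x \<in> carrier ?F1" "y \<in> carrier ?F1"
      show "(r \<odot>\<^bsub>?H\<^esub> f) (x \<oplus>\<^bsub>?F1\<^esub> y) = (r \<odot>\<^bsub>?H\<^esub> f) x \<oplus>\<^bsub>M\<^esub> (r \<odot>\<^bsub>?H\<^esub> f) y"
        using xy r Zc[OF f] d0.M.M.add.m_closed[OF xy]
        by (simp add: fun_module_def Zadd[OF f] M.smult_r_distr)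
    next
      fix s x assume s: "s \<in> carrier R" and x: "x \<in> carrier ?F1"
      show "(r \<odot>\<^bsub>?H\<^esub> f) (s \<odot>\<^bsub>?F1\<^esub> x) = s \<odot>\<^bsub>M\<^esub> (r \<odot>\<^bsub>?H\<^esub> f) x"
        using r s x Zc[OF f x] d0.M.smult_closed[OF s x] M.smult_assoc1[of r s] M.smult_assoc1[of s r]
        by (simp add: fun_module_def Zsm[OF f] m_comm)
    next
      fix v assume v: "v \<in> carrier ?F2"
      show "(r \<odot>\<^bsub>?H\<^esub> f) (?d1 v) = \<zero>\<^bsub>M\<^esub>"
        using f r v d1.\<psi>_closed[OF v] by (simp add: fun_module_def Z_iff)
    qed
  qed
  interpret HZ: module R ?HZ by (rule submodule.submodule_is_module[OF ZH M.fun_module_module])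
  have lin: "linear_map R ?HZ V (carrier ?HZ) \<psi>"
  proof (rule linear_map_V[OF HZ.module_axioms])
    show "\<psi> f \<in> carrier Q" if "f \<in> carrier ?HZ" for f
      using that ai(1) pQ[OF Zc[of f u]] u by (simp add: \<psi>_def)
    show "\<psi> (f \<oplus>\<^bsub>?HZ\<^esub> g) = \<psi> f \<oplus> \<psi> g" if "f \<in> carrier ?HZ" "g \<in> carrier ?HZ" for f g
      using that ai(1) Zc[of f u] Zc[of g u] u by (simp add: \<psi>_def fun_module_def padd pQ r_distr)
    show "\<psi> (r \<odot>\<^bsub>?HZ\<^esub> f) = r \<otimes> \<psi> f" if "r \<in> carrier R" "f \<in> carrier ?HZ" for r f
      using that ai(1) Zc[of f u] u by (simp add: \<psi>_def fun_module_def psm pQ m_lcomm)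
  qed
  interpret \<psi>: linear_map R ?HZ V "carrier ?HZ" \<psi> by (rule lin)
  have a\<psi>: "a \<otimes> \<psi> f = \<phi>' (f u)" if "f \<in> Z" for f
    using ai aR pQ[OF Zc[OF that u(1)]] by (simp add: \<psi>_def m_assoc[symmetric])
  have \<psi>D: "\<psi> f \<in> ?D" if f: "f \<in> Z" for f
  proof (intro CollectI conjI ballI)
    show fQ: "\<psi> f \<in> carrier Q" using \<psi>.\<psi>_closed[of f] f by simp
    fix \<mu> assume \<mu>: "\<mu> \<in> \<mm>"
    obtain w where w: "w \<in> carrier ?F1" "?d0 w = \<mu> \<odot>\<^bsub>?F0\<^esub> v0" using d0_m[OF \<mu> v0(1)] by blast
    \<comment> \<open>Both sides equal \<mu> a v0. Comparing the values of f there and dividing by a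
      gives \<mu> \<psi>(f) = \<phi>'(f(w)), an element of C.\<close>
    have "?d0 (\<mu> \<odot>\<^bsub>?F1\<^esub> u) = ?d0 (a \<odot>\<^bsub>?F1\<^esub> w)"
      using u w v0(1) mR[OF \<mu>] aR e.M.smult_assoc1[of \<mu> a v0] e.M.smult_assoc1[of a \<mu> v0]
      by (simp add: d0.\<psi>_smult m_comm)
    then have "f (\<mu> \<odot>\<^bsub>?F1\<^esub> u) = f (a \<odot>\<^bsub>?F1\<^esub> w)"
      using Zwd[OF f] u w mR[OF \<mu>] aR by simp
    then have "\<mu> \<otimes> \<phi>' (f u) = a \<otimes> \<phi>' (f w)"
      using Zsm[OF f] psm Zc[OF f] u w mR[OF \<mu>] aR by metis
    then have "\<mu> \<otimes> \<psi> f = \<phi>' (f w)"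
      using a_cancel[OF pQ[OF Zc[OF f w(1)]]] ai(1) mR[OF \<mu>] pQ[OF Zc[OF f u(1)]]
      by (simp add: \<psi>_def m_lcomm[of \<mu> "inv a"])
    then show "\<mu> \<otimes> \<psi> f \<in> C" using inv(2)[OF Zc[OF f w(1)]] by simp
  qed
  have BZ: "B \<subseteq> {f \<in> Z. \<psi> f \<in> C}"
  proof
    fix f assume "f \<in> B"
    then obtain g where g: "g \<in> module_hom R ?F0 M" and fg: "f = (\<lambda>v\<in>carrier ?F1. g (?d0 v))"
      by (auto simp: B_def)
    interpret g: linear_map R ?F0 M "carrier ?F0" g
      by (rule linear_map_of_hom[OF R.free_module_module M g])
    have "f \<in> Z"
      unfolding Z_iff module_hom_def
    proof (intro conjI CollectI ballI)
      show "f \<in> carrier ?F1 \<rightarrow>\<^sub>E carrier M" using g.\<psi>_closed d0.\<psi>_closed by (simp add: fg)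
      fix v assume v: "v \<in> carrier ?F2"
      then have "?d0 (?d1 v) = \<zero>\<^bsub>?F0\<^esub>" using ex1 by auto
      then show "f (?d1 v) = \<zero>\<^bsub>M\<^esub>" using d1.\<psi>_closed[OF v] g.\<psi>_zero by (simp add: fg)
    qed (use d0.\<psi>_closed in \<open>simp_all add: fg d0.\<psi>_add g.\<psi>_add d0.\<psi>_smult g.\<psi>_smult\<close>)
    moreover have "\<psi> f = \<phi>' (g v0)"
      using u aR v0(1) g.\<psi>_closed[OF v0(1)] by (simp add: \<psi>_def fg g.\<psi>_smult psm a_cancel pQ)
    ultimately show "f \<in> {f \<in> Z. \<psi> f \<in> C}" using inv(2)[OF g.\<psi>_closed[OF v0(1)]] by simp
  qed
  have ZB: "{f \<in> Z. \<psi> f \<in> C} \<subseteq> B"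
  proof
    fix f assume "f \<in> {f \<in> Z. \<psi> f \<in> C}"
    then have f: "f \<in> Z" and fC: "\<psi> f \<in> C" by auto
    \<comment> \<open>A lift of a v, which exists because \<mm> kills the residue field. The choice
      is harmless, since f depends only on the image of the lift.\<close>
    define w where "w = (\<lambda>v. SOME w. w \<in> carrier ?F1 \<and> ?d0 w = a \<odot>\<^bsub>?F0\<^esub> v)"
    have w: "w v \<in> carrier ?F1" "?d0 (w v) = a \<odot>\<^bsub>?F0\<^esub> v" if "v \<in> carrier ?F0" for v
      using someI_ex[of "\<lambda>w. w \<in> carrier ?F1 \<and> ?d0 w = a \<odot>\<^bsub>?F0\<^esub> v"] d0_m[OF a(1) that]
      unfolding w_def by blast+
    have fw: "f (w v) = f x" if "v \<in> carrier ?F0" "x \<in> carrier ?F1" "?d0 x = a \<odot>\<^bsub>?F0\<^esub> v" for v x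
      using Zwd[OF f w(1)[OF that(1)] that(2)] w(2)[OF that(1)] that(3) by simp
    define g0 where "g0 = (\<lambda>v. inv a \<otimes> \<phi>' (f (w v)))"
    \<comment> \<open>Since v0 generates the residue field, v = r v0 + d0(x) for some r and x. The
      extension then takes the value r \<psi>(f) + \<phi>'(f(x)) at v, and both summands lie in
      C.\<close>
    have g0C: "g0 v \<in> C" if v: "v \<in> carrier ?F0" for v
    proof -
      obtain r where r: "r \<in> carrier R" "e v = r \<odot>\<^bsub>?k\<^esub> ?o" using kcyc[OF e.\<psi>_closed[OF v]] by blast
      have rv: "r \<odot>\<^bsub>?F0\<^esub> v0 \<in> carrier ?F0" using r v0 by simp
      have "e (v \<ominus>\<^bsub>?F0\<^esub> r \<odot>\<^bsub>?F0\<^esub> v0) = \<zero>\<^bsub>?k\<^esub>"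
        using e.\<psi>_minus[OF v rv] r v0 e.\<psi>_closed[OF v] by (simp add: e.\<psi>_smult a_minus_def k.M.r_neg)
      then obtain x where x: "x \<in> carrier ?F1" "?d0 x = v \<ominus>\<^bsub>?F0\<^esub> r \<odot>\<^bsub>?F0\<^esub> v0"
        using d0_lift e.\<psi>_minus(1)[OF v rv] by blast
      have "r \<odot>\<^bsub>?F0\<^esub> v0 \<oplus>\<^bsub>?F0\<^esub> ?d0 x = v"
        using x(2) v rv by (simp add: a_minus_def e.M.M.a_lcomm[of "r \<odot>\<^bsub>?F0\<^esub> v0" v] e.M.M.r_neg)
      then have "a \<odot>\<^bsub>?F0\<^esub> v = ?d0 (r \<odot>\<^bsub>?F1\<^esub> u \<oplus>\<^bsub>?F1\<^esub> a \<odot>\<^bsub>?F1\<^esub> x)"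
        using r aR u x(1) v0(1) rv d0.\<psi>_closed[OF x(1)] e.M.smult_assoc1[of r a v0] e.M.smult_assoc1[of a r v0]
          e.M.smult_r_distr[OF aR rv d0.\<psi>_closed[OF x(1)]]
        by (simp add: d0.\<psi>_add d0.\<psi>_smult m_comm)
      then have "f (w v) = r \<odot>\<^bsub>M\<^esub> f u \<oplus>\<^bsub>M\<^esub> a \<odot>\<^bsub>M\<^esub> f x"
        using fw[OF v, of "r \<odot>\<^bsub>?F1\<^esub> u \<oplus>\<^bsub>?F1\<^esub> a \<odot>\<^bsub>?F1\<^esub> x"] r aR u x(1) by (simp add: Zadd[OF f] Zsm[OF f])
      then have "g0 v = inv a \<otimes> (r \<otimes> \<phi>' (f u)) \<oplus> inv a \<otimes> (a \<otimes> \<phi>' (f x))"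
        using Zc[OF f u(1)] Zc[OF f x(1)] r(1) aR ai(1) by (simp add: g0_def padd psm pQ r_distr)
      also have "\<dots> = r \<otimes> \<psi> f \<oplus> \<phi>' (f x)"
        using Zc[OF f u(1)] Zc[OF f x(1)] r(1) ai(1) by (simp add: \<psi>_def a_cancel pQ m_lcomm)
      also have "\<dots> \<in> C"
        using fsubD(3,4)[OF C] fC r(1) inv(2)[OF Zc[OF f x(1)]] by simp
      finally show ?thesis .
    qed
    define g where "g = (\<lambda>v\<in>carrier ?F0. \<phi> (g0 v))"
    have "g \<in> module_hom R ?F0 M"
      unfolding module_hom_def
    proof (intro CollectI conjI ballI)
      show "g \<in> carrier ?F0 \<rightarrow>\<^sub>E carrier M" using inv(5)[OF g0C] by (simp add: g_def)
      fix x y assume x: "x \<in> carrier ?F0" and y: "y \<in> carrier ?F0"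
      have "f (w (x \<oplus>\<^bsub>?F0\<^esub> y)) = f (w x \<oplus>\<^bsub>?F1\<^esub> w y)"
        by (rule fw) (use x y w[OF x] w[OF y] aR in \<open>simp_all add: d0.\<psi>_add e.M.smult_r_distr\<close>)
      then have "g0 (x \<oplus>\<^bsub>?F0\<^esub> y) = g0 x \<oplus> g0 y"
        using w(1)[OF x] w(1)[OF y] ai(1) Zc[OF f w(1)[OF x]] Zc[OF f w(1)[OF y]]
        by (simp add: g0_def Zadd[OF f] padd pQ r_distr)
      then show "g (x \<oplus>\<^bsub>?F0\<^esub> y) = g x \<oplus>\<^bsub>M\<^esub> g y"
        using x y hadd[OF g0C[OF x] g0C[OF y]] by (simp add: g_def)
    next
      fix r x assume r: "r \<in> carrier R" and x: "x \<in> carrier ?F0"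
      have "f (w (r \<odot>\<^bsub>?F0\<^esub> x)) = f (r \<odot>\<^bsub>?F1\<^esub> w x)"
        by (rule fw) (use r x w[OF x] aR e.M.smult_assoc1[of r a x] e.M.smult_assoc1[of a r x] in
            \<open>simp_all add: d0.\<psi>_smult m_comm\<close>)
      then have "g0 (r \<odot>\<^bsub>?F0\<^esub> x) = r \<otimes> g0 x"
        using r w(1)[OF x] ai(1) Zc[OF f w(1)[OF x]] by (simp add: g0_def Zsm[OF f] psm pQ m_lcomm)
      then show "g (r \<odot>\<^bsub>?F0\<^esub> x) = r \<odot>\<^bsub>M\<^esub> g x"
        using r x hsm[OF r g0C[OF x]] by (simp add: g_def)
    qed
    moreover have "f = (\<lambda>v\<in>carrier ?F1. g (?d0 v))"
    proof
      fix x
      show "f x = (\<lambda>v\<in>carrier ?F1. g (?d0 v)) x"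
      proof (cases "x \<in> carrier ?F1")
        case False
        then show ?thesis using f by (auto simp: Z_iff module_hom_def intro: PiE_arb)
      next
        case x: True
        have "f (w (?d0 x)) = f (a \<odot>\<^bsub>?F1\<^esub> x)"
          by (rule fw) (use x aR d0.\<psi>_closed in \<open>simp_all add: d0.\<psi>_smult\<close>)
        then have "g0 (?d0 x) = \<phi>' (f x)"
          using x aR Zc[OF f x] by (simp add: g0_def Zsm[OF f] psm a_cancel pQ)
        then show ?thesis using x d0.\<psi>_closed[OF x] inv(3)[OF Zc[OF f x]] by (simp add: g_def)
      qed
    qed
    ultimately show "f \<in> B" by (auto simp: B_def)
  qed
  have surj: "?D \<subseteq> \<psi> ` Z <+>\<^bsub>V\<^esub> C"
  proof
    fix q assume q: "q \<in> ?D"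
    then have qQ: "q \<in> carrier Q" by simp
    \<comment> \<open>The augmentation is lifted to a map \<epsilon> into R. On boundaries
      \<epsilon> has values in \<mm>, so multiplying these by q gives a cocycle with values in
      C.\<close>
    have "\<exists>r\<in>carrier R. e (unit_vec R (n 0) j) = \<mm> +>\<^bsub>?S\<^esub> r" for j
      using e.\<psi>_closed[OF R.unit_vec_carrier, of j] kcar by auto
    then obtain \<rho> where \<rho>: "\<And>j. \<rho> j \<in> carrier R" "\<And>j. e (unit_vec R (n 0) j) = \<mm> +>\<^bsub>?S\<^esub> \<rho> j" by metis
    obtain \<epsilon> where \<epsilon>: "\<epsilon> \<in> module_hom R ?F0 ?S" "\<And>j. j < n 0 \<Longrightarrow> \<epsilon> (unit_vec R (n 0) j) = \<rho> j"
      using R.free_module_hom_exists[OF R.module_self, of "n 0" \<rho>] \<rho>(1) by auto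
    interpret \<epsilon>: linear_map R ?F0 ?S "carrier ?F0" \<epsilon>
      by (rule linear_map_of_hom[OF R.free_module_module R.module_self \<epsilon>(1)])
    have \<epsilon>R: "\<epsilon> v \<in> carrier R" if "v \<in> carrier ?F0" for v using \<epsilon>.\<psi>_closed[OF that] by simp
    have \<epsilon>add: "\<epsilon> (x \<oplus>\<^bsub>?F0\<^esub> y) = \<epsilon> x \<oplus> \<epsilon> y" if "x \<in> carrier ?F0" "y \<in> carrier ?F0" for x y
      using \<epsilon>.\<psi>_add[OF that] by simp
    have \<epsilon>sm: "\<epsilon> (r \<odot>\<^bsub>?F0\<^esub> x) = r \<otimes> \<epsilon> x" if "r \<in> carrier R" "x \<in> carrier ?F0" for r x
      using \<epsilon>.\<psi>_smult[OF that] by simp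
    have kadd: "\<mm> +>\<^bsub>?S\<^esub> (x \<oplus> y) = (\<mm> +>\<^bsub>?S\<^esub> x) \<oplus>\<^bsub>?k\<^esub> (\<mm> +>\<^bsub>?S\<^esub> y)" if "x \<in> carrier R" "y \<in> carrier R" for x y
      using S.quot_module_add[OF mS, of x y] that by (simp add: residue_module_def)
    have "linear_map R ?F0 ?k (carrier ?F0) (\<lambda>v. \<mm> +>\<^bsub>?S\<^esub> \<epsilon> v)"
      by (intro linear_map.intro linear_map_axioms.intro R.free_module_module kmod e.M.carrier_is_submodule)
        (use \<epsilon>R in \<open>auto simp: kcar \<epsilon>add \<epsilon>sm ksm kadd\<close>)
    then have e\<epsilon>: "e v = \<mm> +>\<^bsub>?S\<^esub> \<epsilon> v" if "v \<in> carrier ?F0" for v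
      using R.free_module_hom_eqI[OF e.linear_map_axioms _ _ that] \<epsilon>(2) \<rho>(2) by simp
    have \<epsilon>m: "\<epsilon> (?d0 x) \<in> \<mm>" if "x \<in> carrier ?F1" for x
      using e_d0[OF that] e\<epsilon>[OF d0.\<psi>_closed[OF that]] kz[OF \<epsilon>R[OF d0.\<psi>_closed[OF that]]] by simp
    have inC: "\<epsilon> (?d0 x) \<otimes> q \<in> C" if "x \<in> carrier ?F1" for x using \<epsilon>m[OF that] q by simp
    define f where "f = (\<lambda>x\<in>carrier ?F1. \<phi> (\<epsilon> (?d0 x) \<otimes> q))"
    have fZ: "f \<in> Z"
      unfolding Z_iff module_hom_def
    proof (intro conjI CollectI ballI)
      show "f \<in> carrier ?F1 \<rightarrow>\<^sub>E carrier M" using inv(5)[OF inC] by (simp add: f_def)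
      fix x y assume x: "x \<in> carrier ?F1" and y: "y \<in> carrier ?F1"
      have "\<epsilon> (?d0 (x \<oplus>\<^bsub>?F1\<^esub> y)) \<otimes> q = \<epsilon> (?d0 x) \<otimes> q \<oplus> \<epsilon> (?d0 y) \<otimes> q"
        using x y qQ R_mem[OF \<epsilon>R[OF d0.\<psi>_closed[OF x]]] R_mem[OF \<epsilon>R[OF d0.\<psi>_closed[OF y]]] d0.\<psi>_closed
        by (simp add: d0.\<psi>_add \<epsilon>add l_distr)
      then show "f (x \<oplus>\<^bsub>?F1\<^esub> y) = f x \<oplus>\<^bsub>M\<^esub> f y"
        using x y hadd[OF inC[OF x] inC[OF y]] by (simp add: f_def)
    next
      fix r x assume r: "r \<in> carrier R" and x: "x \<in> carrier ?F1"
      have "\<epsilon> (?d0 (r \<odot>\<^bsub>?F1\<^esub> x)) \<otimes> q = r \<otimes> (\<epsilon> (?d0 x) \<otimes> q)"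
        using r x qQ R_mem[OF \<epsilon>R[OF d0.\<psi>_closed[OF x]]] d0.\<psi>_closed[OF x]
        by (simp add: d0.\<psi>_smult \<epsilon>sm m_assoc)
      then show "f (r \<odot>\<^bsub>?F1\<^esub> x) = r \<odot>\<^bsub>M\<^esub> f x"
        using r x hsm[OF r inC[OF x]] by (simp add: f_def)
    next
      fix v assume v: "v \<in> carrier ?F2"
      then have "?d0 (?d1 v) = \<zero>\<^bsub>?F0\<^esub>" using ex1 by auto
      then show "f (?d1 v) = \<zero>\<^bsub>M\<^esub>" using d1.\<psi>_closed[OF v] \<epsilon>.\<psi>_zero hz qQ by (simp add: f_def)
    qed
    have "\<phi>' (f u) = a \<otimes> (\<epsilon> v0 \<otimes> q)"
      using u(1) inv(4)[OF inC[OF u(1)]] u(2) v0(1) aR \<epsilon>R[OF v0(1)] qQ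
      by (simp add: f_def \<epsilon>sm m_assoc)
    then have \<psi>f: "\<psi> f = \<epsilon> v0 \<otimes> q" using a_cancel[of "\<epsilon> v0 \<otimes> q"] \<epsilon>R[OF v0(1)] qQ by (simp add: \<psi>_def)
    have "?o = \<mm> +>\<^bsub>?S\<^esub> \<epsilon> v0" using e\<epsilon>[OF v0(1)] v0(2) by simp
    moreover have "\<one> \<in> ?o"
      using abelian_subgroup.a_rcos_self[OF S.abelian_subgroup_sub[OF mS], of \<one>] R.one_closed by simp
    ultimately have "\<one> \<in> \<mm> +>\<^bsub>?S\<^esub> \<epsilon> v0" by simp
    then obtain \<mu> where \<mu>: "\<mu> \<in> \<mm>" "\<one> = \<mu> \<oplus> \<epsilon> v0"
      by (auto simp: a_r_coset_def')
    \<comment> \<open>As v0 lifts 1, the value \<epsilon>(v0) is congruent to 1 modulo \<mm>; hence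
      \<psi>(f) = \<epsilon>(v0) q hits q up to an element of \<mm>q, which lies in C.\<close>
    have "q = (\<mu> \<oplus> \<epsilon> v0) \<otimes> q" unfolding \<mu>(2)[symmetric] using qQ by simp
    also have "\<dots> = \<psi> f \<oplus> \<mu> \<otimes> q"
      using mR[OF \<mu>(1)] \<epsilon>R[OF v0(1)] qQ by (simp add: \<psi>f l_distr a_comm)
    finally have "q = \<psi> f \<oplus>\<^bsub>V\<^esub> \<mu> \<otimes> q" by simp
    moreover have "\<mu> \<otimes> q \<in> C" using q \<mu>(1) by simp
    ultimately show "q \<in> \<psi> ` Z <+>\<^bsub>V\<^esub> C" unfolding V.mem_set_add using fZ by blast
  qed
  have D: "submodule ?D R V"
  proof (rule fsubI)
    fix r x assume r: "r \<in> carrier R" and x: "x \<in> ?D"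
    have "\<mu> \<otimes> (r \<otimes> x) \<in> C" if "\<mu> \<in> \<mm>" for \<mu>
    proof -
      have "\<mu> \<otimes> (r \<otimes> x) = r \<otimes> (\<mu> \<otimes> x)" using mR[OF that] r x by (simp add: m_lcomm)
      then show ?thesis using x that fsubD(4)[OF C r] by simp
    qed
    then show "r \<otimes> x \<in> ?D" using r x by simp
  qed (use fsubD(2,3)[OF C] mR in \<open>auto simp: r_distr\<close>)
  have CD: "C \<subseteq> ?D" using fsubD(1,4)[OF C] mR by auto
  have B: "B = {f \<in> carrier ?HZ. \<psi> f \<in> C}" using BZ ZB by auto
  have "bass_number R \<mm> M 1 = module_length R (quot_module ?HZ B)"
    unfolding One_nat_def bass_number_def ext_module_def nd Let_def prod.case hom_module_eq Z_def B_def ..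
  also have "\<dots> = mlen R ?HZ B (carrier ?HZ)"
    unfolding B by (rule HZ.module_length_quot[OF \<psi>.sub_vimage[OF C]])
  also have "\<dots> = mlen R V C ?D"
    unfolding B by (rule \<psi>.mlen_vimage[OF C D CD]) (use \<psi>D surj in auto)
  finally show ?thesis .
qed

section \<open>Units of a Noetherian local ring, and products with principal ideals\<close>

lemma (in noetherian_ring) local_ring_units:
  assumes loc: "local_ring R \<mm>" and r: "r \<in> carrier R" "r \<notin> \<mm>"
  shows "r \<in> Units R"
proof (rule ccontr)
  assume nu: "r \<notin> Units R"
  interpret cring R using loc by (simp add: local_ring_def)
  let ?A = "{I. ideal I R \<and> r \<in> I \<and> \<one> \<notin> I}"
  have "\<one> \<notin> PIdl r"
  proof
    assume "\<one> \<in> PIdl r"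
    then obtain x where "x \<in> carrier R" "\<one> = x \<otimes> r" by (auto simp: cgenideal_def)
    then have "r \<in> Units R" using r m_comm[of x r] by (auto simp: Units_def)
    then show False using nu by simp
  qed
  then have P: "PIdl r \<in> ?A" using cgenideal_ideal[OF r(1)] cgenideal_self[OF r(1)] by simp
  \<comment> \<open>In a Noetherian ring a nonempty chain of ideals contains its union, which gives
    the upper bounds for Zorn's lemma.\<close>
  have "\<exists>M\<in>?A. \<forall>X\<in>?A. M \<subseteq> X \<longrightarrow> X = M"
  proof (rule subset_Zorn)
    fix K assume K: "subset.chain ?A K"
    show "\<exists>U\<in>?A. \<forall>X\<in>K. X \<subseteq> U"
    proof (cases "K = {}")
      case True
      then show ?thesis using P by blast
    next
      case False
      have "subset.chain {I. ideal I R} K" using K by (auto simp: subset_chain_def)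
      then have "\<Union>K \<in> K" by (rule ideal_chain_is_trivial[OF False])
      then show ?thesis using K by (intro bexI[of _ "\<Union>K"]) (auto simp: subset_chain_def)
    qed
  qed
  then obtain M where M: "ideal M R" "r \<in> M" "\<one> \<notin> M" and max: "\<And>X. X \<in> ?A \<Longrightarrow> M \<subseteq> X \<Longrightarrow> X = M"
    by blast
  have "maximalideal M R"
  proof (rule maximalidealI[OF M(1)])
    show "carrier R \<noteq> M" using M(3) by auto
    fix J assume J: "ideal J R" "M \<subseteq> J" "J \<subseteq> carrier R"
    show "J = M \<or> J = carrier R"
      using max[of J] J M(2) ideal.one_imp_carrier[OF J(1)] by auto
  qed
  then show False using loc M(2) r(2) by (auto simp: local_ring_def)
qed

lemma (in cring) PIdl_prod:
  assumes "a \<in> carrier R" "ideal I R"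
  shows "(PIdl a) \<cdot> I = (\<lambda>x. a \<otimes> x) ` I"
proof
  interpret I: ideal I R by fact
  have "x \<in> (\<lambda>x. a \<otimes> x) ` I" if "x \<in> (PIdl a) \<cdot> I" for x
    using that
  proof (induction rule: ideal_prod.induct)
    case (prod i j)
    then obtain s where "s \<in> carrier R" "i = s \<otimes> a" by (auto simp: cgenideal_def)
    then have "i \<otimes> j = a \<otimes> (s \<otimes> j)" "s \<otimes> j \<in> I"
      using assms(1) I.a_Hcarr[OF prod(2)] I.I_l_closed[OF prod(2)] by (simp add: m_ac, blast)
    then show ?case by blast
  next
    case (sum x y)
    then obtain p q where "p \<in> I" "q \<in> I" "x = a \<otimes> p" "y = a \<otimes> q" by blast
    then have "x \<oplus> y = a \<otimes> (p \<oplus> q)" "p \<oplus> q \<in> I"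
      using assms(1) by (auto simp: r_distr I.a_Hcarr)
    then show ?case by blast
  qed
  then show "(PIdl a) \<cdot> I \<subseteq> (\<lambda>x. a \<otimes> x) ` I" by blast
  show "(\<lambda>x. a \<otimes> x) ` I \<subseteq> (PIdl a) \<cdot> I"
    using cgenideal_self[OF assms(1)] by (auto intro: ideal_prod.prod)
qed

section \<open>Fractional ideals\<close>

context overring
begin

abbreviation len where "len X Y \<equiv> mlen R V X Y"

abbreviation A where "A \<equiv> carrier R"

definition sc where "sc q X = (\<lambda>x. q \<otimes> x) ` X"

lemma neg_A: "r \<in> A \<Longrightarrow> \<ominus> r \<in> A"
  using Q.minus_equality[of "\<ominus>\<^bsub>R\<^esub> r" r] R.l_neg[of r] R.a_inv_closed[of r] by simp

lemma A_fsub: "submodule A R V"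
proof (rule fsubI)
  show "\<zero> \<in> A" using R.zero_closed by simp
  show "x \<oplus> y \<in> A" if "x \<in> A" "y \<in> A" for x y using R.add.m_closed[OF that] by simp
  show "x \<otimes> y \<in> A" if "x \<in> A" "y \<in> A" for x y using R.m_closed[OF that] by simp
qed auto

lemma ideal_fsub: "ideal I R \<Longrightarrow> submodule I R V"
proof (rule fsubI)
  assume "ideal I R"
  then interpret I: ideal I R .
  show "I \<subseteq> carrier Q" using I.a_Hcarr by auto
  show "\<zero> \<in> I" using I.zero_closed by simp
  show "x \<oplus> y \<in> I" if "x \<in> I" "y \<in> I" for x y using I.a_closed[OF that] by simp
  show "r \<otimes> x \<in> I" if "r \<in> A" "x \<in> I" for r x using I.I_l_closed[OF that(2,1)] by simp
qed

lemma fsub_ideal: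
  assumes X: "submodule X R V" and "X \<subseteq> A"
  shows "ideal X R"
  unfolding R.submodule_self_iff[symmetric]
  by (rule module.submoduleI'[OF R.module_self]) (use assms fsubD[OF X] in auto)

lemma mult_linear_map:
  assumes "q \<in> carrier Q" and "submodule X R V"
  shows "linear_map R V V X (\<lambda>x. q \<otimes> x)"
  by (intro linear_map.intro linear_map_axioms.intro module_V assms(2))
    (use assms(1) fsubD(1)[OF assms(2)] in \<open>auto simp: r_distr m_lcomm\<close>)

lemma sc_fsub:
  assumes "q \<in> carrier Q" "submodule X R V"
  shows "submodule (sc q X) R V"
  unfolding sc_def by (rule linear_map.sub_image[OF mult_linear_map[OF assms] assms(2)]) simp

lemma sc_sc:
  assumes "p \<in> carrier Q" "q \<in> carrier Q" "X \<subseteq> carrier Q"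
  shows "sc p (sc q X) = sc (p \<otimes> q) X"
  unfolding sc_def image_image by (rule image_cong) (use assms in \<open>auto simp: m_assoc\<close>)

lemma sc_one: "X \<subseteq> carrier Q \<Longrightarrow> sc \<one> X = X"
proof -
  assume "X \<subseteq> carrier Q"
  then have "(\<lambda>x. \<one> \<otimes> x) ` X = (\<lambda>x. x) ` X" by (intro image_cong) auto
  then show ?thesis by (simp add: sc_def)
qed

lemma sc_mono: "X \<subseteq> Y \<Longrightarrow> sc q X \<subseteq> sc q Y"
  by (auto simp: sc_def)

lemma sc_sub: "r \<in> A \<Longrightarrow> submodule X R V \<Longrightarrow> sc r X \<subseteq> X"
  using fsubD(4) by (auto simp: sc_def)

lemma unit_cancel:
  assumes "q \<in> Units Q" "x \<in> carrier Q"
  shows "inv q \<otimes> (q \<otimes> x) = x" "q \<otimes> (inv q \<otimes> x) = x"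
proof -
  have "q \<in> carrier Q" "inv q \<in> carrier Q" "inv q \<otimes> q = \<one>" "q \<otimes> inv q = \<one>"
    using assms(1) by (rule Units_closed, auto)
  then show "inv q \<otimes> (q \<otimes> x) = x" "q \<otimes> (inv q \<otimes> x) = x"
    using assms(2) m_assoc[of "inv q" q x] m_assoc[of q "inv q" x] by simp_all
qed

lemma mem_sc_unit:
  assumes "q \<in> Units Q" "X \<subseteq> carrier Q" "x \<in> carrier Q"
  shows "q \<otimes> x \<in> sc q X \<longleftrightarrow> x \<in> X"
proof
  assume "q \<otimes> x \<in> sc q X"
  then obtain y where y: "y \<in> X" "q \<otimes> x = q \<otimes> y" by (auto simp: sc_def)
  have "x = inv q \<otimes> (q \<otimes> y)" using unit_cancel(1)[OF assms(1,3)] y(2) by simp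
  then show "x \<in> X" using unit_cancel(1)[OF assms(1), of y] y(1) assms(2) by auto
qed (simp add: sc_def)

lemma len_sc:
  assumes q: "q \<in> Units Q" and X: "submodule X R V" and Y: "submodule Y R V" and "X \<subseteq> Y"
  shows "len (sc q X) (sc q Y) = len X Y"
proof -
  have qQ: "q \<in> carrier Q" using q by auto
  interpret l: linear_map R V V Y "\<lambda>x. q \<otimes> x" by (rule mult_linear_map[OF qQ Y])
  have "{z \<in> Y. q \<otimes> z \<in> sc q X} = X"
    using mem_sc_unit[OF q V.submoduleE(1)[OF X, simplified]] fsubD(1)[OF Y] \<open>X \<subseteq> Y\<close> by auto
  moreover have "len {z \<in> Y. q \<otimes> z \<in> sc q X} Y = len (sc q X) (sc q Y)"
    by (rule l.mlen_vimage[OF sc_fsub[OF qQ X] sc_fsub[OF qQ Y] sc_mono[OF \<open>X \<subseteq> Y\<close>]])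
      (use V.sum_upper(1)[OF sc_fsub[OF qQ Y] sc_fsub[OF qQ X]] in \<open>auto simp: sc_def\<close>)
  ultimately show ?thesis by simp
qed

lemma colon_fsub:
  assumes X: "submodule X R V" and "Y \<subseteq> carrier Q"
  shows "submodule (frac_colon Q X Y) R V"
proof (rule fsubI)
  fix r q assume r: "r \<in> A" and q: "q \<in> frac_colon Q X Y"
  have "(r \<otimes> q) \<otimes> y \<in> X" if y: "y \<in> Y" for y
    using r q y fsubD(4)[OF X r, of "q \<otimes> y"] assms(2) by (auto simp: frac_colon_def m_assoc subset_iff)
  then show "r \<otimes> q \<in> frac_colon Q X Y" using r q by (auto simp: frac_colon_def)
qed (use assms(2) fsubD(2,3)[OF X] in \<open>auto simp: frac_colon_def l_distr subset_iff\<close>)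

lemma colon_antimono: "Y \<subseteq> Y' \<Longrightarrow> frac_colon Q X Y' \<subseteq> frac_colon Q X Y"
  by (auto simp: frac_colon_def)

end

section \<open>The length of R/aR and its invariance\<close>

locale local_cm_ring = overring Q R for Q :: "('a, 'b) ring_scheme" (structure) and R :: "('a, 'b) ring_scheme" +
  fixes \<mm> :: "'a set" and a :: 'a
  assumes noeth: "noetherian_ring R"
    and loc: "local_ring R \<mm>"
    and tot: "total_ring_of_fractions R Q"
    and a_mem: "a \<in> \<mm>" and a_nzd: "a \<in> nonzerodivisors R"
    and red: "reduction_of R (PIdl\<^bsub>R\<^esub> a) \<mm>"
begin

lemma \<mm>_ideal: "ideal \<mm> R"
  using loc maximalideal.axioms(1) by (auto simp: local_ring_def)

sublocale \<mm>: ideal \<mm> R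
  by (rule \<mm>_ideal)

lemma \<mm>_mem [simp, intro]: "\<mu> \<in> \<mm> \<Longrightarrow> \<mu> \<in> A"
  by (rule \<mm>.a_Hcarr)

lemma \<mm>_one: "\<one> \<notin> \<mm>"
  using loc \<mm>.one_imp_carrier maximalideal.I_notcarr unfolding local_ring_def by auto

lemma units: "r \<in> A \<Longrightarrow> r \<notin> \<mm> \<Longrightarrow> r \<in> Units R"
  using noetherian_ring.local_ring_units[OF noeth loc] .

lemma nzd_units: "s \<in> nonzerodivisors R \<Longrightarrow> s \<in> Units Q"
  using tot unfolding total_ring_of_fractions_def by auto

lemma a_unit [simp, intro]: "a \<in> Units Q"
  by (rule nzd_units[OF a_nzd])

lemma a_A [simp, intro]: "a \<in> A"
  using a_mem by simp

lemma a_Q [simp, intro]: "a \<in> carrier Q" by auto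

lemma pow_unit [simp, intro]: "a [^] (n::nat) \<in> Units Q"
  by (rule Units_pow_closed) simp

lemma pow_A [simp, intro]: "a [^] (n::nat) \<in> A"
  by (induction n) (use R.one_closed R.m_closed in \<open>auto\<close>)

lemma pow_Q [simp, intro]: "a [^] (n::nat) \<in> carrier Q" by simp

definition P where "P n = \<mm> [^]\<^bsub>ideals_set R\<^esub> (n::nat)"

lemma P_simps [simp]: "P 0 = A" "P (Suc n) = P n \<cdot>\<^bsub>R\<^esub> \<mm>"
  by (simp_all add: P_def nat_pow_def ideals_set_def)

lemma P_ideal: "ideal (P n) R"
proof (induction n)
  case 0
  then show ?case using R.oneideal by simp
next
  case (Suc n)
  then show ?case using R.ideal_prod_is_ideal[OF Suc \<mm>_ideal] by simp
qed

lemma P_fsub: "submodule (P n) R V"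
  by (rule ideal_fsub[OF P_ideal])

lemma P_sub: "P (Suc n) \<subseteq> P n" "P n \<subseteq> A"
  using R.ideal_prod_inter[OF P_ideal \<mm>_ideal] ideal.Icarr[OF P_ideal] by auto

text \<open>Each layer of the \<mm>-adic filtration is finitely generated and killed by \<mm>, so
  its length is at most the number of generators.\<close>

lemma len_P_finite: "len (P n) A < \<infinity>"
proof (induction n)
  case 0
  then show ?case using V.mlen_self[OF A_fsub] by simp
next
  case (Suc n)
  obtain G where G: "G \<subseteq> A" "finite G" "P n = Idl\<^bsub>R\<^esub> G"
    using noetherian_ring.finetely_gen[OF noeth P_ideal] by blast
  have GP: "G \<subseteq> P n" using R.genideal_self[OF G(1)] G(3) by simp
  have sp: "spans_over R V (P (Suc n)) G (P n)"
    unfolding spans_over_def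
  proof (intro conjI allI impI GP)
    fix N assume N: "submodule N R V" "G \<subseteq> N"
    have "ideal (N \<inter> A) R" using V.sub_Int[OF N(1) A_fsub] by (rule fsub_ideal) simp
    then have "Idl\<^bsub>R\<^esub> G \<subseteq> N \<inter> A" by (rule R.genideal_minimal) (use N G in auto)
    then show "P n \<subseteq> N" using G(3) by simp
  qed
  have "len (P (Suc n)) (P n) \<le> enat (card G)"
  proof (rule V.mlen_le_card[OF units G(2) P_fsub P_fsub P_sub(1) sp])
    fix \<mu> y assume "\<mu> \<in> \<mm>" "y \<in> G"
    then have "y \<otimes>\<^bsub>R\<^esub> \<mu> \<in> P (Suc n)" unfolding P_simps by (intro ideal_prod.prod) (use GP in auto)
    then show "\<mu> \<odot>\<^bsub>V\<^esub> y \<in> P (Suc n)" using \<open>\<mu> \<in> \<mm>\<close> \<open>y \<in> G\<close> G(1) by (auto simp: m_comm subset_iff simp del: P_simps)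
  qed
  then have "len (P (Suc n)) (P n) < \<infinity>" by (metis enat_ord_code(4) leD leI order_le_less_trans)
  then show ?case
    using Suc unfolding V.mlen_add[OF P_fsub P_fsub A_fsub P_sub]
    by (cases "len (P (Suc n)) (P n)"; cases "len (P n) A") (simp_all del: P_simps)
qed

text \<open>The reduction provides the equation for one exponent, and multiplying it by \<mm>
  carries it to all larger ones.\<close>

lemma P_reduction: "\<exists>n0. \<forall>n\<ge>n0. P (Suc n) = sc a (P n)"
proof -
  obtain n0 where n0: "P (Suc n0) = (PIdl\<^bsub>R\<^esub> a) \<cdot>\<^bsub>R\<^esub> P n0"
    using red unfolding reduction_of_def P_def by auto
  have pa: "ideal (PIdl\<^bsub>R\<^esub> a) R" by (rule R.cgenideal_ideal) simp
  have "P (Suc n) = (PIdl\<^bsub>R\<^esub> a) \<cdot>\<^bsub>R\<^esub> P n" if "n \<ge> n0" for n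
    using that
  proof (induction rule: nat_induct_at_least)
    case base
    show ?case by (rule n0)
  next
    case (Suc n)
    have "P (Suc (Suc n)) = P (Suc n) \<cdot>\<^bsub>R\<^esub> \<mm>" by simp
    also have "\<dots> = ((PIdl\<^bsub>R\<^esub> a) \<cdot>\<^bsub>R\<^esub> P n) \<cdot>\<^bsub>R\<^esub> \<mm>" using Suc.IH by (simp only:)
    also have "\<dots> = (PIdl\<^bsub>R\<^esub> a) \<cdot>\<^bsub>R\<^esub> P (Suc n)" using R.ideal_prod_assoc[OF pa P_ideal \<mm>_ideal] by simp
    finally show ?case .
  qed
  then have "P (Suc n) = sc a (P n)" if "n \<ge> n0" for n
    using that R.PIdl_prod[OF _ P_ideal, of a] by (simp add: sc_def del: P_simps)
  then show ?thesis by blast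
qed

definition e where "e = len (sc a A) A"

text \<open>The ideal aR contains a power of \<mm>, whose colength is finite.\<close>

lemma e_finite: "e < \<infinity>"
proof -
  obtain n0 where n0: "P (Suc n0) = sc a (P n0)" using P_reduction by blast
  have s: "P (Suc n0) \<subseteq> sc a A" unfolding n0 by (rule sc_mono[OF P_sub(2)])
  have "len (P (Suc n0)) A = len (P (Suc n0)) (sc a A) + e"
    unfolding e_def by (rule V.mlen_add[OF P_fsub sc_fsub[OF a_Q A_fsub] A_fsub s sc_sub[OF a_A A_fsub]])
  then show ?thesis using len_P_finite[of "Suc n0"] by (cases e) auto
qed

lemma sc_pow_fsub: "submodule X R V \<Longrightarrow> submodule (sc (a [^] (n::nat)) X) R V"
  by (rule sc_fsub) simp

lemma sc_pow_Suc:
  assumes "submodule X R V"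
  shows "sc (a [^] Suc n) X = sc (a [^] n) (sc a X)"
  using sc_sc[of "a [^] n" a X] V.submoduleE(1)[OF assms] by simp

lemma sc_pow_add:
  assumes "submodule X R V"
  shows "sc (a [^] (m + n :: nat)) X = sc (a [^] m) (sc (a [^] n) X)"
  using sc_sc[of "a [^] m" "a [^] n" X] V.submoduleE(1)[OF assms] by (simp add: nat_pow_mult)

text \<open>Multiplication by a^i identifies X/aX with every layer of the filtration of X by the
  submodules a^i X.\<close>

lemma len_sc_pow:
  assumes X: "submodule X R V"
  shows "len (sc (a [^] n) X) X = of_nat n * len (sc a X) X"
proof (induction n)
  case 0
  then show ?case using V.mlen_self[OF X] sc_one V.submoduleE(1)[OF X] by simp
next
  case (Suc n)
  note aX = sc_fsub[OF a_Q X] and s = sc_sub[OF a_A X]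
  have "len (sc (a [^] Suc n) X) X = len (sc (a [^] Suc n) X) (sc (a [^] n) X) + len (sc (a [^] n) X) X"
    using sc_mono[OF s] sc_sub[OF pow_A X]
    by (intro V.mlen_add sc_pow_fsub X) (simp_all only: sc_pow_Suc[OF X])
  also have "len (sc (a [^] Suc n) X) (sc (a [^] n) X) = len (sc a X) X"
    unfolding sc_pow_Suc[OF X] by (rule len_sc[OF pow_unit aX X s])
  finally show ?case using Suc by (simp add: distrib_right)
qed

text \<open>The length of Y/aX is computed through X and through aY. Since multiplication by a
  identifies Y/X with aY/aX, these terms cancel; they are finite because Y/X is a quotient of Y/a^N
  Y.\<close>

lemma len_sc_a_eq:
  assumes X: "submodule X R V" and Y: "submodule Y R V" and XY: "X \<subseteq> Y"
    and N: "sc (a [^] (N::nat)) Y \<subseteq> X" and fin: "len (sc a Y) Y < \<infinity>"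
  shows "len (sc a X) X = len (sc a Y) Y"
proof -
  note aX = sc_fsub[OF a_Q X] and aY = sc_fsub[OF a_Q Y]
  have sX: "sc a X \<subseteq> X" and sY: "sc a Y \<subseteq> Y" by (rule sc_sub[OF a_A], fact)+
  have "of_nat N * len (sc a Y) Y < \<infinity>"
    using fin by (cases "len (sc a Y) Y") (auto simp: of_nat_eq_enat)
  then have "len (sc (a [^] N) Y) Y < \<infinity>" unfolding len_sc_pow[OF Y] .
  moreover have "len (sc (a [^] N) Y) Y = len (sc (a [^] N) Y) X + len X Y"
    by (rule V.mlen_add[OF sc_pow_fsub[OF Y] X Y N XY])
  ultimately have f: "len X Y < \<infinity>" by (cases "len X Y") auto
  have "len (sc a X) Y = len (sc a X) X + len X Y"
    by (rule V.mlen_add[OF aX X Y sX XY])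
  moreover have "len (sc a X) Y = len (sc a X) (sc a Y) + len (sc a Y) Y"
    by (rule V.mlen_add[OF aX aY Y sc_mono[OF XY] sY])
  moreover have "len (sc a X) (sc a Y) = len X Y" by (rule len_sc[OF a_unit X Y XY])
  ultimately have "len (sc a X) X + len X Y = len X Y + len (sc a Y) Y" by metis
  moreover obtain k where "len X Y = enat k" using f by auto
  ultimately show ?thesis
    by (cases "len (sc a X) X"; cases "len (sc a Y) Y") auto
qed

text \<open>Every non-zero-divisor \<open>s\<close> divides a power of \<open>a\<close>: the saturation \<open>J\<close> of \<open>(s)\<close> with respect to \<open>a\<close>
  has the same multiplicity as \<open>R\<close>, and \<open>J/aJ\<close> embeds into \<open>R/aR\<close>, so that \<open>J + aR = R\<close>.\<close>

lemma nzd_divides_power: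
  assumes s: "s \<in> nonzerodivisors R"
  shows "\<exists>n::nat. \<exists>t\<in>A. a [^] n = s \<otimes> t"
proof -
  have sA: "s \<in> A" using s by (simp add: nonzerodivisors_def)
  have sQ: "s \<in> carrier Q" using sA by simp
  have su: "s \<in> Units Q" by (rule nzd_units[OF s])
  let ?sA = "sc s A"
  have sAs: "submodule ?sA R V" by (rule sc_fsub[OF sQ A_fsub])
  let ?J = "{x \<in> A. \<exists>n::nat. a [^] n \<otimes> x \<in> ?sA}"
  have J: "submodule ?J R V"
  proof (rule fsubI)
    show "?J \<subseteq> carrier Q" by auto
    show "\<zero> \<in> ?J" using fsubD(2)[OF sAs] R.zero_closed by auto
    fix x y assume "x \<in> ?J" "y \<in> ?J"
    then obtain m n :: nat where xy: "x \<in> A" "y \<in> A" "a [^] m \<otimes> x \<in> ?sA" "a [^] n \<otimes> y \<in> ?sA" by auto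
    have "a [^] (m + n) \<otimes> (x \<oplus> y) = a [^] n \<otimes> (a [^] m \<otimes> x) \<oplus> a [^] m \<otimes> (a [^] n \<otimes> y)"
      using xy(1,2) by (simp add: nat_pow_mult[symmetric] r_distr m_ac)
    also have "\<dots> \<in> ?sA" using xy fsubD(3,4)[OF sAs] by simp
    finally show "x \<oplus> y \<in> ?J" using fsubD(3)[OF A_fsub xy(1,2)] by blast
  next
    fix r x assume r: "r \<in> A" and "x \<in> ?J"
    then obtain n :: nat where x: "x \<in> A" "a [^] n \<otimes> x \<in> ?sA" by auto
    have "a [^] n \<otimes> (r \<otimes> x) = r \<otimes> (a [^] n \<otimes> x)" using r x by (simp add: m_lcomm)
    then have "a [^] n \<otimes> (r \<otimes> x) \<in> ?sA" using fsubD(4)[OF sAs r x(2)] by simp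
    then show "r \<otimes> x \<in> ?J" using fsubD(4)[OF A_fsub r x(1)] by blast
  qed
  have JA: "?J \<subseteq> A" by auto
  obtain G where G: "G \<subseteq> A" "finite G" "?J = Idl\<^bsub>R\<^esub> G"
    using noetherian_ring.finetely_gen[OF noeth fsub_ideal[OF J JA]] by blast
  have GJ: "G \<subseteq> ?J" using R.genideal_self[OF G(1)] G(3) by simp
  then have "\<forall>g\<in>G. \<exists>n::nat. a [^] n \<otimes> g \<in> ?sA" by blast
  then obtain f :: "'a \<Rightarrow> nat" where f: "\<forall>g\<in>G. a [^] f g \<otimes> g \<in> ?sA"
    by (rule bchoice[THEN exE])
  \<comment> \<open>One exponent for all of J: each summand is at most the sum, and there are
    finitely many generators.\<close>
  define N where "N = (\<Sum>g\<in>G. f g)"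
  have "a [^] N \<otimes> g \<in> ?sA" if g: "g \<in> G" for g
  proof -
    have le: "f g \<le> N" unfolding N_def by (rule member_le_sum) (use g G in auto)
    have gQ: "g \<in> carrier Q" using g G by auto
    have "a [^] N \<otimes> g = a [^] (N - f g) \<otimes> (a [^] f g \<otimes> g)"
      using le gQ by (simp add: m_assoc[symmetric] nat_pow_mult)
    then show ?thesis using fsubD(4)[OF sAs pow_A bspec[OF f g]] by simp
  qed
  moreover have "submodule {x \<in> A. a [^] N \<otimes> x \<in> ?sA} R V"
    using linear_map.sub_vimage[OF mult_linear_map[OF pow_Q A_fsub] sAs, of N] by simp
  then have "ideal {x \<in> A. a [^] N \<otimes> x \<in> ?sA} R" by (rule fsub_ideal) auto
  ultimately have "Idl\<^bsub>R\<^esub> G \<subseteq> {x \<in> A. a [^] N \<otimes> x \<in> ?sA}"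
    using G(1) by (intro R.genideal_minimal) auto
  then have NJ: "sc (a [^] N) ?J \<subseteq> ?sA" unfolding G(3)[symmetric] by (auto simp: sc_def)
  have sJ: "?sA \<subseteq> ?J"
  proof
    fix x assume x: "x \<in> ?sA"
    then have "x \<in> A" using sc_sub[OF sA A_fsub] by auto
    moreover have "a [^] (0::nat) \<otimes> x \<in> ?sA" using x \<open>x \<in> A\<close> by simp
    ultimately show "x \<in> ?J" by blast
  qed
  note aJ = sc_fsub[OF a_Q J] and aA = sc_fsub[OF a_Q A_fsub]
  have esA: "len (sc a ?sA) ?sA = e"
  proof -
    have "sc a ?sA = sc s (sc a A)" using sc_sc[of a s A] sc_sc[of s a A] sQ by (simp add: m_comm carrier_sub)
    then show ?thesis unfolding e_def using len_sc[OF su aA A_fsub sc_sub[OF a_A A_fsub]] by simp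
  qed
  \<comment> \<open>The comparison needs a larger module already known to have finite length modulo
    a. Hence a^N J is placed inside sA instead of sA inside J.\<close>
  have eJ: "len (sc a ?J) ?J = e"
  proof -
    let ?X = "sc (a [^] N) ?J"
    have "len (sc a ?X) ?X = len (sc a ?sA) ?sA"
      by (rule len_sc_a_eq[OF sc_pow_fsub[OF J] sAs NJ sc_mono[OF sJ]]) (unfold esA, rule e_finite)
    moreover have "sc a ?X = sc (a [^] N) (sc a ?J)"
      using sc_sc[of a "a [^] N" ?J] sc_sc[of "a [^] N" a ?J] V.submoduleE(1)[OF J] by (simp add: m_comm)
    ultimately show ?thesis using len_sc[OF pow_unit aJ J sc_sub[OF a_A J]] esA by simp
  qed
  let ?D = "?J <+>\<^bsub>V\<^esub> sc a A"
  have D: "submodule ?D R V" by (rule V.sub_sum[OF J aA])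
  note up = V.sum_upper[OF J aA]
  have DA: "?D \<subseteq> A" by (rule V.sum_least[OF A_fsub JA sc_sub[OF a_A A_fsub]])
  \<comment> \<open>J is saturated, so ay in J forces y in J: the intersection of J with aA is aJ.
    The factor \<one> presents the inclusion as a multiplication map.\<close>
  have "{z \<in> ?J. \<one> \<otimes> z \<in> sc a A} = sc a ?J"
  proof
    show "sc a ?J \<subseteq> {z \<in> ?J. \<one> \<otimes> z \<in> sc a A}"
    proof
      fix x assume x: "x \<in> sc a ?J"
      have "x \<in> ?J" using x sc_sub[OF a_A J] by (rule subsetD[rotated])
      moreover have "x \<in> sc a A" using x sc_mono[OF JA, of a] by (rule subsetD[rotated])
      moreover have "\<one> \<otimes> x = x" using \<open>x \<in> ?J\<close> by simp
      ultimately show "x \<in> {z \<in> ?J. \<one> \<otimes> z \<in> sc a A}" by simp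
    qed
    show "{z \<in> ?J. \<one> \<otimes> z \<in> sc a A} \<subseteq> sc a ?J"
    proof
      fix z assume z: "z \<in> {z \<in> ?J. \<one> \<otimes> z \<in> sc a A}"
      then have "z \<in> A" "\<one> \<otimes> z \<in> sc a A" by auto
      then have "z \<in> sc a A" by simp
      then obtain y where y: "y \<in> A" "z = a \<otimes> y" unfolding sc_def by blast
      obtain n where "a [^] (n::nat) \<otimes> z \<in> ?sA" using z by blast
      with y have "a [^] Suc n \<otimes> y \<in> ?sA" by (simp add: m_assoc)
      then have "y \<in> ?J" using y(1) by blast
      then show "z \<in> sc a ?J" using y(2) unfolding sc_def by (rule image_eqI[rotated])
    qed
  qed
  moreover have "len {z \<in> ?J. \<one> \<otimes> z \<in> sc a A} ?J = len (sc a A) ?D"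
  proof (rule linear_map.mlen_vimage[OF mult_linear_map[OF one_closed J] aA D up(2)])
    have "(\<lambda>x. \<one> \<otimes> x) ` ?J = ?J" using sc_one[of ?J] V.submoduleE(1)[OF J] by (simp add: sc_def)
    then show "(\<lambda>x. \<one> \<otimes> x) ` ?J \<subseteq> ?D" "?D \<subseteq> (\<lambda>x. \<one> \<otimes> x) ` ?J <+>\<^bsub>V\<^esub> sc a A" using up(1) by auto
  qed
  ultimately have "len (sc a A) ?D = e" using eJ by simp
  moreover have "e = len (sc a A) ?D + len ?D A"
    unfolding e_def by (rule V.mlen_add[OF aA D A_fsub up(2) DA])
  \<comment> \<open>The image of J in A/aA already has the full, finite length e, so nothing remains
    above J + aA.\<close>
  ultimately have sum: "e = e + len ?D A" by (simp only:)
  obtain k where "e = enat k" using e_finite by (cases e) auto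
  then have "len ?D A = 0" using sum by (cases "len ?D A") (simp_all add: zero_enat_def)
  then have "?D = A" by (rule V.mlen_eq_0D[OF D A_fsub DA])
  moreover have "\<one> \<in> A" using R.one_closed by simp
  ultimately have "\<one> \<in> ?D" by (simp only:)
  then obtain j d where jd: "j \<in> ?J" "d \<in> sc a A" "\<one> = j \<oplus>\<^bsub>V\<^esub> d"
    unfolding V.mem_set_add by blast
  then obtain y where jy: "y \<in> A" "\<one> = j \<oplus> a \<otimes> y"
    unfolding sc_def by auto
  have jA: "j \<in> A" using jd(1) by simp
  \<comment> \<open>From 1 = j + ay with a in \<mm>, the element j of J is a unit. Thus 1 lies in J,
    which means that a power of a is a multiple of s.\<close>
  have "j \<notin> \<mm>"
  proof
    assume "j \<in> \<mm>"
    then have "\<one> \<in> \<mm>" using \<mm>.a_closed[of j "a \<otimes> y"] \<mm>.I_r_closed[OF a_mem jy(1)] jy(2) by simp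
    then show False using \<mm>_one by simp
  qed
  then have "j \<in> Units R" using units jA by simp
  then obtain i where i: "i \<in> A" "i \<otimes> j = \<one>" unfolding Units_def by auto
  have "\<one> \<in> ?J" using fsubD(4)[OF J i(1) jd(1)] i(2) by (simp only:)
  then obtain n where "a [^] (n::nat) \<otimes> \<one> \<in> ?sA" by blast
  then show ?thesis by (auto simp: sc_def)
qed

section \<open>Fractional ideals, measured by powers of a\<close>

lemma frac_denominator:
  assumes "q \<in> carrier Q"
  shows "\<exists>n::nat. a [^] n \<otimes> q \<in> A"
proof -
  obtain r s where rs: "r \<in> A" "s \<in> nonzerodivisors R" "q = r \<otimes> inv s"
    using tot assms unfolding total_ring_of_fractions_def by blast
  obtain n t where nt: "t \<in> A" "a [^] (n::nat) = s \<otimes> t" using nzd_divides_power[OF rs(2)] by blast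
  have s: "s \<in> Units Q" "s \<in> carrier Q" "inv s \<in> carrier Q" using nzd_units[OF rs(2)] by auto
  have "a [^] n \<otimes> q = (s \<otimes> inv s) \<otimes> (t \<otimes> r)"
    using nt rs(1,3) s(2,3) by (simp add: m_ac)
  also have "\<dots> = t \<otimes> r" using s(1) nt(1) rs(1) by simp
  also have "\<dots> \<in> A" by (rule fsubD(4)[OF A_fsub nt(1) rs(1)])
  finally show ?thesis by blast
qed

text \<open>Equivalent to being a finitely generated submodule of Q that contains a non-zero-divisor
  of R: denominators can be cleared by powers of a, every non-zero-divisor divides a power of a, and
  R is Noetherian.\<close>

definition frac where
  "frac X \<longleftrightarrow> submodule X R V \<and> (\<exists>i::nat. a [^] i \<in> X) \<and> (\<exists>j::nat. sc (a [^] j) X \<subseteq> A)"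

lemma fracD: "frac X \<Longrightarrow> submodule X R V"
  by (simp add: frac_def)

lemma frac_A: "frac A"
proof -
  have "sc (a [^] (0::nat)) A \<subseteq> A" using sc_sub[OF pow_A A_fsub] .
  moreover have "a [^] (0::nat) \<in> A" by (rule pow_A)
  ultimately show ?thesis using A_fsub unfolding frac_def by blast
qed

lemma fracI:
  assumes "submodule X R V" "a [^] (i::nat) \<in> X" "X \<subseteq> Y" "frac Y"
  shows "frac X"
proof -
  obtain j where "sc (a [^] (j::nat)) Y \<subseteq> A" using assms(4) unfolding frac_def by auto
  then have "sc (a [^] j) X \<subseteq> A" using sc_mono[OF assms(3)] by (rule subset_trans[rotated])
  then show ?thesis using assms(1,2) unfolding frac_def by blast
qed

lemma frac_sc_pow:
  assumes "frac X"
  shows "frac (sc (a [^] (n::nat)) X)"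
proof -
  note X = fracD[OF assms]
  obtain i where "a [^] (i::nat) \<in> X" using assms unfolding frac_def by auto
  then have "a [^] (n + i) \<in> sc (a [^] n) X" by (auto simp: sc_def nat_pow_mult[symmetric])
  then show ?thesis using fracI[OF sc_pow_fsub[OF X] _ sc_sub[OF pow_A X] assms] by blast
qed

lemma sc_pow_A_sub:
  assumes "submodule X R V" "a [^] (i::nat) \<in> X"
  shows "sc (a [^] i) A \<subseteq> X"
proof
  fix x assume "x \<in> sc (a [^] i) A"
  then obtain r where "r \<in> A" "x = r \<otimes> a [^] i" by (auto simp: sc_def m_comm)
  then show "x \<in> X" using fsubD(4)[OF assms(1) _ assms(2)] by simp
qed

lemma frac_comparable:
  assumes "frac X" "frac Y"
  shows "\<exists>n::nat. sc (a [^] n) Y \<subseteq> X"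
proof -
  note X = fracD[OF assms(1)] and Y = fracD[OF assms(2)]
  obtain i where i: "a [^] (i::nat) \<in> X" using assms(1) unfolding frac_def by auto
  obtain j where j: "sc (a [^] (j::nat)) Y \<subseteq> A" using assms(2) unfolding frac_def by auto
  have "sc (a [^] (i + j)) Y \<subseteq> X"
    unfolding sc_pow_add[OF Y] using sc_mono[OF j] sc_pow_A_sub[OF X i] by (rule subset_trans)
  then show ?thesis by blast
qed

text \<open>A power of a moves X into A, where the multiplicity can be compared with that of A, and
  multiplication by a unit of Q changes no lengths.\<close>

lemma frac_len:
  assumes "frac X"
  shows "len (sc a X) X = e"
proof -
  note X = fracD[OF assms]
  obtain j where j: "sc (a [^] (j::nat)) X \<subseteq> A" using assms unfolding frac_def by auto
  let ?Z = "sc (a [^] j) X"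
  obtain n where n: "sc (a [^] (n::nat)) A \<subseteq> ?Z"
    using frac_comparable[OF frac_sc_pow[OF assms] frac_A] by blast
  have "len (sc a ?Z) ?Z = e"
    unfolding e_def by (rule len_sc_a_eq[OF sc_pow_fsub[OF X] A_fsub j n]) (rule e_finite[unfolded e_def])
  moreover have "sc a ?Z = sc (a [^] j) (sc a X)"
    using sc_sc[of a "a [^] j" X] sc_sc[of "a [^] j" a X] V.submoduleE(1)[OF X] by (simp add: m_comm)
  ultimately show ?thesis using len_sc[OF pow_unit sc_fsub[OF a_Q X] X sc_sub[OF a_A X]] by simp
qed

lemma frac_len_finite:
  assumes "frac X" "frac Y" "X \<subseteq> Y"
  shows "len X Y < \<infinity>"
proof -
  note X = fracD[OF assms(1)] and Y = fracD[OF assms(2)]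
  obtain n where n: "sc (a [^] (n::nat)) Y \<subseteq> X" using frac_comparable[OF assms(1,2)] by blast
  have "len (sc (a [^] n) Y) Y < \<infinity>"
    unfolding len_sc_pow[OF Y] frac_len[OF assms(2)] using e_finite by (cases e) (auto simp: of_nat_eq_enat)
  moreover have "len (sc (a [^] n) Y) Y = len (sc (a [^] n) Y) X + len X Y"
    by (rule V.mlen_add[OF sc_pow_fsub[OF Y] X Y n assms(3)])
  ultimately show ?thesis by (cases "len X Y") auto
qed

lemma frac_colon_frac:
  assumes "frac X" "frac Y"
  shows "frac (frac_colon Q X Y)"
proof -
  note X = fracD[OF assms(1)] and Y = fracD[OF assms(2)]
  have YQ: "Y \<subseteq> carrier Q" using fsubD(1)[OF Y] by auto
  obtain n where n: "sc (a [^] (n::nat)) Y \<subseteq> X" using frac_comparable[OF assms] by blast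
  then have 1: "a [^] n \<in> frac_colon Q X Y" by (auto simp: frac_colon_def sc_def)
  obtain i where i: "a [^] (i::nat) \<in> Y" using assms(2) unfolding frac_def by auto
  obtain j where j: "sc (a [^] (j::nat)) X \<subseteq> A" using assms(1) unfolding frac_def by auto
  \<comment> \<open>The factor a^i lies in Y and takes q into X; the factor a^j then takes X into
    A.\<close>
  have "sc (a [^] (j + i)) (frac_colon Q X Y) \<subseteq> A"
  proof
    fix x assume "x \<in> sc (a [^] (j + i)) (frac_colon Q X Y)"
    then obtain q where q: "q \<in> frac_colon Q X Y" "x = a [^] (j + i) \<otimes> q" by (auto simp: sc_def)
    then have "q \<otimes> a [^] i \<in> X" "q \<in> carrier Q" using i by (auto simp: frac_colon_def)
    moreover have "x = a [^] j \<otimes> (q \<otimes> a [^] i)"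
      using q \<open>q \<in> carrier Q\<close> by (simp add: nat_pow_mult[symmetric] m_ac)
    ultimately show "x \<in> A" using j by (auto simp: sc_def)
  qed
  then show ?thesis using colon_fsub[OF X YQ] 1 unfolding frac_def by blast
qed

lemma colon_sc:
  assumes X: "submodule X R V" and Y: "submodule Y R V" and u: "u \<in> Units Q"
  shows "sc u (frac_colon Q X (sc u Y)) = frac_colon Q X Y"
proof
  have uQ: "u \<in> carrier Q" "inv u \<in> carrier Q" using u by auto
  have YQ: "y \<in> Y \<Longrightarrow> y \<in> carrier Q" for y using fsubD(1)[OF Y] .
  show "sc u (frac_colon Q X (sc u Y)) \<subseteq> frac_colon Q X Y"
    using uQ(1) YQ by (auto simp: sc_def frac_colon_def m_assoc m_lcomm)
  show "frac_colon Q X Y \<subseteq> sc u (frac_colon Q X (sc u Y))"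
  proof
    fix q assume q: "q \<in> frac_colon Q X Y"
    then have qQ: "q \<in> carrier Q" by (simp add: frac_colon_def)
    have "(inv u \<otimes> q) \<otimes> (u \<otimes> y) = q \<otimes> y" if "y \<in> carrier Q" for y
    proof -
      have "(inv u \<otimes> q) \<otimes> (u \<otimes> y) = (inv u \<otimes> u) \<otimes> (q \<otimes> y)" using that uQ qQ by (simp add: m_ac del: Units_l_inv Units_r_inv)
      then show ?thesis using u that qQ by simp
    qed
    then have "inv u \<otimes> q \<in> frac_colon Q X (sc u Y)"
      using q uQ qQ YQ by (auto simp: frac_colon_def sc_def)
    moreover have "q = u \<otimes> (inv u \<otimes> q)" using unit_cancel(2)[OF u qQ] by simp
    ultimately show "q \<in> sc u (frac_colon Q X (sc u Y))" unfolding sc_def by (rule image_eqI[rotated])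
  qed
qed

text \<open>A nonzero module of finite length has an element killed by \<mm>. It is found as z in Y
  - X with (X + Rz)/X of least length: if \<mu>z were outside X for some \<mu> in \<mm>, then X +
  R\<mu>z would be strictly smaller, by Nakayama's argument.\<close>

lemma socle_element:
  assumes X: "submodule X R V" and Y: "submodule Y R V" and XY: "X \<subset> Y" and fin: "len X Y < \<infinity>"
  shows "\<exists>z\<in>Y - X. \<forall>\<mu>\<in>\<mm>. \<mu> \<otimes> z \<in> X"
proof -
  let ?m = "\<lambda>z. the_enat (len X (X <+>\<^bsub>V\<^esub> V.cyc z))"
  define z where "z = arg_min ?m (\<lambda>z. z \<in> Y - X)"
  obtain z1 where z1: "z1 \<in> Y - X" using XY by auto
  have "z \<in> Y - X \<and> (\<forall>y. y \<in> Y - X \<longrightarrow> ?m z \<le> ?m y)"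
    unfolding z_def by (rule arg_min_nat_lemma) (rule z1)
  then have z: "z \<in> Y - X" and min: "\<And>y. y \<in> Y - X \<Longrightarrow> ?m z \<le> ?m y"
    by blast+
  have "\<mu> \<otimes> z \<in> X" if \<mu>: "\<mu> \<in> \<mm>" for \<mu>
  proof (rule ccontr)
    assume n: "\<mu> \<otimes> z \<notin> X"
    have zQ: "z \<in> carrier Q" using z fsubD(1)[OF Y] by auto
    have \<mu>A: "\<mu> \<in> A" using \<mu> by simp
    have yY: "\<mu> \<otimes> z \<in> Y" using z fsubD(4)[OF Y \<mu>A] by auto
    have yQ: "\<mu> \<otimes> z \<in> carrier V" "z \<in> carrier V" using zQ \<mu>A by auto
    let ?L = "X <+>\<^bsub>V\<^esub> V.cyc (\<mu> \<otimes> z)" and ?Z = "X <+>\<^bsub>V\<^esub> V.cyc z"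
    note L = V.sub_extend[OF X yQ(1)] and Z = V.sub_extend[OF X yQ(2)]
    have "\<mu> \<otimes> z \<in> ?Z" using fsubD(4)[OF Z(1) \<mu>A Z(3)] .
    then have LZ: "?L \<subseteq> ?Z" using L(4)[OF Z(1) Z(2)] by simp
    have "z \<notin> ?L"
    proof
      assume "z \<in> ?L"
      then obtain x r where xr: "x \<in> X" "r \<in> A" "z = x \<oplus> r \<otimes> (\<mu> \<otimes> z)"
        by (auto simp: V.mem_set_add V.cyc_def)
      \<comment> \<open>The equation z = x + r\<mu>z becomes (1 - r\<mu>) z = x. Its coefficient is
        a unit because \<mu> lies in \<mm>, so z would belong to X.\<close>
      let ?v = "\<ominus> (r \<otimes> \<mu>) \<oplus> \<one>"
      have r\<mu>: "r \<otimes> \<mu> \<in> \<mm>" using \<mm>.I_l_closed[OF \<mu> xr(2)] by simp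
      have "\<ominus> \<one> \<in> A" using neg_A[OF R.one_closed] by simp
      then have nA: "\<ominus> (r \<otimes> \<mu>) \<in> \<mm>"
        using \<mm>.I_l_closed[OF r\<mu>, of "\<ominus> \<one>"] xr(2) \<mu>A by (simp add: l_minus)
      have vA: "?v \<in> A" using R.a_closed[of "\<ominus> (r \<otimes> \<mu>)" \<one>] R.one_closed nA by simp
      have "?v \<notin> \<mm>"
      proof
        assume "?v \<in> \<mm>"
        then have "r \<otimes> \<mu> \<oplus> ?v \<in> \<mm>" using \<mm>.a_closed[OF r\<mu>, of ?v] by simp
        moreover have "r \<otimes> \<mu> \<oplus> ?v = \<one>" using xr(2) \<mu>A by (simp add: a_assoc[symmetric] r_neg)
        ultimately show False using \<mm>_one by simp
      qed
      then obtain i where i: "i \<in> A" "i \<otimes> ?v = \<one>" using units[OF vA] unfolding Units_def by auto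
      have xQ: "x \<in> carrier Q" using xr fsubD(1)[OF X] by simp
      have "?v \<otimes> z = z \<oplus> \<ominus> (r \<otimes> (\<mu> \<otimes> z))"
        using xr(2) \<mu>A zQ by (simp add: l_distr l_minus m_assoc a_comm)
      also have "\<dots> = x"
        using xr(2) \<mu>A zQ xQ by (subst xr(3)) (simp add: a_assoc r_neg)
      finally have "z = i \<otimes> x" using i zQ R_mem[OF vA] by (metis m_assoc l_one R_mem)
      then have "z \<in> X" using fsubD(4)[OF X i(1) xr(1)] by simp
      then show False using z by simp
    qed
    then have "?L \<subset> ?Z" using LZ Z(3) by auto
    then have "1 \<le> len ?L ?Z" by (rule V.mlen_pos[OF L(1) Z(1)])
    moreover have "len X ?Z = len X ?L + len ?L ?Z" by (rule V.mlen_add[OF X L(1) Z(1) L(2) LZ])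
    moreover have "len X ?Z < \<infinity>"
    proof -
      have "?Z \<subseteq> Y" by (rule Z(4)[OF Y]) (use XY z in auto)
      then have "len X Y = len X ?Z + len ?Z Y" by (rule V.mlen_add[OF X Z(1) Y Z(2)])
      then show ?thesis using fin by (cases "len X ?Z") auto
    qed
    ultimately have "?m (\<mu> \<otimes> z) < ?m z"
      by (cases "len X ?L"; cases "len ?L ?Z") (auto simp: one_enat_def)
    moreover have "?m z \<le> ?m (\<mu> \<otimes> z)" by (rule min) (use n yY in auto)
    ultimately show False by simp
  qed
  then show ?thesis using z by blast
qed

end

context local_cm_ring
begin

section \<open>Duality\<close>

lemma colon_\<mm>_mem: "q \<in> frac_colon Q X \<mm> \<longleftrightarrow> q \<in> carrier Q \<and> (\<forall>\<mu>\<in>\<mm>. \<mu> \<otimes> q \<in> X)"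
  by (auto simp: frac_colon_def m_comm)

text \<open>Induction on the length of Y/X. For a socle element z of Y modulo X and Z = X + Rz,
  multiplication by z maps C : X into C : \<mm>, and the preimage of C is exactly C : Z. Hence
  passing from Z to X enlarges the dual by at most the length of (C : \<mm>)/C.\<close>

lemma len_colon_le:
  assumes C: "frac C" and type: "len C (frac_colon Q C \<mm>) \<le> 1"
    and "len X Y = enat n" and X: "submodule X R V" and Y: "submodule Y R V" and "X \<subseteq> Y"
  shows "len (frac_colon Q C Y) (frac_colon Q C X) \<le> enat n"
  using assms(3,4,6)
proof (induction n arbitrary: X rule: less_induct)
  case (less n)
  note Xs = \<open>submodule X R V\<close>
  note Cs = fracD[OF C]
  have YQ: "Y \<subseteq> carrier Q" using fsubD(1)[OF Y] by auto
  have XQ: "X \<subseteq> carrier Q" using fsubD(1)[OF Xs] by auto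
  show ?case
  proof (cases "X = Y")
    case True
    then show ?thesis using V.mlen_self[OF colon_fsub[OF Cs YQ]] by simp
  next
    case False
    then have "X \<subset> Y" using less.prems by auto
    then obtain z where z: "z \<in> Y" "z \<notin> X" "\<And>\<mu>. \<mu> \<in> \<mm> \<Longrightarrow> \<mu> \<otimes> z \<in> X"
      using socle_element[OF Xs Y] less.prems(1) by auto
    have zQ: "z \<in> carrier Q" using z YQ by auto
    let ?Z = "X <+>\<^bsub>V\<^esub> V.cyc z"
    have zV: "z \<in> carrier V" using zQ by simp
    note Z = V.sub_extend[OF Xs zV]
    have ZY: "?Z \<subseteq> Y" by (rule Z(4)[OF Y less.prems(3) z(1)])
    have ZQ: "?Z \<subseteq> carrier Q" using ZY YQ by auto
    have add: "len X Y = len X ?Z + len ?Z Y" by (rule V.mlen_add[OF Xs Z(1) Y Z(2) ZY])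
    have pos: "1 \<le> len X ?Z" by (rule V.mlen_pos[OF Xs Z(1)]) (use Z(2,3) z(2) in auto)
    obtain k where k: "len ?Z Y = enat k" using add less.prems(1) by (cases "len ?Z Y") auto
    have kn: "Suc k \<le> n" using add pos k less.prems(1) by (cases "len X ?Z") (auto simp: one_enat_def)
    have IH: "len (frac_colon Q C Y) (frac_colon Q C ?Z) \<le> enat k"
      by (rule less.IH[OF _ k Z(1) ZY]) (use kn in simp)
    let ?cX = "frac_colon Q C X" and ?cZ = "frac_colon Q C ?Z" and ?cY = "frac_colon Q C Y"
    let ?D = "frac_colon Q C \<mm>"
    have mQ: "\<mm> \<subseteq> carrier Q" by auto
    note cs = colon_fsub[OF Cs XQ] colon_fsub[OF Cs ZQ] colon_fsub[OF Cs YQ] colon_fsub[OF Cs mQ]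
    interpret l: linear_map R V V ?cX "\<lambda>x. z \<otimes> x" by (rule mult_linear_map[OF zQ cs(1)])
    have CD: "C \<subseteq> ?D" using fsubD(1,4)[OF Cs] by (auto simp: colon_\<mm>_mem)
    have im: "(\<lambda>x. z \<otimes> x) ` ?cX \<subseteq> ?D"
    proof
      fix y assume "y \<in> (\<lambda>x. z \<otimes> x) ` ?cX"
      then obtain q where q: "q \<in> ?cX" "y = z \<otimes> q" by auto
      then have qQ: "q \<in> carrier Q" by (simp add: frac_colon_def)
      have "\<mu> \<otimes> y \<in> C" if \<mu>: "\<mu> \<in> \<mm>" for \<mu>
      proof -
        have "\<mu> \<otimes> y = q \<otimes> (\<mu> \<otimes> z)" using \<mu> zQ qQ q(2) by (simp add: m_ac)
        then show ?thesis using q(1) z(3)[OF \<mu>] by (simp add: frac_colon_def)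
      qed
      then show "y \<in> ?D" using zQ qQ q(2) by (simp add: colon_\<mm>_mem)
    qed
    have "{q \<in> ?cX. z \<otimes> q \<in> C} = ?cZ"
    proof
      show "?cZ \<subseteq> {q \<in> ?cX. z \<otimes> q \<in> C}"
        using Z(2,3) zQ by (auto simp: frac_colon_def m_comm)
      show "{q \<in> ?cX. z \<otimes> q \<in> C} \<subseteq> ?cZ"
      proof
        fix q assume "q \<in> {q \<in> ?cX. z \<otimes> q \<in> C}"
        then have q: "q \<in> ?cX" "z \<otimes> q \<in> C" "q \<in> carrier Q" by (auto simp: frac_colon_def)
        have "submodule {x \<in> carrier Q. q \<otimes> x \<in> C} R V"
          using linear_map.sub_vimage[OF mult_linear_map[OF q(3)] Cs] V.carrier_is_submodule by simp
        then have "?Z \<subseteq> {x \<in> carrier Q. q \<otimes> x \<in> C}"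
          by (rule Z(4)) (use q XQ zQ in \<open>auto simp: frac_colon_def m_comm\<close>)
        then show "q \<in> ?cZ" using q(3) by (auto simp: frac_colon_def)
      qed
    qed
    then have "len ?cZ ?cX \<le> len C ?D" using l.mlen_vimage_le[OF Cs cs(4) CD im] by simp
    then have "len ?cZ ?cX \<le> 1" using type by (rule order_trans)
    moreover have "len ?cY ?cX = len ?cY ?cZ + len ?cZ ?cX"
      by (rule V.mlen_add[OF cs(3,2,1) colon_antimono[OF ZY] colon_antimono[OF Z(2)]])
    ultimately have "len ?cY ?cX \<le> enat k + 1" using IH by (simp add: add_mono)
    also have "\<dots> \<le> enat n" using kn by (simp add: one_enat_def)
    finally show ?thesis .
  qed
qed

text \<open>The inequality of the previous lemma is an equality because it is one for the pair
  \<open>a\<^sup>n Y \<subseteq> Y\<close>: both sides are then \<open>n e(R)\<close>.\<close>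

lemma len_colon:
  assumes C: "frac C" and type: "len C (frac_colon Q C \<mm>) \<le> 1"
    and X: "frac X" and Y: "frac Y" and XY: "X \<subseteq> Y"
  shows "len (frac_colon Q C Y) (frac_colon Q C X) = len X Y"
proof -
  note Xs = fracD[OF X] and Ys = fracD[OF Y] and Cs = fracD[OF C]
  obtain n where n: "sc (a [^] (n::nat)) Y \<subseteq> X" using frac_comparable[OF X Y] by blast
  let ?Z = "sc (a [^] n) Y"
  have Z: "frac ?Z" by (rule frac_sc_pow[OF Y])
  note Zs = fracD[OF Z]
  let ?cX = "frac_colon Q C X" and ?cZ = "frac_colon Q C ?Z" and ?cY = "frac_colon Q C Y"
  note cf = frac_colon_frac[OF C X] frac_colon_frac[OF C Y] frac_colon_frac[OF C Z]
  note cs = cf[THEN fracD]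
  have s1: "?cY \<subseteq> ?cX" and s2: "?cX \<subseteq> ?cZ" using colon_antimono XY n by auto
  obtain p q where p: "len X Y = enat p" and q: "len ?Z X = enat q"
    using frac_len_finite[OF X Y XY] frac_len_finite[OF Z X n] by auto
  have le: "len ?cY ?cX \<le> enat p" "len ?cX ?cZ \<le> enat q"
    using len_colon_le[OF C type p Xs Ys XY] len_colon_le[OF C type q Zs Xs n] by auto
  \<comment> \<open>C : Y is a^n times C : (a^n Y), so the dual pair is again a fractional ideal and
    its multiple by a^n.\<close>
  have "len ?cY ?cZ = len (sc (a [^] n) ?cZ) ?cZ"
    by (simp only: colon_sc[OF Cs Ys pow_unit])
  also have "\<dots> = of_nat n * e" by (simp only: len_sc_pow[OF cs(3)] frac_len[OF cf(3)])
  also have "\<dots> = len ?Z Y" by (simp only: len_sc_pow[OF Ys] frac_len[OF Y])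
  also have "\<dots> = len ?Z X + len X Y" by (rule V.mlen_add[OF Zs Xs Ys n XY])
  finally have "len ?cY ?cZ = enat q + enat p" using p q by simp
  moreover have "len ?cY ?cZ = len ?cY ?cX + len ?cX ?cZ"
    by (rule V.mlen_add[OF cs(2,1,3) s1 s2])
  \<comment> \<open>Two finite upper bounds whose sum is attained are both attained.\<close>
  ultimately show ?thesis using le p by (cases "len ?cY ?cX"; cases "len ?cX ?cZ") auto
qed

text \<open>Duality is a Galois connection, so X and its double dual have the same dual. As lengths
  are preserved, the quotient of the double dual by X has length zero.\<close>

lemma colon_colon:
  assumes C: "frac C" and type: "len C (frac_colon Q C \<mm>) \<le> 1" and X: "frac X"
  shows "frac_colon Q C (frac_colon Q C X) = X"
proof -
  let ?d = "frac_colon Q C"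
  have dX: "frac (?d X)" "frac (?d (?d X))" "frac (?d (?d (?d X)))"
    using frac_colon_frac[OF C] X by auto
  have sub: "Y \<subseteq> ?d (?d Y)" if "frac Y" for Y
    using fsubD(1)[OF fracD[OF that]] by (auto simp: frac_colon_def m_comm)
  have "?d X = ?d (?d (?d X))"
    using sub[OF dX(1)] colon_antimono[OF sub[OF X]] by blast
  then have "len X (?d (?d X)) = 0"
    using len_colon[OF C type X dX(2) sub[OF X]] V.mlen_self[OF fracD[OF dX(1)]] by simp
  then show ?thesis
    using V.mlen_eq_0D[OF fracD[OF X] fracD[OF dX(2)] sub[OF X]] by simp
qed

section \<open>The integral closure\<close>

abbreviation S where "S \<equiv> integral_closure R Q"

text \<open>The R-module generated by 1, y, ..., y^(k-1). That y^k belongs to it is an equation of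
  integral dependence of degree k.\<close>

primrec pow_span :: "'a \<Rightarrow> nat \<Rightarrow> 'a set" where
  "pow_span y 0 = {\<zero>}"
| "pow_span y (Suc k) = pow_span y k <+>\<^bsub>V\<^esub> V.cyc (y [^] k)"

lemma pow_span:
  assumes y: "y \<in> carrier Q"
  shows "submodule (pow_span y k) R V" "pow_span y k \<subseteq> pow_span y (Suc k)" "y [^] k \<in> pow_span y (Suc k)"
proof -
  have s: "submodule (pow_span y k) R V" for k
  proof (induction k)
    case 0
    show ?case by (rule fsubI) auto
  next
    case (Suc k)
    then show ?case using V.sub_extend(1)[OF Suc, of "y [^] k"] y by simp
  qed
  show "submodule (pow_span y k) R V" by (rule s)
  show "pow_span y k \<subseteq> pow_span y (Suc k)" "y [^] k \<in> pow_span y (Suc k)"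
    using V.sub_extend(2,3)[OF s[of k], of "y [^] k"] y by simp_all
qed

lemma pow_span_combination:
  assumes y: "y \<in> carrier Q" and "q \<in> pow_span y k"
  shows "\<exists>c. (\<forall>i<k. c i \<in> A) \<and> q = (\<Oplus>i\<in>{..<k}. c i \<otimes> y [^] i)"
  using assms(2)
proof (induction k arbitrary: q)
  case 0
  then show ?case by simp
next
  case (Suc k)
  then obtain p d where "p \<in> pow_span y k" "d \<in> V.cyc (y [^] k)" "q = p \<oplus>\<^bsub>V\<^esub> d"
    unfolding pow_span.simps V.mem_set_add by blast
  then obtain r where pr: "p \<in> pow_span y k" "r \<in> A" "q = p \<oplus> r \<otimes> y [^] k"
    unfolding V.cyc_def by auto
  obtain c where c: "\<forall>i<k. c i \<in> A" "p = (\<Oplus>i\<in>{..<k}. c i \<otimes> y [^] i)" using Suc.IH[OF pr(1)] by blast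
  let ?c = "c(k := r)"
  have cl: "(\<lambda>i. ?c i \<otimes> y [^] i) \<in> {..<k} \<rightarrow> carrier Q" using c(1) y by auto
  have "(\<Oplus>i\<in>{..<Suc k}. ?c i \<otimes> y [^] i) = ?c k \<otimes> y [^] k \<oplus> (\<Oplus>i\<in>{..<k}. ?c i \<otimes> y [^] i)"
    unfolding lessThan_Suc by (rule finsum_insert) (use cl pr(2) y in auto)
  also have "(\<Oplus>i\<in>{..<k}. ?c i \<otimes> y [^] i) = p"
    unfolding c(2) by (rule finsum_cong') (use c(1) y in auto)
  also have "?c k \<otimes> y [^] k \<oplus> p = q"
    using pr y fsubD(1)[OF pow_span(1)[OF y] pr(1)] by (simp add: a_comm)
  finally have "q = (\<Oplus>i\<in>{..<Suc k}. ?c i \<otimes> y [^] i)" ..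
  moreover have "\<forall>i<Suc k. ?c i \<in> A" using c(1) pr(2) by (auto simp: less_Suc_eq)
  ultimately show ?case by blast
qed

lemma pow_span_integral:
  assumes y: "y \<in> carrier Q" and "y [^] k \<in> pow_span y k"
  shows "y \<in> S"
proof -
  \<comment> \<open>The defining equation of \<open>integral_closure\<close> adds the lower terms to
    the leading power, hence the sign.\<close>
  have "(\<ominus> \<one>) \<otimes> y [^] k \<in> pow_span y k"
    by (rule fsubD(4)[OF pow_span(1)[OF y] _ assms(2)]) (use neg_A[OF R.one_closed] in simp)
  then obtain c where c: "\<forall>i<k. c i \<in> A" "(\<ominus> \<one>) \<otimes> y [^] k = (\<Oplus>i\<in>{..<k}. c i \<otimes> y [^] i)"
    using pow_span_combination[OF y] by blast
  have "y [^] k \<oplus> (\<Oplus>i\<in>{..<k}. c i \<otimes> y [^] i) = \<zero>"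
    unfolding c(2)[symmetric] using y by (simp add: l_minus r_neg)
  then show ?thesis unfolding integral_closure_def using y c(1) by blast
qed

lemma A_sub_S: "A \<subseteq> S"
proof
  fix r assume r: "r \<in> A"
  have "r \<otimes> r [^] (0::nat) \<in> pow_span r (Suc 0)"
    using r by (intro fsubD(4)[OF pow_span(1)] pow_span(3)) auto
  then have "r [^] Suc 0 \<in> pow_span r (Suc 0)" using r by simp
  then show "r \<in> S" by (rule pow_span_integral[OF R_mem[OF r]])
qed

text \<open>Since \<open>\<mm>\<^sup>n\<^sup>+\<^sup>1 = a \<mm>\<^sup>n\<close>, the element \<open>y = x/a\<close> maps \<open>\<mm>\<^sup>n\<close> into itself, so \<open>a\<^sup>n R[y] \<subseteq> R\<close> and \<open>R[y]\<close> is
  a Noetherian module.\<close>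

lemma \<mm>_over_a_integral:
  assumes x: "x \<in> \<mm>"
  shows "inv a \<otimes> x \<in> S"
proof -
  let ?y = "inv a \<otimes> x"
  have xQ: "x \<in> carrier Q" using x by auto
  have aiQ: "inv a \<in> carrier Q" using a_unit by simp
  have y: "?y \<in> carrier Q" using xQ aiQ by simp
  obtain n where n: "P (Suc n) = sc a (P n)" using P_reduction by blast
  have step: "?y \<otimes> p \<in> P n" if p: "p \<in> P n" for p
  proof -
    have "p \<otimes>\<^bsub>R\<^esub> x \<in> P (Suc n)" unfolding P_simps by (rule ideal_prod.prod[OF p x])
    then obtain p' where p': "p' \<in> P n" "p \<otimes> x = a \<otimes> p'" unfolding n by (auto simp: sc_def)
    have Q: "p \<in> carrier Q" "p' \<in> carrier Q" using p p'(1) fsubD(1)[OF P_fsub] by auto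
    have "?y \<otimes> p = inv a \<otimes> (p \<otimes> x)" using xQ aiQ Q by (simp add: m_ac)
    also have "\<dots> = p'" using p'(2) unit_cancel(1)[OF a_unit Q(2)] by simp
    finally show ?thesis using p'(1) by simp
  qed
  have aP: "a [^] n \<in> P n"
  proof (induction n)
    case 0
    show ?case using R.one_closed by simp
  next
    case (Suc n)
    have "a [^] n \<otimes>\<^bsub>R\<^esub> a \<in> P n \<cdot>\<^bsub>R\<^esub> \<mm>" by (rule ideal_prod.prod[OF Suc a_mem])
    then show ?case by simp
  qed
  have yP: "?y [^] (j::nat) \<otimes> a [^] n \<in> P n" for j
  proof (induction j)
    case 0
    show ?case using aP by simp
  next
    case (Suc j)
    have "?y [^] Suc j \<otimes> a [^] n = ?y \<otimes> (?y [^] j \<otimes> a [^] n)" using y by (simp add: m_ac)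
    then show ?case using step[OF Suc] by simp
  qed
  \<comment> \<open>Multiplied by a^n, the spans of powers of y become an ascending sequence of
    ideals of R. It stabilizes, and a^n can be cancelled afterwards.\<close>
  let ?I = "\<lambda>k. sc (a [^] n) (pow_span ?y k)"
  have Is: "submodule (?I k) R V" for k by (rule sc_fsub[OF pow_Q pow_span(1)[OF y]])
  have mono: "?I k \<subseteq> ?I m" if "k \<le> m" for k m
    using that by (induction rule: dec_induct) (use sc_mono[OF pow_span(2)[OF y]] in blast)+
  have "pow_span ?y k \<subseteq> {q \<in> carrier Q. a [^] n \<otimes> q \<in> A}" for k
  proof (induction k)
    case 0
    show ?case using R.zero_closed by auto
  next
    case (Suc k)
    have s: "submodule {q \<in> carrier Q. a [^] n \<otimes> q \<in> A} R V"
      using linear_map.sub_vimage[OF mult_linear_map[OF pow_Q] A_fsub] V.carrier_is_submodule by simp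
    have yk: "?y [^] k \<in> carrier V" using y by simp
    have "a [^] n \<otimes> ?y [^] k \<in> A" using yP[of k] P_sub(2) y by (auto simp: m_comm)
    then show ?case
      unfolding pow_span.simps
      by (intro V.sub_extend(4)[OF pow_span(1)[OF y] yk s Suc]) (use y in simp)
  qed
  then have IA: "?I k \<subseteq> A" for k unfolding sc_def by blast
  have "\<Union>(range ?I) \<in> range ?I"
  proof (rule noetherian_ring.ideal_chain_is_trivial[OF noeth])
    show "subset.chain {I. ideal I R} (range ?I)"
      unfolding subset_chain_def
    proof (intro conjI ballI)
      show "range ?I \<subseteq> {I. ideal I R}" using fsub_ideal[OF Is IA] by auto
      fix X Y assume "X \<in> range ?I" "Y \<in> range ?I"
      then obtain k m where "X = ?I k" "Y = ?I m" by auto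
      then show "X \<subseteq> Y \<or> Y \<subseteq> X" using mono[of k m] mono[of m k] by (cases "k \<le> m") auto
    qed
  qed simp
  then obtain k where k: "\<Union>(range ?I) = ?I k" by auto
  have "a [^] n \<otimes> ?y [^] k \<in> ?I (Suc k)" unfolding sc_def by (rule imageI[OF pow_span(3)[OF y]])
  then have "a [^] n \<otimes> ?y [^] k \<in> ?I k" using k by blast
  then have "?y [^] k \<in> pow_span ?y k"
    using mem_sc_unit[OF pow_unit, of "pow_span ?y k" "?y [^] k" n] fsubD(1)[OF pow_span(1)[OF y]] y by blast
  then show ?thesis by (rule pow_span_integral[OF y])
qed

end

section \<open>Products of generators\<close>

text \<open>A new element g contributes at most one product with each element of G and its own
  square, and ((n + 1) choose 2) + (n + 1) = (n + 2) choose 2.\<close>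

lemma card_products_le:
  assumes "finite G" and comm: "\<And>x y. x \<in> G \<Longrightarrow> y \<in> G \<Longrightarrow> f x y = f y x"
  shows "card ((\<lambda>(x, y). f x y) ` (G \<times> G)) \<le> (card G + 1) choose 2"
  using assms
proof (induction G rule: finite_induct)
  case empty
  show ?case by simp
next
  case (insert g G)
  let ?p = "\<lambda>G. (\<lambda>(x, y). f x y) ` (G \<times> G)"
  have sub: "?p (insert g G) \<subseteq> ?p G \<union> f g ` insert g G"
    using insert.prems by (auto simp: image_iff)
  have "card (?p (insert g G)) \<le> card (?p G \<union> f g ` insert g G)"
    by (rule card_mono[OF _ sub]) (use insert.hyps in auto)
  also have "\<dots> \<le> card (?p G) + card (f g ` insert g G)" by (rule card_Un_le)
  also have "\<dots> \<le> ((card G + 1) choose 2) + (card G + 1)"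
  proof (rule add_mono)
    show "card (?p G) \<le> (card G + 1) choose 2" by (rule insert.IH) (use insert.prems in auto)
    show "card (f g ` insert g G) \<le> card G + 1"
      using card_image_le[of "insert g G" "f g"] insert.hyps by simp
  qed
  also have "\<dots> = (card (insert g G) + 1) choose 2" using insert.hyps by (simp add: numeral_2_eq_2)
  finally show ?case .
qed

section \<open>The bounds\<close>

context local_cm_ring
begin

context
  assumes S_ring: "cring (Q\<lparr>carrier := S\<rparr>)"
    and S_fg: "finitely_generated_module R (ring_module Q S)"
begin

section \<open>Bounds when the integral closure is a finite ring extension\<close>

lemma S_closed:
  "x \<in> S \<Longrightarrow> x \<in> carrier Q"
  "x \<in> S \<Longrightarrow> y \<in> S \<Longrightarrow> x \<oplus> y \<in> S"
  "x \<in> S \<Longrightarrow> y \<in> S \<Longrightarrow> x \<otimes> y \<in> S"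
proof -
  interpret S: cring "Q\<lparr>carrier := S\<rparr>" by (rule S_ring)
  show "x \<in> S \<Longrightarrow> x \<in> carrier Q" by (simp add: integral_closure_def)
  show "x \<in> S \<Longrightarrow> y \<in> S \<Longrightarrow> x \<oplus> y \<in> S" using S.a_closed[of x y] by simp
  show "x \<in> S \<Longrightarrow> y \<in> S \<Longrightarrow> x \<otimes> y \<in> S" using S.m_closed[of x y] by simp
qed

lemma S_fsub: "submodule S R V"
  by (rule fsubI) (use S_closed A_sub_S fsubD(2)[OF A_fsub] in auto)

text \<open>Finite generation gives a common denominator: a power of a that clears all generators
  clears all of S.\<close>

lemma S_frac: "frac S"
proof -
  obtain G where G: "finite G" "G \<subseteq> S" "generated_submodule R (ring_module Q S) G = S"
    using S_fg unfolding finitely_generated_module_def by auto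
  have "\<forall>g\<in>G. \<exists>n::nat. a [^] n \<otimes> g \<in> A" using G(2) S_closed(1) frac_denominator by blast
  then obtain f :: "'a \<Rightarrow> nat" where f: "\<forall>g\<in>G. a [^] f g \<otimes> g \<in> A" by (rule bchoice[THEN exE])
  define N where "N = (\<Sum>g\<in>G. f g)"
  have aN: "a [^] N \<otimes> g \<in> A" if g: "g \<in> G" for g
  proof -
    have le: "f g \<le> N" unfolding N_def by (rule member_le_sum) (use g G in auto)
    have gQ: "g \<in> carrier Q" using g G S_closed(1) by auto
    have "a [^] N \<otimes> g = a [^] (N - f g) \<otimes> (a [^] f g \<otimes> g)"
      using le gQ by (simp add: m_assoc[symmetric] nat_pow_mult)
    then show ?thesis using fsubD(4)[OF A_fsub pow_A bspec[OF f g]] by simp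
  qed
  have eq: "ring_module Q S = V\<lparr>carrier := S\<rparr>" by (simp add: ring_module_def)
  have mod: "module R (ring_module Q S)"
    unfolding eq by (rule submodule.submodule_is_module[OF S_fsub module_V])
  let ?N = "{x \<in> S. a [^] N \<otimes> x \<in> A}"
  have N: "submodule ?N R V"
    using linear_map.sub_vimage[OF mult_linear_map[OF pow_Q S_fsub] A_fsub] by simp
  have "submodule ?N R (ring_module Q S)"
    by (rule module.submoduleI'[OF mod]) (use fsubD(2-4)[OF N] in simp_all)
  then have "generated_submodule R (ring_module Q S) G \<subseteq> ?N"
    by (rule module.generated_submodule_least[OF mod]) (use G(2) aN in auto)
  then have "sc (a [^] N) S \<subseteq> A" unfolding G(3) sc_def by auto
  moreover have "a [^] (0::nat) \<in> S" using A_sub_S by blast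
  ultimately show ?thesis using S_fsub unfolding frac_def by blast
qed

lemma \<mm>_S_sub: "\<mu> \<in> \<mm> \<Longrightarrow> s \<in> S \<Longrightarrow> \<mu> \<otimes> s \<in> sc a S"
proof -
  assume \<mu>: "\<mu> \<in> \<mm>" and s: "s \<in> S"
  have Q: "\<mu> \<in> carrier Q" "s \<in> carrier Q" "inv a \<in> carrier Q" using \<mu> S_closed(1)[OF s] a_unit by auto
  have "\<mu> \<otimes> s = a \<otimes> ((inv a \<otimes> \<mu>) \<otimes> s)"
    using unit_cancel(2)[OF a_unit, of "\<mu> \<otimes> s"] Q by (simp add: m_assoc)
  then show ?thesis using S_closed(3)[OF \<mm>_over_a_integral[OF \<mu>] s] unfolding sc_def by (rule image_eqI)
qed

lemma between_frac:
  assumes "submodule X R V" "A \<subseteq> X" "X \<subseteq> S"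
  shows "frac X"
proof -
  have "a [^] (0::nat) \<in> X" using assms(2) by blast
  then show ?thesis by (rule fracI[OF assms(1) _ assms(3) S_frac])
qed

text \<open>There are inclusions A \<subseteq> A : \<mm> \<subseteq> a^(-1) A, and the outer two
  modules differ by length e. It remains to exclude equality on the right, which would mean \<mm> =
  aA; R would then be integrally closed.\<close>

lemma len_socle_lt:
  assumes "S \<noteq> A"
  shows "len A (frac_colon Q A \<mm>) + 1 \<le> e"
proof -
  let ?D = "frac_colon Q A \<mm>" and ?B = "sc (inv a) A"
  have aiQ: "inv a \<in> carrier Q" using a_unit by simp
  have ia: "inv a \<in> Units Q" using a_unit by simp
  have mQ: "\<mm> \<subseteq> carrier Q" by auto
  note D = colon_fsub[OF A_fsub mQ] and B = sc_fsub[OF aiQ A_fsub]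
  have aB: "sc a ?B = A"
    using sc_sc[of a "inv a" A] sc_one[of A] aiQ carrier_sub by simp
  have "len A ?B = len (sc a A) (sc a ?B)"
    by (rule len_sc[OF a_unit A_fsub B, symmetric]) (use sc_sub[OF a_A B] aB in simp)
  then have eB: "len A ?B = e" unfolding aB e_def .
  have AD: "A \<subseteq> ?D" using fsubD(4)[OF A_fsub] by (auto simp: colon_\<mm>_mem)
  have DB: "?D \<subseteq> ?B"
  proof
    fix q assume "q \<in> ?D"
    then have q: "q \<in> carrier Q" "a \<otimes> q \<in> A" using a_mem by (auto simp: colon_\<mm>_mem)
    then show "q \<in> ?B" using unit_cancel(1)[OF a_unit q(1)] unfolding sc_def by (intro image_eqI[of q _ "a \<otimes> q"]) auto
  qed
  have "?D \<noteq> ?B"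
  proof
    assume DB: "?D = ?B"
    have "inv a \<in> ?B" unfolding sc_def using R.one_closed aiQ by (intro image_eqI[of _ _ \<one>]) auto
    then have ai: "\<mu> \<otimes> inv a \<in> A" if "\<mu> \<in> \<mm>" for \<mu> using that unfolding DB[symmetric] by (simp add: colon_\<mm>_mem)
    have \<mm>_eq: "\<exists>t\<in>A. \<mu> = a \<otimes> t" if \<mu>: "\<mu> \<in> \<mm>" for \<mu>
    proof -
      have \<mu>Q: "\<mu> \<in> carrier Q" using \<mu> by auto
      have "\<mu> = a \<otimes> (\<mu> \<otimes> inv a)"
        using unit_cancel(2)[OF a_unit \<mu>Q] \<mu>Q aiQ by (simp add: m_comm)
      then show ?thesis using ai[OF \<mu>] by blast
    qed
    obtain q where q: "q \<in> S" "q \<notin> A" using assms A_sub_S by blast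
    have qQ: "q \<in> carrier Q" by (rule S_closed(1)[OF q(1)])
    \<comment> \<open>The least power of a clearing the denominator of q. By minimality a^k q is not
      divisible by a in A, so it lies outside \<mm> = aA and is a unit.\<close>
    define k where "k = (LEAST k::nat. a [^] k \<otimes> q \<in> A)"
    have k: "a [^] k \<otimes> q \<in> A" unfolding k_def by (rule LeastI_ex[OF frac_denominator[OF qQ]])
    have "k \<noteq> 0" using k q(2) qQ by (cases k) auto
    then obtain l where l: "k = Suc l" by (cases k) auto
    have nl: "a [^] l \<otimes> q \<notin> A"
      using not_less_Least[of l "\<lambda>k. a [^] k \<otimes> q \<in> A"] l unfolding k_def[symmetric] by simp
    have kl: "a [^] k \<otimes> q = a \<otimes> (a [^] l \<otimes> q)" using qQ l by (simp add: m_ac)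
    have "a [^] k \<otimes> q \<notin> \<mm>"
    proof
      assume "a [^] k \<otimes> q \<in> \<mm>"
      then obtain t where t: "t \<in> A" "a \<otimes> (a [^] l \<otimes> q) = a \<otimes> t" using \<mm>_eq kl by metis
      have "a [^] l \<otimes> q = inv a \<otimes> (a \<otimes> (a [^] l \<otimes> q))" by (rule unit_cancel(1)[OF a_unit, symmetric]) (use qQ in simp)
      also have "\<dots> = t" unfolding t(2) by (rule unit_cancel(1)[OF a_unit]) (use t in simp)
      finally show False using nl t(1) by simp
    qed
    then obtain u where u: "u \<in> A" "u \<otimes> (a [^] k \<otimes> q) = \<one>" using units[OF k] unfolding Units_def by auto
    \<comment> \<open>This is the inverse of a, now seen to lie in S. All its powers lie in S too,
      and a^j S \<subseteq> A gives b = a^j b^(j+1) in A, contradicting a in \<mm>.\<close>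
    let ?b = "u \<otimes> (a [^] l \<otimes> q)"
    have bS: "?b \<in> S"
      using S_closed(3) u(1) q(1) A_sub_S pow_A by blast
    have ab: "a \<otimes> ?b = \<one>" using u qQ kl by (simp add: m_lcomm)
    have bQ: "?b \<in> carrier Q" by (rule S_closed(1)[OF bS])
    have bn: "?b [^] (n::nat) \<in> S" for n
    proof (induction n)
      case 0
      then show ?case using A_sub_S R.one_closed by auto
    next
      case (Suc n)
      then show ?case using S_closed(3)[OF Suc bS] by simp
    qed
    obtain j where j: "sc (a [^] (j::nat)) S \<subseteq> A" using S_frac unfolding frac_def by blast
    have "a [^] j \<otimes> ?b [^] j = \<one>" using ab bQ by (simp add: pow_mult_distrib[symmetric] m_comm del: nat_pow_Suc)
    then have "a [^] j \<otimes> ?b [^] Suc j = ?b" using bQ by (simp add: m_assoc[symmetric])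
    moreover have "a [^] j \<otimes> ?b [^] Suc j \<in> A" using j bn[of "Suc j"] unfolding sc_def by blast
    ultimately have "?b \<in> A" by simp
    then have "\<one> \<in> \<mm>" using \<mm>.I_r_closed[OF a_mem, of ?b] ab by simp
    then show False using \<mm>_one by simp
  qed
  then have "1 \<le> len ?D ?B" using DB by (intro V.mlen_pos[OF D B]) auto
  then have "len A ?D + 1 \<le> len A ?D + len ?D ?B" by (rule add_left_mono)
  also have "\<dots> = e" using V.mlen_add[OF A_fsub D B AD DB] eB by simp
  finally show ?thesis .
qed

lemma e_le_choose:
  assumes C: "submodule C R V" "A \<subseteq> C" "C \<subseteq> S"
    and type: "len C (frac_colon Q C \<mm>) \<le> 1"
    and far: "frac_colon Q A C \<subseteq> frac_colon Q A S"
    and r: "len A (frac_colon Q A \<mm>) = enat r"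
  shows "e \<le> enat ((r + 1) choose 2)"
proof -
  let ?d = "frac_colon Q C"
  have one: "\<one> \<in> C" using C(2) R.one_closed by auto
  have CQ: "x \<in> C \<Longrightarrow> x \<in> carrier Q" for x by (rule fsubD(1)[OF C(1)])
  have Cf: "frac C" by (rule between_frac[OF C])
  note dd = colon_colon[OF Cf type]
  have CA: "?d A = C"
  proof
    show "?d A \<subseteq> C"
    proof
      fix q assume "q \<in> ?d A"
      then have "q \<in> carrier Q" "q \<otimes> \<one> \<in> C" using R.one_closed by (auto simp: frac_colon_def)
      then show "q \<in> C" by simp
    qed
    show "C \<subseteq> ?d A"
    proof
      fix q assume q: "q \<in> C"
      have "q \<otimes> x \<in> C" if "x \<in> A" for x
        using fsubD(4)[OF C(1) that q] m_comm[OF CQ[OF q] R_mem[OF that]] by simp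
      then show "q \<in> ?d A" using CQ[OF q] by (simp add: frac_colon_def)
    qed
  qed
  have CC: "?d C = A" using dd[OF frac_A] CA by simp
  let ?T0 = "{x \<otimes> y |x y. x \<in> C \<and> y \<in> C}"
  define T where "T = generated_submodule R V ?T0"
  have T0: "?T0 \<subseteq> carrier V" using CQ by auto
  have T: "submodule T R V" "?T0 \<subseteq> T" "\<And>N. submodule N R V \<Longrightarrow> ?T0 \<subseteq> N \<Longrightarrow> T \<subseteq> N"
    unfolding T_def using V.generated_submodule_sub[OF T0] V.generated_submodule_upper V.generated_submodule_least by auto
  have TS: "T \<subseteq> S" by (rule T(3)[OF S_fsub]) (use S_closed(3) C(3) in blast)
  have CT: "C \<subseteq> T"
  proof
    fix x assume x: "x \<in> C"
    then have "x \<otimes> \<one> \<in> T" using T(2) one by blast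
    then show "x \<in> T" using CQ[OF x] by simp
  qed
  have Tf: "frac T" by (rule between_frac[OF T(1) _ TS]) (use C(2) CT in auto)
  \<comment> \<open>T is C^2. An element q with qC^2 \<subseteq> C satisfies qC \<subseteq> C : C =
    A, so it lies in A : C, hence in A : S by \<open>far\<close>, and A is contained in C.\<close>
  have "?d T \<subseteq> ?d S"
  proof
    fix q assume q: "q \<in> ?d T"
    then have qQ: "q \<in> carrier Q" by (simp add: frac_colon_def)
    have "q \<otimes> x \<in> ?d C" if x: "x \<in> C" for x
    proof -
      have "(q \<otimes> x) \<otimes> y \<in> C" if y: "y \<in> C" for y
      proof -
        have "x \<otimes> y \<in> T" using T(2) x y by blast
        then have "q \<otimes> (x \<otimes> y) \<in> C" using q by (simp add: frac_colon_def)
        then show ?thesis using qQ CQ[OF x] CQ[OF y] by (simp add: m_assoc)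
      qed
      then show ?thesis using qQ CQ[OF x] by (simp add: frac_colon_def)
    qed
    then have "q \<otimes> x \<in> A" if "x \<in> C" for x using that unfolding CC by simp
    then have "q \<in> frac_colon Q A C" using qQ by (simp add: frac_colon_def)
    then have "q \<in> frac_colon Q A S" using far by auto
    then show "q \<in> ?d S" using C(2) by (auto simp: frac_colon_def)
  qed
  then have "?d (?d S) \<subseteq> ?d (?d T)" by (rule colon_antimono)
  then have ST: "S \<subseteq> T" using dd[OF S_frac] dd[OF Tf] by simp
  \<comment> \<open>M is \<mm>C. Its dual is (C : C) : \<mm> = A : \<mm>, while the dual of C is A;
    so C/\<mm>C has the same length r as (A : \<mm>)/A.\<close>
  let ?M0 = "{\<mu> \<otimes> x |\<mu> x. \<mu> \<in> \<mm> \<and> x \<in> C}"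
  define M where "M = generated_submodule R V ?M0"
  have M0: "?M0 \<subseteq> carrier V" using CQ by auto
  have M: "submodule M R V" "?M0 \<subseteq> M" "\<And>N. submodule N R V \<Longrightarrow> ?M0 \<subseteq> N \<Longrightarrow> M \<subseteq> N"
    unfolding M_def using V.generated_submodule_sub[OF M0] V.generated_submodule_upper V.generated_submodule_least by auto
  have MC: "M \<subseteq> C" by (rule M(3)[OF C(1)]) (use fsubD(4)[OF C(1)] in auto)
  have "a \<otimes> \<one> \<in> M" using M(2) a_mem one by blast
  then have "a [^] (1::nat) \<in> M" by simp
  then have Mf: "frac M" using fracI[OF M(1) _ MC Cf] by blast
  have "?d M = frac_colon Q A \<mm>"
  proof
    show "?d M \<subseteq> frac_colon Q A \<mm>"
    proof
      fix q assume q: "q \<in> ?d M"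
      then have qQ: "q \<in> carrier Q" by (simp add: frac_colon_def)
      have "\<mu> \<otimes> q \<in> A" if \<mu>: "\<mu> \<in> \<mm>" for \<mu>
      proof -
        have \<mu>Q: "\<mu> \<in> carrier Q" using \<mu> by auto
        have "(\<mu> \<otimes> q) \<otimes> x \<in> C" if x: "x \<in> C" for x
        proof -
          have "\<mu> \<otimes> x \<in> M" using M(2) \<mu> x by blast
          then have "q \<otimes> (\<mu> \<otimes> x) \<in> C" using q by (simp add: frac_colon_def)
          then show ?thesis using qQ \<mu>Q CQ[OF x] by (simp add: m_ac)
        qed
        then have "\<mu> \<otimes> q \<in> ?d C" using \<mu>Q qQ by (simp add: frac_colon_def)
        then show ?thesis using CC by simp
      qed
      then show "q \<in> frac_colon Q A \<mm>" using qQ by (simp add: colon_\<mm>_mem)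
    qed
    show "frac_colon Q A \<mm> \<subseteq> ?d M"
    proof
      fix q assume "q \<in> frac_colon Q A \<mm>"
      then have q: "q \<in> carrier Q" "\<And>\<mu>. \<mu> \<in> \<mm> \<Longrightarrow> \<mu> \<otimes> q \<in> A" by (auto simp: colon_\<mm>_mem)
      have s: "submodule {x \<in> carrier Q. q \<otimes> x \<in> C} R V"
        using linear_map.sub_vimage[OF mult_linear_map[OF q(1)] C(1)] V.carrier_is_submodule by simp
      have "M \<subseteq> {x \<in> carrier Q. q \<otimes> x \<in> C}"
      proof (rule M(3)[OF s])
        have "q \<otimes> (\<mu> \<otimes> x) \<in> C" if \<mu>: "\<mu> \<in> \<mm>" and x: "x \<in> C" for \<mu> x
        proof -
          have "q \<otimes> (\<mu> \<otimes> x) = (\<mu> \<otimes> q) \<otimes> x" using q(1) \<mu> CQ[OF x] by (simp add: m_ac)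
          then show ?thesis using fsubD(4)[OF C(1) q(2)[OF \<mu>] x] by simp
        qed
        then show "?M0 \<subseteq> {x \<in> carrier Q. q \<otimes> x \<in> C}" using CQ by auto
      qed
      then show "q \<in> ?d M" using q(1) by (auto simp: frac_colon_def)
    qed
  qed
  then have "len M C = enat r" using len_colon[OF Cf type Mf Cf MC] CC r by simp
  then obtain G where G: "finite G" "card G \<le> r" "spans_over R V M G C"
    using V.spanning_set_of_length[OF M(1) C(1) MC, of r] by auto
  have GC: "G \<subseteq> C" using G(3) by (simp add: spans_over_def)
  have Cspan: "C \<subseteq> N" if "submodule N R V" "M \<subseteq> N" "G \<subseteq> N" for N
    using that G(3) by (simp add: spans_over_def)
  let ?G = "(\<lambda>(x, y). x \<otimes> y) ` (G \<times> G)"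
  note aS = sc_fsub[OF a_Q S_fsub]
  have CS: "x \<in> C \<Longrightarrow> x \<in> S" for x using C(3) by auto
  have GS: "?G \<subseteq> S"
  proof (rule image_subsetI)
    fix p assume "p \<in> G \<times> G"
    then obtain g h where p: "p = (g, h)" "g \<in> C" "h \<in> C" using GC by auto
    show "(case p of (x, y) \<Rightarrow> x \<otimes> y) \<in> S"
      using S_closed(3)[OF CS[OF p(2)] CS[OF p(3)]] p(1) by simp
  qed
  have "spans_over R V (sc a S) ?G S"
    unfolding spans_over_def
  proof (intro conjI allI impI)
    show "?G \<subseteq> S" by (rule GS)
    fix N assume N: "submodule N R V" "sc a S \<subseteq> N" "?G \<subseteq> N"
    \<comment> \<open>For fixed x in C, the elements y with xy in N form a submodule. It contains
      \<mm>C, because \<mm>S \<subseteq> aS \<subseteq> N, so it contains C as soon as it contains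
      G. This is applied to each of the two factors in turn.\<close>
    have extend: "\<forall>y\<in>C. x \<otimes> y \<in> N" if x: "x \<in> C" and gen: "\<And>g. g \<in> G \<Longrightarrow> x \<otimes> g \<in> N" for x
    proof -
      have s: "submodule {y \<in> carrier Q. x \<otimes> y \<in> N} R V"
        using linear_map.sub_vimage[OF mult_linear_map[OF CQ[OF x]] N(1)] V.carrier_is_submodule by simp
      have "M \<subseteq> {y \<in> carrier Q. x \<otimes> y \<in> N}"
      proof (rule M(3)[OF s])
        have "x \<otimes> (\<mu> \<otimes> y) \<in> N" if \<mu>: "\<mu> \<in> \<mm>" and y: "y \<in> C" for \<mu> y
        proof -
          have "x \<otimes> (\<mu> \<otimes> y) = \<mu> \<otimes> (x \<otimes> y)" using \<mu> CQ[OF x] CQ[OF y] by (simp add: m_lcomm)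
          then show ?thesis using N(2) \<mm>_S_sub[OF \<mu> S_closed(3)[OF CS[OF x] CS[OF y]]] by auto
        qed
        then show "?M0 \<subseteq> {y \<in> carrier Q. x \<otimes> y \<in> N}" using CQ by auto
      qed
      then have "C \<subseteq> {y \<in> carrier Q. x \<otimes> y \<in> N}"
        by (rule Cspan[OF s]) (use gen GC CQ in auto)
      then show ?thesis by auto
    qed
    have GG: "g \<otimes> h \<in> N" if "g \<in> G" "h \<in> G" for g h using that N(3) by auto
    have "\<forall>y\<in>C. g \<otimes> y \<in> N" if g: "g \<in> G" for g
      using extend[of g] g GC GG by blast
    then have "x \<otimes> g \<in> N" if "x \<in> C" "g \<in> G" for x g
      using that m_comm[OF CQ[OF that(1)], of g] GC CQ by auto
    then have "x \<otimes> y \<in> N" if "x \<in> C" "y \<in> C" for x y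
      using extend[of x] that by blast
    then have "T \<subseteq> N" by (intro T(3)[OF N(1)]) auto
    then show "S \<subseteq> N" using ST by auto
  qed
  moreover have "\<mu> \<odot>\<^bsub>V\<^esub> y \<in> sc a S" if "\<mu> \<in> \<mm>" "y \<in> ?G" for \<mu> y
    using \<mm>_S_sub[OF that(1) subsetD[OF GS that(2)]] by simp
  ultimately have "len (sc a S) S \<le> enat (card ?G)"
    by (intro V.mlen_le_card[OF units _ aS S_fsub sc_sub[OF a_A S_fsub]]) (use G(1) in auto)
  also have "len (sc a S) S = e" by (rule frac_len[OF S_frac])
  also have "enat (card ?G) \<le> enat ((card G + 1) choose 2)"
    using card_products_le[OF G(1), of "\<lambda>x y. x \<otimes> y"] GC CQ by (simp add: m_comm subset_iff)
  also have "\<dots> \<le> enat ((r + 1) choose 2)"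
    using binomial_right_mono[of "card G + 1" "r + 1" 2] G(2) by simp
  finally show ?thesis .
qed

end

section \<open>From the length of R/aR to the Hilbert-Samuel limit\<close>

lemma module_length_quot_ideal:
  assumes I: "ideal I R"
  shows "module_length R (quot_module (ring_module R A) I) = len I A"
proof -
  interpret S: module R "ring_module R A" by (rule R.module_self)
  have Is: "submodule I R (ring_module R A)" using I R.submodule_self_iff by simp
  have lin: "linear_map R (ring_module R A) V (carrier (ring_module R A)) (\<lambda>x. x)"
    by (rule linear_map_V[OF R.module_self]) auto
  have IA: "I \<subseteq> A" using ideal.Icarr[OF I] by auto
  have "mlen R (ring_module R A) {z \<in> carrier (ring_module R A). z \<in> I} (carrier (ring_module R A)) = len I A"
    by (rule linear_map.mlen_vimage[OF lin ideal_fsub[OF I] A_fsub IA])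
      (use V.sum_upper(1)[OF A_fsub ideal_fsub[OF I]] in auto)
  moreover have "{z \<in> carrier (ring_module R A). z \<in> I} = I" using IA by auto
  ultimately show ?thesis using S.module_length_quot[OF Is] by simp
qed

text \<open>From the exponent n0 on, each further power of \<mm> adds exactly k to the colength, so
  the Hilbert-Samuel function is eventually linear with slope k.\<close>

lemma hs_multiplicity_eq:
  assumes dim: "krull_dim R = 1" and k: "e = enat k"
  shows "hs_multiplicity R \<mm> = real k"
proof -
  obtain n0 where n0: "\<And>n. n \<ge> n0 \<Longrightarrow> P (Suc n) = sc a (P n)" using P_reduction by blast
  have Pf: "frac (P n)" for n
  proof -
    have "a [^] n \<in> P n"
    proof (induction n)
      case 0
      show ?case using R.one_closed by simp
    next
      case (Suc n)
      have "a [^] n \<otimes>\<^bsub>R\<^esub> a \<in> P n \<cdot>\<^bsub>R\<^esub> \<mm>" by (rule ideal_prod.prod[OF Suc a_mem])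
      then show ?case by simp
    qed
    then show ?thesis by (rule fracI[OF P_fsub _ P_sub(2) frac_A])
  qed
  obtain c where c: "len (P n0) A = enat c" using len_P_finite[of n0] by auto
  have l: "len (P (n0 + n)) A = enat (c + n * k)" for n
  proof (induction n)
    case 0
    show ?case using c by simp
  next
    case (Suc n)
    have "len (P (Suc (n0 + n))) A = len (P (Suc (n0 + n))) (P (n0 + n)) + len (P (n0 + n)) A"
      by (rule V.mlen_add[OF P_fsub P_fsub A_fsub P_sub])
    also have "len (P (Suc (n0 + n))) (P (n0 + n)) = enat k"
      using frac_len[OF Pf[of "n0 + n"]] n0[of "n0 + n"] k by (simp del: P_simps)
    finally show ?case using Suc by (simp del: P_simps)
  qed
  let ?f = "\<lambda>n. real (the_enat (len (P n) A)) / real n"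
  \<comment> \<open>For n = n0 + m the colength is c + mk = (c - n0 k) + nk, whose quotient by n is
    the expression here.\<close>
  have "(\<lambda>n. (real c - real n0 * real k) * inverse (real n) + real k) \<longlonglongrightarrow> (real c - real n0 * real k) * 0 + real k"
    by (intro tendsto_intros lim_inverse_n)
  moreover have "\<forall>\<^sub>F n in sequentially. (real c - real n0 * real k) * inverse (real n) + real k = ?f n"
  proof (rule eventually_sequentiallyI)
    fix n assume n: "n \<ge> Suc n0"
    then obtain m where m: "n = n0 + m" using le_Suc_ex[of n0 n] by auto
    have "?f n = (real c + real m * real k) / real n" using l[of m] m by simp
    then show "(real c - real n0 * real k) * inverse (real n) + real k = ?f n"
      using n m by (simp add: field_simps)
  qed
  ultimately have "?f \<longlonglongrightarrow> real k" using Lim_transform_eventually by fastforce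
  moreover have "hs_multiplicity R \<mm> = lim ?f"
    unfolding hs_multiplicity_def dim Let_def P_def[symmetric]
    using module_length_quot_ideal[OF P_ideal] by (simp add: one_enat_def)
  ultimately show ?thesis by (simp add: limI)
qed

end

theorem corollary2p7:
  fixes R Q :: "('a, 'b) ring_scheme"
    and \<mm> C :: "'a set"
    and W :: "('a, 'w, 'c) module_scheme"
    and a :: 'a
  assumes "noetherian_ring R"
    and "local_ring R \<mm>"
    and "krull_dim R = 1"
    and "cohen_macaulay R \<mm>"
    and "canonical_module R \<mm> W"
    and "total_ring_of_fractions R Q"
    and "submodule C R (ring_module Q (carrier Q))"
    and "carrier R \<subseteq> C" and "C \<subseteq> integral_closure R Q"
    and "module_iso R (ring_module Q C) W"
    and "finitely_generated_module R (ring_module Q (integral_closure R Q))"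
    and "\<exists>\<nn>. local_ring (Q\<lparr>carrier := integral_closure R Q\<rparr>) \<nn>"
    and "a \<in> \<mm>" and "a \<in> nonzerodivisors R"
    and "reduction_of R (PIdl\<^bsub>R\<^esub> a) \<mm>"
    and "integral_closure R Q \<noteq> carrier R"
    and "far_flung_gorenstein R Q W"
  shows "real (cm_type R \<mm>) + 1 \<le> hs_multiplicity R \<mm> \<and>
         hs_multiplicity R \<mm> \<le> real ((cm_type R \<mm> + 1) choose 2)"
proof -
  have "cring R" "cring Q" "carrier R \<subseteq> carrier Q" "R = Q\<lparr>carrier := carrier R\<rparr>"
    using assms(2,6) subringE(1)[OF subcring.axioms(1)]
    unfolding local_ring_def total_ring_of_fractions_def by auto
  then interpret local_cm_ring Q R \<mm> a
    by (intro local_cm_ring.intro overring.intro overring_axioms.intro local_cm_ring_axioms.intro assms)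
  \<comment> \<open>A local ring is in particular a commutative ring; the closure of S under sums
    and products is drawn from this hypothesis.\<close>
  have S_ring: "cring (Q\<lparr>carrier := S\<rparr>)" using assms(12) by (auto simp: local_ring_def)
  note ctx = S_ring assms(11)
  have D: "{q \<in> carrier Q. \<forall>\<mu>\<in>\<mm>. \<mu> \<otimes>\<^bsub>Q\<^esub> q \<in> X} = frac_colon Q X \<mm>" for X
    using colon_\<mm>_mem by auto
  have W: "module R W" "bass_number R \<mm> W 1 = 1"
    using assms(3,5) by (auto simp: canonical_module_def one_enat_def)
  obtain \<phi> where \<phi>: "\<phi> \<in> module_hom R (ring_module Q C) W" and bij: "bij_betw \<phi> C (carrier W)"
    using assms(10) unfolding module_iso_def by auto
  have type: "len C (frac_colon Q C \<mm>) \<le> 1"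
    using bass_number_1[OF noeth \<mm>_ideal a_mem a_unit W(1) assms(7) \<phi> bij] W(2) unfolding D by simp
  \<comment> \<open>The type is the Bass number of R at its depth, which is 1, so the formula for C
    also applies to R. The identity is restricted to A because homomorphisms are
    extensional.\<close>
  have "len A (frac_colon Q A \<mm>) = bass_number R \<mm> (ring_module R A) 1"
  proof -
    let ?id = "\<lambda>x\<in>A. x"
    have "?id \<in> module_hom R (ring_module Q A) (ring_module R A)"
      using fsubD(3,4)[OF A_fsub] by (auto simp: module_hom_def)
    moreover have "bij_betw ?id A (carrier (ring_module R A))" by (auto simp: bij_betw_def inj_on_def)
    ultimately show ?thesis
      using bass_number_1[OF noeth \<mm>_ideal a_mem a_unit R.module_self A_fsub, of ?id] unfolding D by simp
  qed
  moreover have "depth R \<mm> = 1" using assms(3,4) by (simp add: cohen_macaulay_def)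
  ultimately have r: "cm_type R \<mm> = the_enat (len A (frac_colon Q A \<mm>))"
    by (simp add: cm_type_def one_enat_def)
  obtain k where k: "e = enat k" using e_finite by auto
  \<comment> \<open>Besides the lower bound this yields finiteness of the length, without which
    \<open>the_enat\<close> would not recover it.\<close>
  have lower: "len A (frac_colon Q A \<mm>) + 1 \<le> e" by (rule len_socle_lt[OF ctx assms(16)])
  then obtain r' where r': "len A (frac_colon Q A \<mm>) = enat r'"
    using k by (cases "len A (frac_colon Q A \<mm>)") auto
  have far: "frac_colon Q A C \<subseteq> frac_colon Q A S"
  proof
    fix q assume q: "q \<in> frac_colon Q A C"
    note inv = inverse_linear[OF W(1) assms(7) \<phi> bij]
    interpret p: linear_map R W V "carrier W" "inv_into C \<phi>" by (rule inv(1))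
    have qQ: "q \<in> carrier Q" using q by (simp add: frac_colon_def)
    have one: "\<one>\<^bsub>Q\<^esub> \<in> C" using assms(8) R.one_closed by auto
    \<comment> \<open>Multiplication by q, transported to W. It takes values in A because qC
      \<subseteq> A, and its value at the image of 1 is q, which places q in the trace
      ideal.\<close>
    let ?f = "\<lambda>w\<in>carrier W. q \<otimes>\<^bsub>Q\<^esub> inv_into C \<phi> w"
    have "?f \<in> module_hom R W (ring_module R A)"
      unfolding module_hom_def
    proof (intro CollectI conjI ballI)
      show "?f \<in> carrier W \<rightarrow>\<^sub>E carrier (ring_module R A)"
        using q inv(2) by (auto simp: frac_colon_def)
    qed (use qQ p.\<psi>_closed in \<open>simp_all add: p.\<psi>_add p.\<psi>_smult r_distr m_lcomm\<close>)
    moreover have "?f (\<phi> \<one>\<^bsub>Q\<^esub>) = q" using inv(4,5)[OF one] qQ by simp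
    moreover have "\<phi> \<one>\<^bsub>Q\<^esub> \<in> carrier W" by (rule inv(5)[OF one])
    ultimately have "q \<in> (\<Union>f\<in>module_hom R W (ring_module R A). f ` carrier W)"
      by (metis (no_types, lifting) UN_I imageI)
    moreover have "(\<Union>f\<in>module_hom R W (ring_module R A). f ` carrier W) \<subseteq> A"
      by (auto simp: module_hom_def)
    ultimately have "q \<in> trace_ideal R W"
      unfolding trace_ideal_def using R.genideal_self by blast
    then show "q \<in> frac_colon Q A S" using assms(17) by (simp add: far_flung_gorenstein_def)
  qed
  have upper: "e \<le> enat ((r' + 1) choose 2)"
    by (rule e_le_choose[OF ctx assms(7-9) type far r'])
  have "r' + 1 \<le> k" "k \<le> (r' + 1) choose 2" using lower upper k r' by (auto simp: one_enat_def)
  then have "real r' + 1 \<le> real k" "real k \<le> real ((r' + 1) choose 2)"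
    by linarith+
  then show ?thesis using hs_multiplicity_eq[OF assms(3) k] r r' by simp
qed

end
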